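(* Let $X$ be a Banach lattice and $Y\subset X$ a (closed) ideal. (i) If $X$ is LWCG, then $X/Y$ is LWCG. (ii) If $Y$ is reflexive and $X/Y$ is LWCG, then $X$ is LWCG. (iii) If $X$ is order continuous, $Y$ contains no isomorphic copy of $\ell_1$ and $X/Y$ is WCG, then $X$ is WCG.
   Context: Subspaces, sublattices and ideals are assumed to be (norm) closed. A sublattice of a Banach lattice is a subspace closed under $\vee$ and $\wedge$; an ideal is a subspace $Y$ such that $|x|\le|y|$ with $y\in Y$ implies $x\in Y$. When $Y$ is a closed ideal of $X$, the quotient $X/Y$ is a Banach lattice and the quotient map is a lattice homomorphism. For $A\subset X$, $L(A)$ is the smallest (closed) sublattice of $X$ containing $A$. A Banach lattice $X$ is LWCG if there is a weakly compact set $K\subset X$ with $X=L(K)$. A Banach space $X$ is WCG if there is a weakly compact set $K\subset X$ whose closed linear span is $X$. "Isomorphic" is meant in the Banach space sense (linear homeomorphism onto a subspace). *)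

theory Defs
  imports "HOL-Analysis.Analysis" "HOL-Library.Lattice_Algebras"
begin

section \<open>Banach lattices\<close>

text \<open>The class \<open>lattice_ab_group_add_abs\<close> fixes \<open>\<bar>x\<bar> = sup x (- x)\<close>.\<close>

class banach_lattice = banach + ordered_real_vector + lattice_ab_group_add_abs +
  assumes norm_le_of_abs_le: "\<bar>x\<bar> \<le> \<bar>y\<bar> \<Longrightarrow> norm x \<le> norm y"

instance real :: banach_lattice
  by standard (auto simp: sup_max abs_if)

definition closed_ideal :: "'a::banach_lattice set \<Rightarrow> bool" where
  "closed_ideal Y \<longleftrightarrow>
     subspace Y \<and> closed Y \<and> (\<forall>x y. \<bar>x\<bar> \<le> \<bar>y\<bar> \<longrightarrow> y \<in> Y \<longrightarrow> x \<in> Y)"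

section \<open>Normed spaces and normed lattices on explicit carriers\<close>

text \<open>
  The quotient by an ideal \<open>Y\<close> depends on the term \<open>Y\<close> and therefore is not a type. The notions
  below are defined once for structures with an explicit carrier, so that they apply alike to a
  whole space, to a subspace, to a quotient, to a dual and to \<open>\<ell>\<^sub>1\<close>. These records carry no
  axioms; the definitions are meant for structures that are normed spaces (lattices).
\<close>

record 'v nspace =
  ns_carrier :: "'v set"
  ns_add :: "'v \<Rightarrow> 'v \<Rightarrow> 'v"
  ns_zero :: 'v
  ns_scale :: "real \<Rightarrow> 'v \<Rightarrow> 'v"
  ns_norm :: "'v \<Rightarrow> real"

record 'v nlattice = "'v nspace" +
  nl_le :: "'v \<Rightarrow> 'v \<Rightarrow> bool"

definition ns_dist :: "('v, 'm) nspace_scheme \<Rightarrow> 'v \<Rightarrow> 'v \<Rightarrow> real" where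
  "ns_dist V x y = ns_norm V (ns_add V x (ns_scale V (-1) y))"

definition ns_topology :: "('v, 'm) nspace_scheme \<Rightarrow> 'v topology" where
  "ns_topology V = topology (\<lambda>U. U \<subseteq> ns_carrier V \<and>
     (\<forall>x\<in>U. \<exists>e>0. \<forall>y\<in>ns_carrier V. ns_dist V y x < e \<longrightarrow> y \<in> U))"

lemma openin_ns_topology:
  "openin (ns_topology V) U \<longleftrightarrow> U \<subseteq> ns_carrier V \<and>
     (\<forall>x\<in>U. \<exists>e>0. \<forall>y\<in>ns_carrier V. ns_dist V y x < e \<longrightarrow> y \<in> U)"
proof -
  let ?P = "\<lambda>U. U \<subseteq> ns_carrier V \<and>
     (\<forall>x\<in>U. \<exists>e>0. \<forall>y\<in>ns_carrier V. ns_dist V y x < e \<longrightarrow> y \<in> U)"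
  have "?P (S \<inter> T)" if S: "?P S" and T: "?P T" for S T
  proof (intro conjI ballI)
    show "S \<inter> T \<subseteq> ns_carrier V" using S by blast
    fix x assume x: "x \<in> S \<inter> T"
    obtain d where d: "d > 0" "\<forall>y\<in>ns_carrier V. ns_dist V y x < d \<longrightarrow> y \<in> S"
      using S x by blast
    obtain e where e: "e > 0" "\<forall>y\<in>ns_carrier V. ns_dist V y x < e \<longrightarrow> y \<in> T"
      using T x by blast
    show "\<exists>e>0. \<forall>y\<in>ns_carrier V. ns_dist V y x < e \<longrightarrow> y \<in> S \<inter> T"
      using d e by (intro exI[of _ "min d e"]) auto
  qed
  moreover have "?P (\<Union>\<K>)" if "\<forall>K\<in>\<K>. ?P K" for \<K>
    using that by (metis (no_types, lifting) Union_iff Union_least)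
  ultimately have "istopology ?P"
    unfolding istopology_def by blast
  then show ?thesis
    by (simp add: ns_topology_def topology_inverse')
qed

lemma topspace_ns_topology [simp]: "topspace (ns_topology V) = ns_carrier V"
proof -
  have "openin (ns_topology V) (ns_carrier V)"
    by (auto simp: openin_ns_topology intro: exI[of _ 1])
  then show ?thesis
    by (metis openin_ns_topology openin_subset openin_topspace subset_antisym)
qed

definition ns_linear_on ::
  "('v, 'm) nspace_scheme \<Rightarrow> ('w, 'n) nspace_scheme \<Rightarrow> ('v \<Rightarrow> 'w) \<Rightarrow> bool" where
  "ns_linear_on V W T \<longleftrightarrow>
     (\<forall>x\<in>ns_carrier V. T x \<in> ns_carrier W) \<and>
     (\<forall>x\<in>ns_carrier V. \<forall>y\<in>ns_carrier V. T (ns_add V x y) = ns_add W (T x) (T y)) \<and>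
     (\<forall>r. \<forall>x\<in>ns_carrier V. T (ns_scale V r x) = ns_scale W r (T x))"

definition ns_subspace :: "('v, 'm) nspace_scheme \<Rightarrow> 'v set \<Rightarrow> bool" where
  "ns_subspace V S \<longleftrightarrow>
     S \<subseteq> ns_carrier V \<and> ns_zero V \<in> S \<and>
     (\<forall>x\<in>S. \<forall>y\<in>S. ns_add V x y \<in> S) \<and> (\<forall>r. \<forall>x\<in>S. ns_scale V r x \<in> S)"

subsection \<open>Duality and the weak topology\<close>

definition real_nspace :: "real nspace" where
  "real_nspace = \<lparr>ns_carrier = UNIV, ns_add = (+), ns_zero = 0, ns_scale = (*), ns_norm = abs\<rparr>"

text \<open>Functionals are taken to be \<open>extensional\<close>, so that equal functionals are equal in HOL.\<close>

definition ns_dual :: "('v, 'm) nspace_scheme \<Rightarrow> ('v \<Rightarrow> real) nspace" where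
  "ns_dual V =
    \<lparr>ns_carrier = {f \<in> extensional (ns_carrier V). ns_linear_on V real_nspace f \<and>
                     (\<exists>C. \<forall>x\<in>ns_carrier V. \<bar>f x\<bar> \<le> C * ns_norm V x)},
     ns_add = (\<lambda>f g. \<lambda>x\<in>ns_carrier V. f x + g x),
     ns_zero = (\<lambda>x\<in>ns_carrier V. 0),
     ns_scale = (\<lambda>r f. \<lambda>x\<in>ns_carrier V. r * f x),
     ns_norm = (\<lambda>f. Sup {\<bar>f x\<bar> | x. x \<in> ns_carrier V \<and> ns_norm V x \<le> 1})\<rparr>"

definition ns_reflexive :: "('v, 'm) nspace_scheme \<Rightarrow> bool" where
  "ns_reflexive V \<longleftrightarrow>
     (\<forall>\<phi>\<in>ns_carrier (ns_dual (ns_dual V)).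
        \<exists>x\<in>ns_carrier V. \<forall>f\<in>ns_carrier (ns_dual V). \<phi> f = f x)"

definition weak_topology :: "('v, 'm) nspace_scheme \<Rightarrow> 'v topology" where
  "weak_topology V = topology_generated_by
     {{x \<in> ns_carrier V. f x \<in> U} | f U. f \<in> ns_carrier (ns_dual V) \<and> open U}"


subsection \<open>Isomorphic copies of \<open>\<ell>\<^sub>1\<close>\<close>

definition l1_space :: "(nat \<Rightarrow> real) nspace" where
  "l1_space =
    \<lparr>ns_carrier = {a. summable (\<lambda>n. \<bar>a n\<bar>)},
     ns_add = (\<lambda>a b n. a n + b n),
     ns_zero = (\<lambda>n. 0),
     ns_scale = (\<lambda>r a n. r * a n),
     ns_norm = (\<lambda>a. \<Sum>n. \<bar>a n\<bar>)\<rparr>"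

definition contains_isomorphic_copy ::
  "('v, 'm) nspace_scheme \<Rightarrow> ('w, 'n) nspace_scheme \<Rightarrow> bool" where
  "contains_isomorphic_copy V W \<longleftrightarrow>
     (\<exists>T. ns_linear_on W V T \<and> embedding_map (ns_topology W) (ns_topology V) T)"

subsection \<open>Weakly compact generation\<close>

definition WCG :: "('v, 'm) nspace_scheme \<Rightarrow> bool" where
  "WCG V \<longleftrightarrow>
     (\<exists>K. compactin (weak_topology V) K \<and>
          ns_topology V closure_of (ns_subspace V hull K) = ns_carrier V)"

definition nl_join :: "('v, 'm) nlattice_scheme \<Rightarrow> 'v \<Rightarrow> 'v \<Rightarrow> 'v" where
  "nl_join L x y = (THE z. z \<in> ns_carrier L \<and> nl_le L x z \<and> nl_le L y z \<and>
     (\<forall>u\<in>ns_carrier L. nl_le L x u \<and> nl_le L y u \<longrightarrow> nl_le L z u))"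

definition nl_meet :: "('v, 'm) nlattice_scheme \<Rightarrow> 'v \<Rightarrow> 'v \<Rightarrow> 'v" where
  "nl_meet L x y = (THE z. z \<in> ns_carrier L \<and> nl_le L z x \<and> nl_le L z y \<and>
     (\<forall>u\<in>ns_carrier L. nl_le L u x \<and> nl_le L u y \<longrightarrow> nl_le L u z))"

definition closed_sublattice :: "('v, 'm) nlattice_scheme \<Rightarrow> 'v set \<Rightarrow> bool" where
  "closed_sublattice L S \<longleftrightarrow>
     ns_subspace L S \<and> closedin (ns_topology L) S \<and>
     (\<forall>x\<in>S. \<forall>y\<in>S. nl_join L x y \<in> S \<and> nl_meet L x y \<in> S)"

definition LWCG :: "('v, 'm) nlattice_scheme \<Rightarrow> bool" where
  "LWCG L \<longleftrightarrow>
     (\<exists>K. compactin (weak_topology L) K \<and> closed_sublattice L hull K = ns_carrier L)"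

subsection \<open>Order continuity\<close>

text \<open>
  A net \<open>x\<^sub>\<alpha> \<down> 0\<close> is represented by its range \<open>A\<close>, a downward directed set with infimum \<open>0\<close>,
  indexed by itself: for decreasing nets, \<open>\<parallel>x\<^sub>\<alpha>\<parallel> \<longlongrightarrow> 0\<close> depends only on the range.
\<close>

definition order_continuous :: "('v, 'm) nlattice_scheme \<Rightarrow> bool" where
  "order_continuous L \<longleftrightarrow>
     (\<forall>A. A \<subseteq> ns_carrier L \<and> A \<noteq> {} \<and>
          (\<forall>a\<in>A. \<forall>b\<in>A. \<exists>c\<in>A. nl_le L c a \<and> nl_le L c b) \<and>
          (\<forall>a\<in>A. nl_le L (ns_zero L) a) \<and>
          (\<forall>l\<in>ns_carrier L. (\<forall>a\<in>A. nl_le L l a) \<longrightarrow> nl_le L l (ns_zero L))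
        \<longrightarrow> (\<forall>e>0. \<exists>a\<in>A. \<forall>b\<in>A. nl_le L b a \<longrightarrow> ns_norm L b < e))"

section \<open>The space, its subspaces and its quotients\<close>

definition whole_lattice :: "'a::banach_lattice nlattice" where
  "whole_lattice =
    \<lparr>ns_carrier = UNIV, ns_add = (+), ns_zero = 0, ns_scale = (*\<^sub>R), ns_norm = norm,
     nl_le = (\<le>)\<rparr>"

definition sub_lattice :: "'a::banach_lattice set \<Rightarrow> 'a nlattice" where
  "sub_lattice Y = whole_lattice\<lparr>ns_carrier := Y\<rparr>"

definition coset :: "'a::banach_lattice set \<Rightarrow> 'a \<Rightarrow> 'a set" where
  "coset Y x = (\<lambda>y. x + y) ` Y"

text \<open>
  In the scalar multiple, \<open>Y\<close> is added so that multiplying by \<open>0\<close> gives the coset \<open>Y\<close>. The order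
  is the one whose positive cone is the image of the positive cone.
\<close>

definition quotient_lattice :: "'a::banach_lattice set \<Rightarrow> 'a set nlattice" where
  "quotient_lattice Y =
    \<lparr>ns_carrier = range (coset Y),
     ns_add = (\<lambda>A B. {a + b | a b. a \<in> A \<and> b \<in> B}),
     ns_zero = Y,
     ns_scale = (\<lambda>r A. {r *\<^sub>R a + y | a y. a \<in> A \<and> y \<in> Y}),
     ns_norm = (\<lambda>A. Inf (norm ` A)),
     nl_le = (\<lambda>A B. \<exists>a\<in>A. \<exists>b\<in>B. a \<le> b)\<rparr>"

lemma ns_topology_whole_lattice: "ns_topology whole_lattice = euclidean"
  unfolding topology_eq
  by (auto simp: openin_ns_topology whole_lattice_def ns_dist_def open_dist dist_norm)

lemma nl_join_whole_lattice: "nl_join whole_lattice x y = sup x y"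
  unfolding nl_join_def whole_lattice_def
  by (rule the_equality) (auto intro: order.antisym)

lemma nl_meet_whole_lattice: "nl_meet whole_lattice x y = inf x y"
  unfolding nl_meet_def whole_lattice_def
  by (rule the_equality) (auto intro: order.antisym)

text \<open>The operations of the quotient are those induced by representatives.\<close>

context
  fixes Y :: "'a::banach_lattice set"
  assumes Y: "closed_ideal Y"
begin

lemma closed_ideal_subspace: "subspace Y"
  using Y by (simp add: closed_ideal_def)

lemma closed_ideal_sup:
  assumes "x \<in> Y" "y \<in> Y"
  shows "sup x y \<in> Y"
proof -
  have abs: "\<bar>z\<bar> \<in> Y" if "z \<in> Y" for z
    using Y that unfolding closed_ideal_def by (metis abs_idempotent order_refl)
  have "sup x y \<le> \<bar>x\<bar> + \<bar>y\<bar>"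
    by (meson abs_ge_self abs_ge_zero add_increasing add_increasing2 le_sup_iff)
  moreover have "- sup x y \<le> \<bar>x\<bar> + \<bar>y\<bar>"
    by (meson abs_ge_minus_self abs_ge_zero add_increasing2 dual_order.trans neg_le_iff_le sup_ge1)
  ultimately have "\<bar>sup x y\<bar> \<le> \<bar>\<bar>x\<bar> + \<bar>y\<bar>\<bar>"
    by (simp add: abs_leI)
  moreover have "\<bar>x\<bar> + \<bar>y\<bar> \<in> Y"
    using abs assms closed_ideal_subspace subspace_add by blast
  ultimately show ?thesis
    using Y unfolding closed_ideal_def by blast
qed

lemma mem_coset: "z \<in> coset Y x \<longleftrightarrow> z - x \<in> Y"
  unfolding coset_def by (force simp: image_iff)

lemma coset_eq_iff: "coset Y x = coset Y z \<longleftrightarrow> x - z \<in> Y"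
proof
  assume "coset Y x = coset Y z"
  then show "x - z \<in> Y"
    using mem_coset[of x x] mem_coset[of x z] closed_ideal_subspace by (simp add: subspace_0)
next
  assume *: "x - z \<in> Y"
  have "w - x \<in> Y \<longleftrightarrow> w - z \<in> Y" for w
    using subspace_add[OF closed_ideal_subspace, of "w - x" "x - z"]
      subspace_diff[OF closed_ideal_subspace, of "w - z" "x - z"] * by auto
  then show "coset Y x = coset Y z"
    by (auto simp: mem_coset)
qed

lemma quotient_add:
  "ns_add (quotient_lattice Y) (coset Y x) (coset Y z) = coset Y (x + z)"
proof (intro set_eqI iffI)
  fix w assume "w \<in> ns_add (quotient_lattice Y) (coset Y x) (coset Y z)"
  then obtain a b where "w = a + b" "a - x \<in> Y" "b - z \<in> Y"
    by (auto simp: quotient_lattice_def mem_coset)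
  then show "w \<in> coset Y (x + z)"
    using subspace_add[OF closed_ideal_subspace, of "a - x" "b - z"]
    by (simp add: mem_coset algebra_simps)
next
  fix w assume "w \<in> coset Y (x + z)"
  then have "w = (w - z) + z" "w - z \<in> coset Y x" "z \<in> coset Y z"
    using subspace_0[OF closed_ideal_subspace] by (auto simp: mem_coset algebra_simps)
  then show "w \<in> ns_add (quotient_lattice Y) (coset Y x) (coset Y z)"
    unfolding quotient_lattice_def nspace.simps mem_Collect_eq by blast
qed

lemma quotient_scale:
  "ns_scale (quotient_lattice Y) r (coset Y x) = coset Y (r *\<^sub>R x)"
proof (intro set_eqI iffI)
  fix w assume "w \<in> ns_scale (quotient_lattice Y) r (coset Y x)"
  then obtain a y where "w = r *\<^sub>R a + y" "a - x \<in> Y" "y \<in> Y"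
    by (auto simp: quotient_lattice_def mem_coset)
  then show "w \<in> coset Y (r *\<^sub>R x)"
    using subspace_add[OF closed_ideal_subspace subspace_scale[OF closed_ideal_subspace, of "a - x" r], of y]
    by (simp add: mem_coset algebra_simps)
next
  fix w assume "w \<in> coset Y (r *\<^sub>R x)"
  then have "w = r *\<^sub>R x + (w - r *\<^sub>R x)" "w - r *\<^sub>R x \<in> Y" "x \<in> coset Y x"
    using subspace_0[OF closed_ideal_subspace] by (auto simp: mem_coset)
  then show "w \<in> ns_scale (quotient_lattice Y) r (coset Y x)"
    unfolding quotient_lattice_def nspace.simps mem_Collect_eq by blast
qed

lemma quotient_norm: "ns_norm (quotient_lattice Y) (coset Y x) = infdist x Y"
proof -
  have "norm ` coset Y x = (\<lambda>y. dist x y) ` Y"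
  proof -
    have "norm ` coset Y x = (\<lambda>y. norm (x - y)) ` uminus ` Y"
      by (auto simp: coset_def image_image)
    also have "uminus ` Y = Y"
      using subspace_neg[OF closed_ideal_subspace] by (force simp: image_iff)
    finally show ?thesis by (simp add: dist_norm)
  qed
  moreover have "Y \<noteq> {}"
    using subspace_0[OF closed_ideal_subspace] by auto
  ultimately show ?thesis
    by (simp add: quotient_lattice_def infdist_def)
qed

lemma quotient_le:
  "nl_le (quotient_lattice Y) (coset Y x) (coset Y z) \<longleftrightarrow> (\<exists>y\<in>Y. x \<le> z + y)"
proof
  assume "nl_le (quotient_lattice Y) (coset Y x) (coset Y z)"
  then obtain y y' where "y \<in> Y" "y' \<in> Y" "x + y \<le> z + y'"
    by (auto simp: quotient_lattice_def coset_def)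
  then have "x \<le> z + (y' - y)" "y' - y \<in> Y"
    using subspace_diff[OF closed_ideal_subspace] by (auto simp: algebra_simps)
  then show "\<exists>y\<in>Y. x \<le> z + y" by blast
next
  assume "\<exists>y\<in>Y. x \<le> z + y"
  moreover have "x \<in> coset Y x"
    using subspace_0[OF closed_ideal_subspace] by (simp add: mem_coset)
  moreover have "z + y \<in> coset Y z" if "y \<in> Y" for y
    using that by (simp add: mem_coset)
  ultimately show "nl_le (quotient_lattice Y) (coset Y x) (coset Y z)"
    unfolding quotient_lattice_def by auto
qed

lemma quotient_le_antisym:
  assumes "nl_le (quotient_lattice Y) (coset Y x) (coset Y z)"
    and "nl_le (quotient_lattice Y) (coset Y z) (coset Y x)"
  shows "coset Y x = coset Y z"
proof -
  obtain y y' where *: "y \<in> Y" "x \<le> z + y" "y' \<in> Y" "z \<le> x + y'"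
    using assms by (auto simp: quotient_le)
  then have "0 \<le> z + y - x" "z + y - x \<le> y' + y"
    by (auto simp: algebra_simps)
  then have "\<bar>z + y - x\<bar> \<le> \<bar>y' + y\<bar>"
    by (simp add: order_trans[OF _ abs_ge_self])
  then have "z + y - x \<in> Y"
    using Y subspace_add[OF closed_ideal_subspace *(3,1)] unfolding closed_ideal_def by blast
  then have "y - (z + y - x) \<in> Y"
    by (rule subspace_diff[OF closed_ideal_subspace *(1)])
  then show ?thesis
    by (simp add: coset_eq_iff)
qed

lemma quotient_join:
  "nl_join (quotient_lattice Y) (coset Y x) (coset Y z) = coset Y (sup x z)"
proof -
  let ?Q = "quotient_lattice Y"
  have carrier: "ns_carrier ?Q = range (coset Y)"
    by (simp add: quotient_lattice_def)
  have le: "nl_le ?Q (coset Y a) (coset Y b)" if "a \<le> b" for a b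
    using that subspace_0[OF closed_ideal_subspace] by (auto simp: quotient_le intro: bexI[of _ 0])
  have least: "nl_le ?Q (coset Y (sup x z)) (coset Y u)"
    if bd: "nl_le ?Q (coset Y x) (coset Y u)" "nl_le ?Q (coset Y z) (coset Y u)" for u
  proof -
    obtain y y' where "y \<in> Y" "x \<le> u + y" "y' \<in> Y" "z \<le> u + y'"
      using bd by (auto simp: quotient_le)
    moreover from this have "sup x z \<le> u + sup y y'"
      by (meson add_left_mono le_supI order_trans sup_ge1 sup_ge2)
    ultimately show ?thesis
      using closed_ideal_sup by (auto simp: quotient_le)
  qed
  show ?thesis
    unfolding nl_join_def carrier
  proof (rule the_equality, goal_cases)
    case 1
    show ?case by (auto intro: le least)
  next
    case (2 C)
    then obtain c where "C = coset Y c" by blast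
    moreover have "nl_le ?Q C (coset Y (sup x z))"
      using 2 le by auto
    moreover have "nl_le ?Q (coset Y (sup x z)) C"
      using 2 least \<open>C = coset Y c\<close> by auto
    ultimately show ?case
      using quotient_le_antisym by blast
  qed
qed

lemma quotient_meet:
  "nl_meet (quotient_lattice Y) (coset Y x) (coset Y z) = coset Y (inf x z)"
proof -
  let ?Q = "quotient_lattice Y"
  have carrier: "ns_carrier ?Q = range (coset Y)"
    by (simp add: quotient_lattice_def)
  have le: "nl_le ?Q (coset Y a) (coset Y b)" if "a \<le> b" for a b
    using that subspace_0[OF closed_ideal_subspace] by (auto simp: quotient_le intro: bexI[of _ 0])
  have greatest: "nl_le ?Q (coset Y u) (coset Y (inf x z))"
    if bd: "nl_le ?Q (coset Y u) (coset Y x)" "nl_le ?Q (coset Y u) (coset Y z)" for u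
  proof -
    obtain y y' where *: "y \<in> Y" "u \<le> x + y" "y' \<in> Y" "u \<le> z + y'"
      using bd by (auto simp: quotient_le)
    then have "u - sup y y' \<le> x" "u - sup y y' \<le> z"
      by (meson add_left_mono diff_le_eq order_trans sup_ge1 sup_ge2)+
    then have "u \<le> inf x z + sup y y'"
      by (metis diff_le_eq le_infI)
    then show ?thesis
      using closed_ideal_sup * by (auto simp: quotient_le)
  qed
  show ?thesis
    unfolding nl_meet_def carrier
  proof (rule the_equality, goal_cases)
    case 1
    show ?case by (auto intro: le greatest)
  next
    case (2 C)
    then obtain c where "C = coset Y c" by blast
    moreover have "nl_le ?Q (coset Y (inf x z)) C"
      using 2 le by auto
    moreover have "nl_le ?Q C (coset Y (inf x z))"
      using 2 greatest \<open>C = coset Y c\<close> by auto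
    ultimately show ?case
      using quotient_le_antisym by blast
  qed
qed

end

end

theory Submission
  imports Defs
begin

text \<open>
  Weak compactness is tested on functionals \<open>\<phi>\<close> on the dual: a pointwise bounded set \<open>K\<close> is weakly
  compact iff every \<open>\<phi>\<close> in its weak* closure is evaluation at a point of \<open>K\<close>.

  For (i) and (ii), closed sublattices of \<open>X/Y\<close> are the images of the closed sublattices of \<open>X\<close>
  containing \<open>Y\<close>. If \<open>Y\<close> is reflexive, the part of the unit ball lying over a weakly compact subset
  of \<open>X/Y\<close> is weakly compact: a \<open>\<phi>\<close> in its weak* closure agrees on the annihilator of \<open>Y\<close> with
  some \<open>x\<close>, and \<open>\<phi> - x\<close> is a functional on the dual of \<open>Y\<close>, hence a point of \<open>Y\<close>.

  For (iii), order continuity makes \<open>Y\<close> a projection band, so that \<open>X/Y\<close> lifts linearly to the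
  disjoint complement of \<open>Y\<close>, and it remains to see that \<open>Y\<close> is WCG. Take a maximal disjoint family
  of positive \<open>u\<^sub>i\<close> in the unit ball of \<open>Y\<close>. The order intervals \<open>[0, u\<^sub>i]\<close> are weakly compact, and
  so is their union with \<open>{0}\<close>: otherwise some functional is bounded away from \<open>0\<close> on a bounded
  disjoint sequence, which then spans a copy of \<open>\<ell>\<^sub>1\<close>. By maximality this union has dense span in \<open>Y\<close>.
\<close>

section \<open>Order and norm\<close>

text \<open>The analytic core is the weak compactness of an order interval [0, u]. In a Hilbert
  space a limit point is found by minimizing the norm over shrinking convex sets. Here order
  continuity supplies a substitute: for a prescribed accuracy e there is a positive functional f
  such that f z small and z in [0, u] imply norm z < e. Then f |x - y| acts as a distance, and an
  energy obtained by cutting [0, u] into finitely many levels and applying f is convex enough for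
  the Hilbert space argument. Both f and the energy depend on e, so a limit in e is taken at the
  end.

  In (iii) the disjoint family may be uncountable and its members need have no common upper bound. A
  limit functional different from 0 is therefore localized: a single f0 on which it does not vanish
  singles out finitely many intervals.

  In (ii) the cut with the unit ball does more than bound the set. It bounds the limit functional by
  the dual norm, so that subtracting x leaves a bounded functional on the dual of Y, to which
  reflexivity applies.\<close>

lemma norm_mono_nonneg:
  fixes x y :: "'a::banach_lattice"
  assumes "0 \<le> x" "x \<le> y" shows "norm x \<le> norm y"
  using assms by (intro norm_le_of_abs_le) simp

lemma norm_abs_eq [simp]: "norm \<bar>x\<bar> = norm (x :: 'a::banach_lattice)"
  by (intro antisym norm_le_of_abs_le) auto

lemma sup_diff_le:
  fixes x y z :: "'a::lattice_ab_group_add_abs"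
  shows "sup x z - sup y z \<le> \<bar>x - y\<bar>"
proof -
  have "x \<le> sup y z + \<bar>x - y\<bar>"
    by (metis abs_ge_self add_mono diff_add_cancel add.commute sup_ge1)
  moreover have "z \<le> sup y z + \<bar>x - y\<bar>"
    by (metis abs_ge_zero add_increasing2 sup_ge2)
  ultimately show ?thesis
    by (subst diff_le_eq) (simp add: add.commute)
qed

lemma abs_sup_diff_le:
  fixes x y z :: "'a::lattice_ab_group_add_abs"
  shows "\<bar>sup x z - sup y z\<bar> \<le> \<bar>x - y\<bar>"
proof (rule abs_leI)
  show "- (sup x z - sup y z) \<le> \<bar>x - y\<bar>"
    unfolding minus_diff_eq by (metis sup_diff_le abs_minus_commute)
qed (rule sup_diff_le)

lemma norm_sup_diff_le: "norm (sup x z - sup y z) \<le> norm (x - y :: 'a::banach_lattice)"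
  by (intro norm_le_of_abs_le abs_sup_diff_le)

lemma isCont_sup_left:
  fixes z :: "'a::banach_lattice"
  shows "isCont (\<lambda>x. sup x z) a"
  unfolding isCont_def LIM_eq using norm_sup_diff_le by (metis order_le_less_trans)

text \<open>The cone is the fixed-point set of the map \<open>sup x 0\<close>, which is 1-Lipschitz
  by \<open>norm_sup_diff_le\<close>.\<close>

lemma closed_nonneg: "closed {x :: 'a::banach_lattice. 0 \<le> x}"
proof -
  have "{x :: 'a. 0 \<le> x} = {x. sup x 0 = x}"
    by (auto simp: le_iff_sup sup_commute)
  then show ?thesis
    by (auto intro!: closed_Collect_eq continuous_at_imp_continuous_on isCont_sup_left)
qed

lemma tendsto_le_lattice:
  fixes a b :: "'a::banach_lattice"
  assumes "F \<noteq> bot" "(f \<longlongrightarrow> a) F" "(g \<longlongrightarrow> b) F" "\<forall>\<^sub>F x in F. f x \<le> g x"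
  shows "a \<le> b"
proof -
  have "b - a \<in> {x. 0 \<le> x}"
    by (rule Lim_in_closed_set[OF closed_nonneg _ assms(1) tendsto_diff[OF assms(3,2)]])
      (use assms(4) in simp)
  then show ?thesis by simp
qed

lemma scaleR_sup:
  fixes x y :: "'a::banach_lattice"
  assumes "0 \<le> r" shows "r *\<^sub>R sup x y = sup (r *\<^sub>R x) (r *\<^sub>R y)"
proof (cases "r = 0")
  case False
  with assms have r: "0 < r" by simp
  show ?thesis
  proof (rule antisym)
    have "x \<le> inverse r *\<^sub>R sup (r *\<^sub>R x) (r *\<^sub>R y)" "y \<le> inverse r *\<^sub>R sup (r *\<^sub>R x) (r *\<^sub>R y)"
      using r scaleR_left_mono[OF sup_ge1[of "r *\<^sub>R x" "r *\<^sub>R y"], of "inverse r"]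
        scaleR_left_mono[OF sup_ge2[of "r *\<^sub>R y" "r *\<^sub>R x"], of "inverse r"]
      by simp_all
    then have "sup x y \<le> inverse r *\<^sub>R sup (r *\<^sub>R x) (r *\<^sub>R y)" by simp
    from scaleR_left_mono[OF this assms] show "r *\<^sub>R sup x y \<le> sup (r *\<^sub>R x) (r *\<^sub>R y)"
      using r by simp
  qed (simp add: assms scaleR_left_mono)
qed simp

lemma abs_scaleR_lattice: "\<bar>r *\<^sub>R x\<bar> = \<bar>r\<bar> *\<^sub>R \<bar>x :: 'a::banach_lattice\<bar>"
proof (cases "0 \<le> r")
  case True
  with scaleR_sup[OF True, of x "-x"] show ?thesis
    by (simp add: abs_lattice[where 'a='a] abs_of_nonneg)
next
  case False
  then have "0 \<le> -r" by simp
  from scaleR_sup[OF this, of x "-x"] False show ?thesis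
    by (simp add: abs_lattice[where 'a='a] abs_if sup_commute)
qed

text \<open>The Archimedean property. The multiples of \<open>sup x 0\<close> stay between 0 and
  \<open>y\<close>, so monotonicity of the norm bounds \<open>n * norm (sup x 0)\<close>.\<close>

lemma le_zero_of_scaleR_le:
  fixes x y :: "'a::banach_lattice"
  assumes "\<And>n. real n *\<^sub>R x \<le> y"
  shows "x \<le> 0"
proof -
  have y: "0 \<le> y" using assms[of 0] by simp
  have "real n * norm (sup x 0) \<le> norm y" for n
  proof -
    have "0 \<le> real n *\<^sub>R sup x 0" by (simp add: scaleR_nonneg_nonneg)
    moreover have "real n *\<^sub>R sup x 0 \<le> y" using assms y by (simp add: scaleR_sup)
    ultimately show ?thesis using norm_mono_nonneg by fastforce
  qed
  then have "norm (sup x 0) \<le> 0"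
    by (metis linorder_not_less reals_Archimedean3)
  then show ?thesis by (metis norm_le_zero_iff sup_ge1)
qed

text \<open>The right-hand side measures how far the positive part is from additive; for reals with
  a > 0 > b it equals the left-hand side. With \<open>a = x - t\<close> and \<open>b = y - t\<close>
  the left-hand side sees where \<open>y\<close> lies below the level \<open>t\<close> and
  \<open>x\<close> above it.\<close>

lemma inf_pos_neg_part_le:
  fixes a b :: "'a::lattice_ab_group_add"
  shows "inf (sup a 0) (sup (- b) 0) \<le> sup a 0 + sup b 0 - sup (a + b) 0"
proof -
  let ?m = "inf (sup a 0) (sup (- b) 0)"
  have "sup (- b) 0 = sup b 0 - b"
    using add_sup_distrib_right[of b 0 "- b"] by (simp add: sup_commute)
  then have "?m \<le> sup b 0 - b" by (metis inf_le2)
  then have "a + b + ?m \<le> sup a 0 + sup b 0"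
    using add_mono[of a "sup a 0" "b + ?m" "sup b 0"] by (simp add: algebra_simps)
  moreover have "0 + ?m \<le> sup a 0 + sup b 0"
    by (simp add: add_increasing2 le_infI1)
  ultimately have "sup (a + b) 0 + ?m \<le> sup a 0 + sup b 0"
    by (metis add_sup_distrib_right le_sup_iff)
  then show ?thesis by (subst le_diff_eq) (simp add: add.commute)
qed

lemma sup_diff_zero_eq:
  fixes x t :: "'a::lattice_ab_group_add"
  shows "sup (x - t) 0 = x - inf x t"
  using add_sup_distrib_left[of x "- t" "- x"] by (simp add: sup_commute)

text \<open>A discrete substitute for the formula \<open>\<integral> (x - t)\<^sup>+ \<and> (t - y)\<^sup>+ dt = ((x - y)\<^sup>+)\<^sup>2 / 4\<close>.\<close>

lemma diff_le_sum_inf: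
  fixes x y d :: "'a::banach_lattice"
  assumes "0 \<le> y" "0 \<le> d" "x \<le> real N *\<^sub>R d"
  shows "x - y \<le> d + (\<Sum>i<N. inf (sup (x - real i *\<^sub>R d) 0) (sup (- (y - real i *\<^sub>R d)) 0))"
proof -
  let ?s = "\<lambda>i. inf (sup (x - real i *\<^sub>R d) 0) (sup (- (y - real i *\<^sub>R d)) 0)"
  \<comment> \<open>The induction truncates \<open>x\<close> at level n. The subtracted
    \<open>d\<close> brings the next truncation, at level n + 1, under the level-n difference in
    \<open>?b\<close>; so the new positive part fits under both \<open>?c + ?a\<close> and
    \<open>?c + ?b\<close>, and only \<open>?s n\<close> is added.\<close>
  have "sup (inf x (real n *\<^sub>R d) - y - d) 0 \<le> (\<Sum>i<n. ?s i)" for n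
  proof (induction n)
    case 0
    have "inf x 0 \<le> y + d" using assms by (metis add_increasing le_infI2)
    then have "inf x 0 - y - d \<le> 0" by (simp only: diff_diff_eq diff_le_0_iff_le)
    then show ?case by (simp add: sup_absorb2)
  next
    case (Suc n)
    let ?c = "sup (inf x (real n *\<^sub>R d) - y - d) 0"
    let ?a = "sup (x - real n *\<^sub>R d) 0" and ?b = "sup (- (y - real n *\<^sub>R d)) 0"
    let ?l = "inf x (real (Suc n) *\<^sub>R d) - y - d"
    have "?l \<le> ?c + ?a"
    proof -
      have "x - y - d = (m - y - d) + (x - m)" for m by simp
      from this[of "inf x (real n *\<^sub>R d)"]
      have "x - y - d = (inf x (real n *\<^sub>R d) - y - d) + ?a"
        by (simp only: sup_diff_zero_eq)
      moreover have "?l \<le> x - y - d" by (intro diff_right_mono) simp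
      ultimately have "?l \<le> (inf x (real n *\<^sub>R d) - y - d) + ?a" by (simp only:)
      also have "\<dots> \<le> ?c + ?a" by (intro add_right_mono) simp
      finally show ?thesis .
    qed
    moreover have "?l \<le> ?b"
    proof -
      have "?l \<le> real (Suc n) *\<^sub>R d - y - d" by (intro diff_right_mono) simp
      also have "\<dots> = - (y - real n *\<^sub>R d)" by (simp add: algebra_simps)
      finally show ?thesis by (simp add: le_supI1)
    qed
    ultimately have "sup ?l 0 \<le> inf (?c + ?a) (?c + ?b)"
      by (intro le_infI le_supI add_nonneg_nonneg) (auto intro: add_increasing)
    also have "\<dots> = ?c + ?s n" by (simp add: add_inf_distrib_left)
    also have "\<dots> \<le> (\<Sum>i<n. ?s i) + ?s n" using Suc by (rule add_right_mono)
    finally show ?case by simp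
  qed
  from this[of N] have "x - y - d \<le> (\<Sum>i<N. ?s i)"
    by (simp only: inf_absorb1[OF assms(3)] le_sup_iff)
  then show ?thesis by (subst (asm) diff_le_eq) (simp add: add.commute)
qed

text \<open>Cutting [0, u] into N slices, every crossing of a level between \<open>x\<close> and
  \<open>y\<close> is paid for by an additivity gap. The gap is symmetric in \<open>x\<close> and
  \<open>y\<close>, so one sum bounds both differences; the first term is the thickness of a
  slice.\<close>

lemma abs_diff_le_sum_gap:
  fixes x y u :: "'a::banach_lattice"
  assumes "0 \<le> x" "x \<le> u" "0 \<le> y" "y \<le> u" "0 < N"
  defines "t \<equiv> \<lambda>i. (real i / real N) *\<^sub>R u"
  shows "\<bar>x - y\<bar> \<le> (1 / real N) *\<^sub>R u +
    (\<Sum>i<N. sup (x - t i) 0 + sup (y - t i) 0 - sup ((x - t i) + (y - t i)) 0)"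
    (is "_ \<le> ?d + ?S")
proof -
  have t: "t i = real i *\<^sub>R ?d" for i by (simp add: t_def)
  have d: "0 \<le> ?d" using assms by (simp add: scaleR_nonneg_nonneg order_trans[of 0 x u])
  have u: "u = real N *\<^sub>R ?d" using assms by simp
  have "(\<Sum>i<N. inf (sup (x - t i) 0) (sup (- (y - t i)) 0)) \<le> ?S"
    by (intro sum_mono inf_pos_neg_part_le)
  then have 1: "x - y \<le> ?d + ?S"
    using diff_le_sum_inf[of y ?d x N] assms(1-4) d u unfolding t
    by (metis (no_types, lifting) add_left_mono order_trans)
  have "(\<Sum>i<N. inf (sup (y - t i) 0) (sup (- (x - t i)) 0)) \<le> ?S"
    using inf_pos_neg_part_le[of "y - t i" "x - t i" for i] by (intro sum_mono) (metis add.commute)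
  then have 2: "y - x \<le> ?d + ?S"
    using diff_le_sum_inf[of x ?d y N] assms(1-4) d u unfolding t
    by (metis (no_types, lifting) add_left_mono order_trans)
  show ?thesis
  proof (rule abs_leI)
    show "- (x - y) \<le> ?d + ?S" unfolding minus_diff_eq by (rule 2)
  qed (rule 1)
qed

text \<open>A greedy choice: split off \<open>inf z (v j)\<close>. The remainder is the positive
  part of \<open>z - v j\<close>, which is still dominated by the sum of the other
  \<open>v i\<close>.\<close>

lemma Riesz_decomposition_sum:
  fixes z :: "'a::banach_lattice"
  assumes "finite I" "0 \<le> z" "z \<le> (\<Sum>i\<in>I. v i)" "\<And>i. i \<in> I \<Longrightarrow> 0 \<le> v i"
  shows "\<exists>w. z = (\<Sum>i\<in>I. w i) \<and> (\<forall>i\<in>I. 0 \<le> w i \<and> w i \<le> v i)"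
  using assms
proof (induction I arbitrary: z rule: finite_induct)
  case (insert j I)
  let ?w = "inf z (v j)"
  have "z - ?w = sup 0 (z - v j)"
    by (simp only: sup_diff_zero_eq[symmetric] sup_commute)
  moreover have "z - v j \<le> (\<Sum>i\<in>I. v i)"
    using insert by (subst diff_le_eq) (simp add: add.commute)
  moreover have "0 \<le> (\<Sum>i\<in>I. v i)" using insert.prems by (simp add: sum_nonneg)
  ultimately have "0 \<le> z - ?w" "z - ?w \<le> (\<Sum>i\<in>I. v i)"
    by (simp_all only: sup_ge1 le_sup_iff simp_thms)
  then obtain w where w: "z - ?w = (\<Sum>i\<in>I. w i)" "\<forall>i\<in>I. 0 \<le> w i \<and> w i \<le> v i"
    using insert.IH[of "z - ?w"] insert.prems(3) by auto
  let ?w' = "w(j := ?w)"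
  have "sum ?w' I = sum w I" using insert by (intro sum.cong) auto
  then have "(\<Sum>i\<in>insert j I. ?w' i) = ?w + (z - ?w)"
    using insert.hyps by (simp only: sum.insert fun_upd_same w(1) not_False_eq_True)
  also have "\<dots> = z" by (simp only: add_diff_eq add_diff_cancel_left')
  finally have "z = (\<Sum>i\<in>insert j I. ?w' i)" by (rule sym)
  then show ?case using w insert by (intro exI[of _ ?w']) auto
qed auto

section \<open>Minimal sublinear functionals and the Hahn-Banach theorem\<close>

definition sublinear :: "('a::real_vector \<Rightarrow> real) \<Rightarrow> bool" where
  "sublinear p \<longleftrightarrow> (\<forall>x y. p (x + y) \<le> p x + p y) \<and> (\<forall>r x. 0 \<le> r \<longrightarrow> p (r *\<^sub>R x) = r * p x)"

text \<open>The inequality for all r > 0 gives equality on applying it once more with the factor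
  \<open>inverse r\<close>.\<close>

lemma sublinearI:
  assumes "\<And>x y. p (x + y) \<le> p x + p y" "\<And>r x. 0 < r \<Longrightarrow> p (r *\<^sub>R x) \<le> r * p x" "p 0 = 0"
  shows "sublinear p"
  unfolding sublinear_def
proof (intro conjI allI impI)
  fix r :: real and x assume "0 \<le> r"
  show "p (r *\<^sub>R x) = r * p x"
  proof (cases "r = 0")
    case False
    with \<open>0 \<le> r\<close> have r: "0 < r" by simp
    have "p (inverse r *\<^sub>R r *\<^sub>R x) \<le> inverse r * p (r *\<^sub>R x)" using assms(2) r by (metis positive_imp_inverse_positive)
    then have "r * p x \<le> p (r *\<^sub>R x)" using r by (simp add: field_simps)
    with assms(2)[OF r, of x] show ?thesis by simp
  qed (simp add: assms)
qed (rule assms)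

lemma sublinear_add: "sublinear p \<Longrightarrow> p (x + y) \<le> p x + p y"
  by (simp add: sublinear_def)

lemma sublinear_scaleR: "sublinear p \<Longrightarrow> 0 \<le> r \<Longrightarrow> p (r *\<^sub>R x) = r * p x"
  by (simp add: sublinear_def)

lemma sublinear_0: "sublinear p \<Longrightarrow> p 0 = 0"
  using sublinear_scaleR[of p 0 0] by simp

lemma sublinear_minus: "sublinear p \<Longrightarrow> - p (- x) \<le> p x"
  using sublinear_add[of p x "- x"] sublinear_0[of p] by simp

text \<open>The functional is the infimum over y in \<open>C\<close> of
  \<open>p (x + y) - f y\<close>, which is at least \<open>- p (- x)\<close> because
  \<open>f \<le> p\<close> on \<open>C\<close>. Applied to a ray it shows that minimal sublinear
  functionals are linear; applied to a subspace it prepares an extension.\<close>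

lemma sublinear_Inf_cone:
  fixes p :: "'a::real_vector \<Rightarrow> real" and C :: "'a set" and f :: "'a \<Rightarrow> real"
  assumes p: "sublinear p"
    and C0: "0 \<in> C" and Cadd: "\<And>y z. y \<in> C \<Longrightarrow> z \<in> C \<Longrightarrow> y + z \<in> C \<and> f (y + z) = f y + f z"
    and Csc: "\<And>r y. 0 \<le> r \<Longrightarrow> y \<in> C \<Longrightarrow> r *\<^sub>R y \<in> C \<and> f (r *\<^sub>R y) = r * f y"
    and fp: "\<And>y. y \<in> C \<Longrightarrow> f y \<le> p y"
  obtains q where "sublinear q" "\<And>x. q x \<le> p x" "\<And>y. y \<in> C \<Longrightarrow> q (- y) \<le> - f y"
proof
  let ?S = "\<lambda>x. (\<lambda>y. p (x + y) - f y) ` C"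
  define q where "q x = Inf (?S x)" for x
  have bdd: "bdd_below (?S x)" for x
  proof (rule bdd_belowI2)
    fix y assume "y \<in> C"
    have "p y \<le> p (x + y) + p (- x)" using sublinear_add[OF p, of "x + y" "- x"] by simp
    with fp[OF \<open>y \<in> C\<close>] show "- p (- x) \<le> p (x + y) - f y" by simp
  qed
  have f0: "f 0 = 0" using Csc[OF _ C0, of 0] by simp
  have ne: "?S x \<noteq> {}" for x using C0 by blast
  have le: "q x \<le> p (x + y) - f y" if "y \<in> C" for x y
    unfolding q_def by (rule cInf_lower[OF imageI[OF that] bdd])
  have ge: "c \<le> q x" if "\<And>y. y \<in> C \<Longrightarrow> c \<le> p (x + y) - f y" for c x
    unfolding q_def by (rule cInf_greatest[OF ne]) (use that in blast)
  show "sublinear q"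
  proof (rule sublinearI)
    fix x y
    have 1: "q (x + y) \<le> (p (x + a) - f a) + (p (y + b) - f b)" if "a \<in> C" "b \<in> C" for a b
      using le[of "a + b" "x + y"] Cadd[OF that] sublinear_add[OF p, of "x + a" "y + b"]
      by (simp add: algebra_simps)
    have "q (x + y) - (p (x + a) - f a) \<le> q y" if "a \<in> C" for a
      by (rule ge) (use 1[OF that] in \<open>simp add: algebra_simps\<close>)
    then have "q (x + y) - q y \<le> p (x + a) - f a" if "a \<in> C" for a
      using that by (simp add: algebra_simps)
    then have "q (x + y) - q y \<le> q x" by (rule ge)
    then show "q (x + y) \<le> q x + q y" by simp
  next
    fix r :: real and x assume r: "0 < r"
    have "inverse r * q (r *\<^sub>R x) \<le> q x"
    proof (rule ge)
      fix y assume y: "y \<in> C"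
      have "q (r *\<^sub>R x) \<le> p (r *\<^sub>R (x + y)) - f (r *\<^sub>R y)"
        using le[of "r *\<^sub>R y" "r *\<^sub>R x"] Csc[of r y] y r by (simp add: scaleR_add_right)
      also have "\<dots> = r * (p (x + y) - f y)"
        using Csc[of r y] y r sublinear_scaleR[OF p, of r "x + y"] by (simp add: right_diff_distrib)
      finally show "inverse r * q (r *\<^sub>R x) \<le> p (x + y) - f y"
        using r by (simp add: field_simps)
    qed
    then show "q (r *\<^sub>R x) \<le> r * q x" using r by (simp add: field_simps)
  next
    show "q 0 = 0"
    proof (rule antisym)
      show "q 0 \<le> 0" using le[OF C0, of 0] f0 sublinear_0[OF p] by simp
      show "0 \<le> q 0" by (rule ge) (use fp in simp)
    qed
  qed
  show "q x \<le> p x" for x using le[OF C0, of x] f0 by simp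
  show "q (- y) \<le> - f y" if "y \<in> C" for y using le[OF that, of "- y"] sublinear_0[OF p] by simp
qed

text \<open>The pointwise infimum works. Comparability is used twice: a member lying below
  \<open>p0\<close> is bounded below through \<open>p0 (- x)\<close>, and of two members the smaller
  one serves both summands in the proof of subadditivity.\<close>

lemma sublinear_Inf_chain:
  assumes ch: "\<And>p q. p \<in> C \<Longrightarrow> q \<in> C \<Longrightarrow> p \<le> q \<or> q \<le> p" and ne: "C \<noteq> {}"
    and sub: "\<And>p. p \<in> C \<Longrightarrow> sublinear p"
  obtains q where "sublinear q" "\<And>p. p \<in> C \<Longrightarrow> q \<le> p"
proof
  define q where "q x = (INF p\<in>C. p x)" for x
  obtain p0 where p0: "p0 \<in> C" using ne by blast
  have bdd: "bdd_below ((\<lambda>p. p x) ` C)" for x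
  proof (rule bdd_belowI2)
    fix p assume p: "p \<in> C"
    have "- max (p (- x)) (p0 (-x)) \<le> p x" using sublinear_minus[OF sub[OF p], of x] by auto
    moreover have "p (-x) \<le> p0 (-x) \<or> p0 x \<le> p x" using ch[OF p p0] by (auto simp: le_fun_def)
    ultimately show "min (- p0 (- x)) (p0 x) \<le> p x"
      using sublinear_minus[OF sub[OF p], of x] by auto
  qed
  have le: "q x \<le> p x" if "p \<in> C" for p x
    unfolding q_def by (rule cINF_lower[OF bdd that])
  have ge: "c \<le> q x" if "\<And>p. p \<in> C \<Longrightarrow> c \<le> p x" for c x
    unfolding q_def by (rule cINF_greatest[OF ne that])
  show "q \<le> p" if "p \<in> C" for p using le[OF that] by (simp add: le_fun_def)
  show "sublinear q"
  proof (rule sublinearI)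
    fix x y
    have 1: "q (x + y) \<le> p x + p' y" if "p \<in> C" "p' \<in> C" for p p'
      using ch[OF that] le[OF that(1), of "x + y"] le[OF that(2), of "x + y"]
        sublinear_add[OF sub[OF that(1)], of x y] sublinear_add[OF sub[OF that(2)], of x y]
      by (fastforce simp: le_fun_def dest: spec[of _ x] spec[of _ y])
    have "q (x + y) - p x \<le> q y" if "p \<in> C" for p
      by (rule ge) (use 1[OF that] in \<open>simp add: algebra_simps\<close>)
    then have "q (x + y) - q y \<le> p x" if "p \<in> C" for p
      using that by (simp add: algebra_simps)
    then have "q (x + y) - q y \<le> q x" by (rule ge)
    then show "q (x + y) \<le> q x + q y" by simp
  next
    fix r :: real and x assume r: "0 < r"
    have "inverse r * q (r *\<^sub>R x) \<le> q x"
    proof (rule ge)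
      fix p assume p: "p \<in> C"
      show "inverse r * q (r *\<^sub>R x) \<le> p x"
        using le[OF p, of "r *\<^sub>R x"] sublinear_scaleR[OF sub[OF p], of r x] r
        by (simp add: field_simps)
    qed
    then show "q (r *\<^sub>R x) \<le> r * q x" using r by (simp add: field_simps)
  next
    have "(\<lambda>p. p 0) ` C = {0}" using sublinear_0[OF sub] ne by force
    then show "q 0 = 0" unfolding q_def by simp
  qed
qed

text \<open>Zorn's lemma for the reversed order gives a minimal sublinear \<open>m\<close>.
  Shrinking \<open>m\<close> along the ray through \<open>z\<close> cannot change it, and this
  forces \<open>m (- z) = - m z\<close>; a subadditive odd functional is additive.\<close>

lemma linear_below_sublinear:
  fixes p :: "'a::real_vector \<Rightarrow> real"
  assumes "sublinear p"
  obtains f where "linear f" "\<And>x. f x \<le> p x"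
proof -
  let ?A = "{q. sublinear q \<and> q \<le> p}"
  have po: "partial_order_on ?A (relation_of (\<lambda>q r. r \<le> q) ?A)"
    by (rule partial_order_on_relation_ofI) auto
  have "\<exists>m\<in>?A. \<forall>a\<in>?A. a \<le> m \<longrightarrow> a = m"
  proof (rule predicate_Zorn[OF po])
    fix C assume C: "C \<in> Chains (relation_of (\<lambda>q r. r \<le> q) ?A)"
    show "\<exists>u\<in>?A. \<forall>a\<in>C. u \<le> a"
    proof (cases "C = {}")
      case True then show ?thesis using assms by auto
    next
      case False
      have CA: "C \<subseteq> ?A" using Chains_relation_of[OF C] .
      have "q \<le> r \<or> r \<le> q" if "q \<in> C" "r \<in> C" for q r
        using C that by (auto simp: Chains_def relation_of_def)
      then obtain u where "sublinear u" "\<And>q. q \<in> C \<Longrightarrow> u \<le> q"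
        using sublinear_Inf_chain[of C] CA False by (smt (verit) mem_Collect_eq subsetD)
      then show ?thesis using CA False by (metis (mono_tags, lifting) all_not_in_conv mem_Collect_eq order_trans subsetD)
    qed
  qed
  then obtain m where m: "sublinear m" "m \<le> p" and min: "\<And>a. sublinear a \<Longrightarrow> a \<le> m \<Longrightarrow> a = m"
    by (auto intro: order_trans)
  have neg: "m (- z) = - m z" for z
  proof -
    have "z \<noteq> 0 \<Longrightarrow> \<exists>f. (\<forall>r. f (r *\<^sub>R z) = r * m z)"
      by (rule exI[of _ "\<lambda>y. (SOME r. y = r *\<^sub>R z) * m z"]) simp
    then obtain f where f: "\<And>r. f (r *\<^sub>R z) = r * m z"
      using sublinear_0[OF m(1)] by (cases "z = 0") auto
    let ?C = "(\<lambda>r. r *\<^sub>R z) ` {0..}"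
    obtain q where q: "sublinear q" "\<And>x. q x \<le> m x" "\<And>y. y \<in> ?C \<Longrightarrow> q (- y) \<le> - f y"
    proof (rule sublinear_Inf_cone[OF m(1), of ?C f])
      show "y + y' \<in> ?C \<and> f (y + y') = f y + f y'" if "y \<in> ?C" "y' \<in> ?C" for y y'
        using that f by (auto simp flip: scaleR_add_left simp: distrib_right)
      show "r *\<^sub>R y \<in> ?C \<and> f (r *\<^sub>R y) = r * f y" if "0 \<le> r" "y \<in> ?C" for r y
        using that f by auto
      show "f y \<le> m y" if "y \<in> ?C" for y using that f sublinear_scaleR[OF m(1)] by auto
    qed (auto intro: rev_image_eqI[of 0])
    then have "q = m" by (intro min) (auto simp: le_fun_def)
    moreover have "q (- z) \<le> - f z" by (rule q(3)) (auto intro: rev_image_eqI[of 1])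
    ultimately show ?thesis using f[of 1] sublinear_minus[OF m(1), of "-z"] by simp
  qed
  have "linear m"
  proof (rule linearI)
    fix x y
    show "m (x + y) = m x + m y"
      using sublinear_add[OF m(1), of x y] sublinear_add[OF m(1), of "- x" "- y"] neg[of x] neg[of y] neg[of "x + y"]
      by simp
    show "m (r *\<^sub>R x) = r *\<^sub>R m x" for r
      using sublinear_scaleR[OF m(1), of r x] sublinear_scaleR[OF m(1), of "- r" x] neg[of "r *\<^sub>R x"]
      by (cases "0 \<le> r") auto
  qed
  with m(2) that show ?thesis by (auto simp: le_fun_def)
qed

text \<open>Once \<open>p\<close> is lowered to \<open>q\<close>, every linear \<open>g\<close>
  below \<open>q\<close> satisfies \<open>f \<le> g\<close> on \<open>Y\<close>, and replacing
  \<open>y\<close> by \<open>- y\<close> gives equality.\<close>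

lemma Hahn_Banach_subspace:
  fixes p :: "'a::real_vector \<Rightarrow> real"
  assumes p: "sublinear p" and Y: "subspace Y"
    and f: "\<And>x y. x \<in> Y \<Longrightarrow> y \<in> Y \<Longrightarrow> f (x + y) = f x + f y" "\<And>r x. x \<in> Y \<Longrightarrow> f (r *\<^sub>R x) = r * f x"
      "\<And>x. x \<in> Y \<Longrightarrow> f x \<le> p x"
  obtains g where "linear g" "\<And>x. g x \<le> p x" "\<And>y. y \<in> Y \<Longrightarrow> g y = f y"
proof -
  obtain q where q: "sublinear q" "\<And>x. q x \<le> p x" "\<And>y. y \<in> Y \<Longrightarrow> q (- y) \<le> - f y"
    by (rule sublinear_Inf_cone[OF p, of Y f])
      (auto simp: f subspace_0[OF Y] subspace_add[OF Y] subspace_scale[OF Y])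
  obtain g where g: "linear g" "\<And>x. g x \<le> q x" using linear_below_sublinear[OF q(1)] by blast
  have le: "f y \<le> g y" if "y \<in> Y" for y
    using g(2)[of "- y"] q(3)[OF that] linear_neg[OF g(1), of y] by simp
  show ?thesis
  proof
    show "g y = f y" if "y \<in> Y" for y
      using le[OF that] le[of "- y"] f(2)[OF that, of "-1"] linear_neg[OF g(1), of y]
        subspace_neg[OF Y that] by simp
  qed (use g q in \<open>auto intro: order_trans\<close>)
qed

lemma Hahn_Banach_point:
  fixes p :: "'a::real_vector \<Rightarrow> real"
  assumes p: "sublinear p"
  obtains g where "linear g" "\<And>x. g x \<le> p x" "g z = p z"
proof -
  let ?Y = "range (\<lambda>r. r *\<^sub>R z)"
  \<comment> \<open>The coefficient of \<open>z\<close> is determined only for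
    \<open>z \<noteq> 0\<close>. For \<open>z = 0\<close> the value 0 is the right one, since
    \<open>p 0 = 0\<close>.\<close>
  define f where "f y = (if z = 0 then 0 else (SOME r. y = r *\<^sub>R z) * p z)" for y
  have f: "f (r *\<^sub>R z) = r * p z" for r
    using sublinear_0[OF p] by (simp add: f_def)
  have "\<exists>g. linear g \<and> (\<forall>x. g x \<le> p x) \<and> (\<forall>y\<in>?Y. g y = f y)"
  proof (rule Hahn_Banach_subspace[OF p, of ?Y f])
    show "subspace ?Y" using subspace_span[of "{z}"] by (simp add: span_singleton)
    show "f (x + y) = f x + f y" if "x \<in> ?Y" "y \<in> ?Y" for x y
      using that f by (auto simp flip: scaleR_add_left simp: distrib_right)
    show "f (r *\<^sub>R x) = r * f x" if "x \<in> ?Y" for r x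
      using that f by auto
    show "f y \<le> p y" if y: "y \<in> ?Y" for y
    proof -
      obtain r where r: "y = r *\<^sub>R z" using y by blast
      show ?thesis
      proof (cases "0 \<le> r")
        case True then show ?thesis using r f sublinear_scaleR[OF p] by simp
      next
        case False
        then have "p (- y) = - r * p z" using sublinear_scaleR[OF p, of "- r" z] r by simp
        then show ?thesis using r f sublinear_minus[OF p, of y] by simp
      qed
    qed
  qed blast
  then show ?thesis using that f[of 1] by (metis rangeI scaleR_one mult_1)
qed

section \<open>Bounded functionals attaining the norm\<close>

lemma sublinear_norm: "0 \<le> c \<Longrightarrow> sublinear (\<lambda>x. c * norm x)"
  unfolding sublinear_def
  by (auto intro: mult_left_mono norm_triangle_ineq simp flip: distrib_left)

lemma bounded_linear_of_le_norm:
  fixes f :: "'a::real_normed_vector \<Rightarrow> real"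
  assumes "linear f" "\<And>x. f x \<le> c * norm x"
  shows "bounded_linear f" "\<bar>f x\<bar> \<le> c * norm x"
proof -
  have *: "\<bar>f x\<bar> \<le> c * norm x" for x
    using assms(2)[of x] assms(2)[of "- x"] linear_neg[OF assms(1), of x] by simp
  then show "\<bar>f x\<bar> \<le> c * norm x" .
  show "bounded_linear f"
    using assms(1) * by (auto simp: bounded_linear_def bounded_linear_axioms_def mult.commute)
qed

lemma norming_functional:
  fixes x :: "'a::real_normed_vector"
  obtains f where "bounded_linear f" "\<And>y. \<bar>f y\<bar> \<le> norm y" "f x = norm x"
proof -
  obtain f where f: "linear f" "\<And>y. f y \<le> 1 * norm y" "f x = 1 * norm x"
    by (rule Hahn_Banach_point[OF sublinear_norm[of 1]]) auto
  then show ?thesis using that bounded_linear_of_le_norm[OF f(1,2)] by simp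
qed

text \<open>Domination by the norm of the positive part forces positivity: for
  \<open>0 \<le> y\<close> it gives \<open>f (- y) \<le> 0\<close>.\<close>

lemma norming_functional_nonneg:
  fixes x :: "'a::banach_lattice"
  assumes "0 \<le> x"
  obtains f where "bounded_linear f" "\<And>y. \<bar>f y\<bar> \<le> norm y" "f x = norm x" "\<And>y. 0 \<le> y \<Longrightarrow> 0 \<le> f y"
proof -
  let ?p = "\<lambda>y :: 'a. norm (sup y 0)"
  have "sublinear ?p"
    unfolding sublinear_def
  proof (intro conjI allI impI)
    fix y z :: 'a
    have "sup (y + z) 0 \<le> sup y 0 + sup z 0" by (simp add: add_mono)
    then have "norm (sup (y + z) 0) \<le> norm (sup y 0 + sup z 0)" by (intro norm_mono_nonneg) auto
    then show "?p (y + z) \<le> ?p y + ?p z" using norm_triangle_ineq order_trans by blast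
  next
    fix r :: real and y :: 'a assume "0 \<le> r"
    then show "?p (r *\<^sub>R y) = r * ?p y" using scaleR_sup[of r y 0] by (metis abs_of_nonneg norm_scaleR scaleR_zero_right)
  qed
  then obtain f where f: "linear f" "\<And>y. f y \<le> ?p y" "f x = ?p x"
    using Hahn_Banach_point[of ?p x] by blast
  have "?p y \<le> norm y" for y :: 'a
    using norm_mono_nonneg[of "sup y 0" "\<bar>y\<bar>"] abs_ge_self[of y] by simp
  then have f1: "f y \<le> 1 * norm y" for y using f(2)[of y] by (metis mult_1 order_trans)
  have "0 \<le> f y" if "0 \<le> y" for y
    using f(2)[of "- y"] linear_neg[OF f(1), of y] that by (simp add: sup_absorb2)
  then show ?thesis using that bounded_linear_of_le_norm[OF f(1) f1] f(3) assms
    by (simp add: sup_absorb1)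
qed

section \<open>Weak compactness\<close>

abbreviation dual_carrier :: "('v, 'm) nspace_scheme \<Rightarrow> ('v \<Rightarrow> real) set" where
  "dual_carrier V \<equiv> ns_carrier (ns_dual V)"

text \<open>The canonical map into a product of real lines indexed by the dual; the restriction
  makes each value a point of that product.\<close>

definition evaluations :: "('v, 'm) nspace_scheme \<Rightarrow> 'v \<Rightarrow> ('v \<Rightarrow> real) \<Rightarrow> real" where
  "evaluations V x = (\<lambda>f\<in>dual_carrier V. f x)"

text \<open>The universal property of an initial topology. One functional in the dual is used to see
  that the subbasis covers the carrier.\<close>

lemma continuous_map_into_weak:
  assumes "g \<in> topspace X \<rightarrow> ns_carrier V" "dual_carrier V \<noteq> {}"
    "\<And>f. f \<in> dual_carrier V \<Longrightarrow> continuous_map X euclideanreal (\<lambda>x. f (g x))"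
  shows "continuous_map X (weak_topology V) g"
  unfolding weak_topology_def
proof (rule continuous_on_generated_topo)
  fix U assume "U \<in> {{x \<in> ns_carrier V. f x \<in> U} |f U. f \<in> dual_carrier V \<and> open U}"
  then obtain f W where U: "U = {x \<in> ns_carrier V. f x \<in> W}" "f \<in> dual_carrier V" "open W" by blast
  have "g -` U \<inter> topspace X = {x \<in> topspace X. f (g x) \<in> W}" using assms(1) U(1) by auto
  also have "openin X \<dots>"
    using openin_continuous_map_preimage[OF assms(3)[OF U(2)], of W] U(3) by simp
  finally show "openin X (g -` U \<inter> topspace X)" .
next
  obtain f where f: "f \<in> dual_carrier V" using assms(2) by blast
  have "ns_carrier V = {x \<in> ns_carrier V. f x \<in> UNIV}" by simp
  with f open_UNIV have "ns_carrier V \<in> {{x \<in> ns_carrier V. f x \<in> U} |f U. f \<in> dual_carrier V \<and> open U}"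
    by blast
  then show "g ` topspace X \<subseteq> \<Union> {{x \<in> ns_carrier V. f x \<in> U} |f U. f \<in> dual_carrier V \<and> open U}"
    using assms(1) by blast
qed

lemma topspace_weak_topology:
  assumes "dual_carrier V \<noteq> {}"
  shows "topspace (weak_topology V) = ns_carrier V"
proof -
  obtain f where f: "f \<in> dual_carrier V" using assms by blast
  have "ns_carrier V = {x \<in> ns_carrier V. f x \<in> UNIV}" by simp
  with f open_UNIV have "ns_carrier V \<in> {{x \<in> ns_carrier V. f x \<in> U} |f U. f \<in> dual_carrier V \<and> open U}"
    by blast
  then show ?thesis unfolding weak_topology_def topology_generated_by_topspace by auto
qed

lemma continuous_map_weak_functional:
  assumes "f \<in> dual_carrier V"
  shows "continuous_map (weak_topology V) euclideanreal f"
proof -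
  have ne: "dual_carrier V \<noteq> {}" using assms by blast
  show ?thesis
    unfolding continuous_map_def topspace_weak_topology[OF ne]
  proof (intro conjI allI impI)
    fix U :: "real set" assume "openin euclideanreal U"
    then show "openin (weak_topology V) {x \<in> ns_carrier V. f x \<in> U}"
      unfolding weak_topology_def using assms
      by (intro topology_generated_by_Basis) auto
  qed simp
qed

text \<open>On an abstract carrier the functionals need not separate points, so evaluation may fail
  to be injective. The converse uses a section \<open>h\<close> of it: points with equal evaluations
  belong to the same weakly open sets, so a finite cover of the image of \<open>h\<close> covers
  \<open>K\<close>.\<close>

lemma compactin_weak_iff_evaluations:
  assumes "dual_carrier V \<noteq> {}"
  shows "compactin (weak_topology V) K \<longleftrightarrow> K \<subseteq> ns_carrier V \<and>
    compactin (product_topology (\<lambda>_. euclideanreal) (dual_carrier V)) (evaluations V ` K)"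
    (is "_ \<longleftrightarrow> _ \<and> compactin ?P _")
proof (intro iffI conjI)
  assume K: "compactin (weak_topology V) K"
  then show "K \<subseteq> ns_carrier V"
    using compactin_subset_topspace topspace_weak_topology[OF assms] by blast
  have "continuous_map (weak_topology V) ?P (evaluations V)"
    unfolding continuous_map_componentwise evaluations_def
    by (auto intro: continuous_map_weak_functional simp: continuous_map_eq)
  then show "compactin ?P (evaluations V ` K)" using K image_compactin by blast
next
  assume *: "K \<subseteq> ns_carrier V \<and> compactin ?P (evaluations V ` K)"
  have K: "K \<subseteq> ns_carrier V" using * by blast
  define h where "h p = (SOME x. x \<in> K \<and> evaluations V x = p)" for p
  have h: "h p \<in> K" "evaluations V (h p) = p" if "p \<in> evaluations V ` K" for p
    using someI_ex[of "\<lambda>x. x \<in> K \<and> evaluations V x = p"] that by (auto simp: h_def)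
  show "compactin (weak_topology V) K"
    unfolding compactin_def
  proof (intro conjI allI impI)
    show "K \<subseteq> topspace (weak_topology V)" using K topspace_weak_topology[OF assms] by simp
    fix \<U> assume \<U>: "Ball \<U> (openin (weak_topology V)) \<and> K \<subseteq> \<Union> \<U>"
    have cont: "continuous_map (subtopology ?P (evaluations V ` K)) (weak_topology V) h"
    proof (rule continuous_map_into_weak[OF _ assms])
      show "h \<in> topspace (subtopology ?P (evaluations V ` K)) \<rightarrow> ns_carrier V" using h K by auto
      fix f assume f: "f \<in> dual_carrier V"
      have "continuous_map ?P euclideanreal (\<lambda>p. p f)" by (rule continuous_map_product_projection[OF f])
      then have "continuous_map (subtopology ?P (evaluations V ` K)) euclideanreal (\<lambda>p. p f)"
        by (rule continuous_map_from_subtopology)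
      then show "continuous_map (subtopology ?P (evaluations V ` K)) euclideanreal (\<lambda>x. f (h x))"
      proof (rule continuous_map_eq)
        fix p assume "p \<in> topspace (subtopology ?P (evaluations V ` K))"
        then have "evaluations V (h p) f = p f" using h by simp
        then show "p f = f (h p)" using f by (simp add: evaluations_def)
      qed
    qed
    have compact_sub: "compactin (subtopology ?P (evaluations V ` K)) (evaluations V ` K)"
      using * by (simp add: compactin_subtopology)
    have same: "x \<in> U \<longleftrightarrow> h (evaluations V x) \<in> U"
      if "x \<in> K" "openin (weak_topology V) U" for x U
    proof -
      let ?y = "h (evaluations V x)"
      have y: "?y \<in> K" "evaluations V ?y = evaluations V x" using h that(1) by auto
      have eq: "f ?y = f x" if "f \<in> dual_carrier V" for f
        using fun_cong[OF y(2), of f] that by (simp add: evaluations_def)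
      have "\<forall>U. generate_topology_on {{x \<in> ns_carrier V. f x \<in> U} |f U. f \<in> dual_carrier V \<and> open U} U
         \<longrightarrow> (x \<in> U \<longleftrightarrow> ?y \<in> U)"
      proof (intro allI impI)
        fix U assume "generate_topology_on {{x \<in> ns_carrier V. f x \<in> U} |f U. f \<in> dual_carrier V \<and> open U} U"
        then show "x \<in> U \<longleftrightarrow> ?y \<in> U"
        proof induction
          case (Basis S)
          then obtain f W where "S = {x \<in> ns_carrier V. f x \<in> W}" "f \<in> dual_carrier V" by blast
          then show ?case using eq[of f] y(1) that(1) K by auto
        qed auto
      qed
      then show ?thesis using that(2) unfolding weak_topology_def openin_topology_generated_by_iff by blast
    qed
    have "compactin (weak_topology V) (h ` evaluations V ` K)"
      using image_compactin[OF compact_sub cont] .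
    moreover have "h ` evaluations V ` K \<subseteq> \<Union> \<U>" using h \<U> by auto
    ultimately have "\<exists>\<F>. finite \<F> \<and> \<F> \<subseteq> \<U> \<and> h ` evaluations V ` K \<subseteq> \<Union> \<F>"
      using \<U> unfolding compactin_def by simp
    then obtain \<F> where \<F>: "finite \<F>" "\<F> \<subseteq> \<U>" "h ` evaluations V ` K \<subseteq> \<Union> \<F>"
      by (elim exE conjE)
    have "x \<in> \<Union> \<F>" if "x \<in> K" for x
    proof -
      have "h (evaluations V x) \<in> \<Union> \<F>"
        using \<F>(3) by (rule subsetD) (intro imageI that)
      then obtain U where U: "U \<in> \<F>" "h (evaluations V x) \<in> U" by (rule UnionE)
      then have "openin (weak_topology V) U" using \<F>(2) \<U> by auto
      then show ?thesis using same[OF that] U by auto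
    qed
    then show "\<exists>\<F>. finite \<F> \<and> \<F> \<subseteq> \<U> \<and> K \<subseteq> \<Union> \<F>"
      using \<F> by (intro exI[of _ \<F>]) auto
  qed
qed

text \<open>Approximability of \<open>\<phi>\<close> by \<open>K\<close> means that \<open>\<phi>\<close> lies in the weak* closure of \<open>K\<close>.\<close>

definition approximable :: "('v \<Rightarrow> real) set \<Rightarrow> 'v set \<Rightarrow> (('v \<Rightarrow> real) \<Rightarrow> real) \<Rightarrow> bool" where
  "approximable D K \<phi> \<longleftrightarrow>
     (\<forall>F e. finite F \<longrightarrow> F \<subseteq> D \<longrightarrow> 0 < e \<longrightarrow> (\<exists>x\<in>K. \<forall>f\<in>F. \<bar>f x - \<phi> f\<bar> < e))"

lemma approximableD:
  assumes "approximable D K \<phi>" "finite F" "F \<subseteq> D" "0 < e"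
  obtains x where "x \<in> K" "\<And>f. f \<in> F \<Longrightarrow> \<bar>f x - \<phi> f\<bar> < e"
proof -
  have "\<exists>x\<in>K. \<forall>f\<in>F. \<bar>f x - \<phi> f\<bar> < e"
    using assms(1)[unfolded approximable_def, rule_format, OF assms(2,3,4)] .
  then show ?thesis using that by auto
qed

lemma in_closure_evaluations:
  assumes "K \<subseteq> ns_carrier V"
  shows "\<phi> \<in> product_topology (\<lambda>_. euclideanreal) (dual_carrier V) closure_of (evaluations V ` K)
    \<longleftrightarrow> \<phi> \<in> extensional (dual_carrier V) \<and> approximable (dual_carrier V) K \<phi>"
    (is "_ \<in> ?P closure_of _ \<longleftrightarrow> _")
proof (intro iffI conjI)
  assume \<phi>: "\<phi> \<in> ?P closure_of (evaluations V ` K)"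
  then have "\<phi> \<in> topspace ?P" by (rule subsetD[OF closure_of_subset_topspace])
  then show ext: "\<phi> \<in> extensional (dual_carrier V)" by (simp add: PiE_def)
  show "approximable (dual_carrier V) K \<phi>"
    unfolding approximable_def
  proof (intro allI impI)
    fix F and e :: real assume F: "finite F" "F \<subseteq> dual_carrier V" "0 < e"
    let ?U = "\<lambda>f. if f \<in> F then ball (\<phi> f) e else UNIV"
    have "{f \<in> dual_carrier V. ?U f \<noteq> topspace euclideanreal} \<subseteq> F" by auto
    then have "finite {f \<in> dual_carrier V. ?U f \<noteq> topspace euclideanreal}"
      using F(1) by (rule finite_subset)
    then have "openin ?P (PiE (dual_carrier V) ?U)"
      by (subst openin_PiE_gen) auto
    moreover have "\<phi> \<in> PiE (dual_carrier V) ?U" using ext F(3) by (auto simp: PiE_def)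
    ultimately obtain x where "x \<in> K" "evaluations V x \<in> PiE (dual_carrier V) ?U"
      using \<phi> unfolding in_closure_of by blast
    then show "\<exists>x\<in>K. \<forall>f\<in>F. \<bar>f x - \<phi> f\<bar> < e"
      using F(2) by (intro bexI[of _ x])
        (force simp: evaluations_def PiE_def Pi_def dist_real_def abs_minus_commute split: if_splits)+
  qed
next
  assume *: "\<phi> \<in> extensional (dual_carrier V) \<and> approximable (dual_carrier V) K \<phi>"
  show "\<phi> \<in> ?P closure_of (evaluations V ` K)"
    unfolding in_closure_of
  proof (intro conjI allI impI)
    show "\<phi> \<in> topspace ?P" using * by (simp add: PiE_def)
    fix T assume "\<phi> \<in> T \<and> openin ?P T"
    then obtain U where U: "finite {i \<in> dual_carrier V. U i \<noteq> UNIV}"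
        "\<And>i. i \<in> dual_carrier V \<Longrightarrow> open (U i)" "\<phi> \<in> PiE (dual_carrier V) U" "PiE (dual_carrier V) U \<subseteq> T"
      unfolding openin_product_topology_alt by (force simp: )
    let ?F = "{i \<in> dual_carrier V. U i \<noteq> UNIV}"
    have "\<exists>e>0. ball (\<phi> i) e \<subseteq> U i" if "i \<in> ?F" for i
    proof -
      have "open (U i)" "\<phi> i \<in> U i" using U(2,3) that by (auto simp: PiE_def Pi_def)
      then show ?thesis by (simp add: open_contains_ball)
    qed
    then have "\<forall>i\<in>?F. \<exists>e. 0 < e \<and> ball (\<phi> i) e \<subseteq> U i" by blast
    then obtain e where "\<forall>i\<in>?F. 0 < e i \<and> ball (\<phi> i) (e i) \<subseteq> U i" by (rule bchoice[THEN exE])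
    then have e: "0 < e i \<and> ball (\<phi> i) (e i) \<subseteq> U i" if "i \<in> ?F" for i using that by (rule bspec)
    \<comment> \<open>The 1 keeps the set nonempty when no coordinate is restricted.\<close>
    let ?e = "Min (insert 1 (e ` ?F))"
    have e0: "0 < ?e" using U(1) e by (subst Min_gr_iff) auto
    have "?F \<subseteq> dual_carrier V" by simp
    with * obtain x where x: "x \<in> K" "\<And>f. f \<in> ?F \<Longrightarrow> \<bar>f x - \<phi> f\<bar> < ?e"
      using approximableD[OF conjunct2[OF *] U(1) _ e0] by auto
    have "f x \<in> U f" if "f \<in> dual_carrier V" for f
    proof (cases "f \<in> ?F")
      case True
      then have "?e \<le> e f" using U(1) by (intro Min_le) auto
      then have "f x \<in> ball (\<phi> f) (e f)" using x(2)[OF True] by (simp add: dist_real_def abs_minus_commute)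
      then show ?thesis using e[OF True] by blast
    qed (use that in auto)
    then have "evaluations V x \<in> PiE (dual_carrier V) U" by (auto simp: evaluations_def)
    with U(4) have "evaluations V x \<in> T" by (rule subsetD)
    moreover have "evaluations V x \<in> evaluations V ` K" using x(1) by (rule imageI)
    ultimately show "\<exists>y. y \<in> evaluations V ` K \<and> y \<in> T" by (intro exI conjI)
  qed
qed

text \<open>By Tychonoff's theorem: the evaluations of \<open>K\<close> lie in a product of compact
  intervals, and \<open>appr\<close> says that they form a closed set there.\<close>

lemma compactin_weakI:
  assumes ne: "dual_carrier V \<noteq> {}" and K: "K \<subseteq> ns_carrier V"
    and bdd: "\<And>f x. f \<in> dual_carrier V \<Longrightarrow> x \<in> K \<Longrightarrow> \<bar>f x\<bar> \<le> B f"
    and appr: "\<And>\<phi>. approximable (dual_carrier V) K \<phi> \<Longrightarrow> \<exists>x\<in>K. \<forall>f\<in>dual_carrier V. \<phi> f = f x"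
  shows "compactin (weak_topology V) K"
proof -
  let ?P = "product_topology (\<lambda>_. euclideanreal) (dual_carrier V)"
  have "compactin ?P (PiE (dual_carrier V) (\<lambda>f. {- B f..B f}))"
    by (simp add: compactin_PiE)
  moreover have "evaluations V ` K \<subseteq> PiE (dual_carrier V) (\<lambda>f. {- B f..B f})"
    using bdd by (auto simp: evaluations_def abs_le_iff) (metis minus_le_iff)
  moreover have "closedin ?P (evaluations V ` K)"
  proof -
    have "\<phi> \<in> evaluations V ` K" if "\<phi> \<in> ?P closure_of (evaluations V ` K)" for \<phi>
    proof -
      have \<phi>: "\<phi> \<in> extensional (dual_carrier V)" "approximable (dual_carrier V) K \<phi>"
        using that by (simp_all add: in_closure_evaluations[OF K])
      then obtain x where x: "x \<in> K" "\<And>f. f \<in> dual_carrier V \<Longrightarrow> \<phi> f = f x" using appr by blast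
      have "\<phi> = evaluations V x" using \<phi>(1) x(2)
        by (auto simp: evaluations_def extensional_def fun_eq_iff)
      then show ?thesis using x(1) by simp
    qed
    then have "?P closure_of (evaluations V ` K) \<subseteq> evaluations V ` K" by (rule subsetI)
    moreover have "evaluations V ` K \<subseteq> topspace ?P" by (auto simp: evaluations_def)
    ultimately show ?thesis
      using closure_of_subset by (metis closure_of_eq subset_antisym)
  qed
  ultimately have "compactin ?P (evaluations V ` K)" by (rule closed_compactin)
  with K show ?thesis by (simp add: compactin_weak_iff_evaluations[OF ne])
qed

text \<open>The product is Hausdorff, so the compact image of \<open>K\<close> is closed. It
  contains \<phi> after restriction to the dual, which makes \<phi> a point of the product.\<close>

lemma compactin_weakD:
  assumes "compactin (weak_topology V) K" "dual_carrier V \<noteq> {}" "approximable (dual_carrier V) K \<phi>"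
  obtains x where "x \<in> K" "\<And>f. f \<in> dual_carrier V \<Longrightarrow> \<phi> f = f x"
proof -
  let ?P = "product_topology (\<lambda>_. euclideanreal) (dual_carrier V)"
  have K: "K \<subseteq> ns_carrier V" "compactin ?P (evaluations V ` K)"
    using assms(1) by (simp_all add: compactin_weak_iff_evaluations[OF assms(2)])
  have "Hausdorff_space ?P" by (simp add: Hausdorff_space_product_topology)
  then have "closedin ?P (evaluations V ` K)" using K(2) compactin_imp_closedin by blast
  moreover have "restrict \<phi> (dual_carrier V) \<in> ?P closure_of (evaluations V ` K)"
    using assms(3) unfolding in_closure_evaluations[OF K(1)] approximable_def
    by (simp add: subset_iff)
  ultimately have "restrict \<phi> (dual_carrier V) \<in> evaluations V ` K" by (simp add: closure_of_closedin)
  then obtain x where x: "restrict \<phi> (dual_carrier V) = evaluations V x" "x \<in> K" by (rule imageE)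
  show ?thesis
  proof (rule that[OF x(2)])
    show "\<phi> f = f x" if "f \<in> dual_carrier V" for f
      using fun_cong[OF x(1), of f] that by (simp add: evaluations_def)
  qed
qed

section \<open>Order continuous norms\<close>

lemma order_continuous_whole_lattice_iff:
  "order_continuous (whole_lattice :: 'a::banach_lattice nlattice) \<longleftrightarrow>
     (\<forall>A :: 'a set. A \<noteq> {} \<and> (\<forall>a\<in>A. \<forall>b\<in>A. \<exists>c\<in>A. c \<le> a \<and> c \<le> b) \<and> (\<forall>a\<in>A. 0 \<le> a) \<and>
        (\<forall>l. (\<forall>a\<in>A. l \<le> a) \<longrightarrow> l \<le> 0) \<longrightarrow> (\<forall>e>0. \<exists>a\<in>A. \<forall>b\<in>A. b \<le> a \<longrightarrow> norm b < e))"
  by (simp add: order_continuous_def whole_lattice_def)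

lemma order_continuousD:
  fixes A :: "'a::banach_lattice set"
  assumes "order_continuous (whole_lattice :: 'a nlattice)"
    and "A \<noteq> {}" "\<And>a b. a \<in> A \<Longrightarrow> b \<in> A \<Longrightarrow> \<exists>c\<in>A. c \<le> a \<and> c \<le> b"
    and "\<And>a. a \<in> A \<Longrightarrow> 0 \<le> a" "\<And>l. (\<And>a. a \<in> A \<Longrightarrow> l \<le> a) \<Longrightarrow> l \<le> 0" "0 < e"
  obtains a where "a \<in> A" "\<And>b. b \<in> A \<Longrightarrow> b \<le> a \<Longrightarrow> norm b < e"
proof -
  have "\<exists>a\<in>A. \<forall>b\<in>A. b \<le> a \<longrightarrow> norm b < e"
    using assms(1)[unfolded order_continuous_whole_lattice_iff, rule_format, of A] assms(2-6) by simp
  then show ?thesis using that by auto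
qed

text \<open>No infimum of \<open>A\<close> is known, so order continuity is applied to the
  differences \<open>a - l\<close> with \<open>l\<close> a lower bound of \<open>A\<close>. Adding a
  lower bound \<open>m\<close> of these differences maps \<open>L\<close> into itself; iterating
  gives \<open>l0 + n m \<le> a0\<close> for all n, hence \<open>m \<le> 0\<close>.\<close>

lemma order_continuous_directed_gaps:
  fixes A :: "'a::banach_lattice set"
  assumes oc: "order_continuous (whole_lattice :: 'a nlattice)"
    and ne: "A \<noteq> {}" and dir: "\<And>a b. a \<in> A \<Longrightarrow> b \<in> A \<Longrightarrow> \<exists>c\<in>A. c \<le> a \<and> c \<le> b"
    and lb: "\<And>a. a \<in> A \<Longrightarrow> l0 \<le> a" and e: "0 < e"
  obtains a where "a \<in> A" "\<And>b. b \<in> A \<Longrightarrow> b \<le> a \<Longrightarrow> norm (a - b) < e"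
proof -
  define L where "L = {l. \<forall>a\<in>A. l \<le> a}"
  define B where "B = {a - l | a l. a \<in> A \<and> l \<in> L}"
  have L: "l \<in> L \<longleftrightarrow> (\<forall>a\<in>A. l \<le> a)" for l by (simp add: L_def)
  have BI: "a - l \<in> B" if "a \<in> A" "l \<in> L" for a l using that by (auto simp: B_def)
  have BE: "\<exists>a l. x = a - l \<and> a \<in> A \<and> l \<in> L" if "x \<in> B" for x using that by (auto simp: B_def)
  obtain a0 where a0: "a0 \<in> A" using ne by auto
  have l0: "l0 \<in> L" using lb by (simp add: L)
  have B1: "B \<noteq> {}" using BI[OF a0 l0] by auto
  have B2: "\<exists>c\<in>B. c \<le> x \<and> c \<le> y" if xy: "x \<in> B" "y \<in> B" for x y
  proof -
    obtain a l b m where x: "x = a - l" "a \<in> A" "l \<in> L" and y: "y = b - m" "b \<in> A" "m \<in> L"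
      using BE[OF xy(1)] BE[OF xy(2)] by auto
    obtain c where c: "c \<in> A" "c \<le> a" "c \<le> b" using dir[OF x(2) y(2)] by blast
    have slm: "sup l m \<in> L" using x(3) y(3) by (simp add: L)
    have le: "c - sup l m \<le> x" "c - sup l m \<le> y"
      unfolding x(1) y(1) using c by (intro diff_mono; simp)+
    show ?thesis using BI[OF c(1) slm] le by (intro bexI[of _ "c - sup l m"] conjI)
  qed
  have B3: "0 \<le> x" if "x \<in> B" for x using BE[OF that] L by auto
  have B4: "m \<le> 0" if m: "\<And>x. x \<in> B \<Longrightarrow> m \<le> x" for m
  proof -
    have step: "l + m \<in> L" if l: "l \<in> L" for l
    proof -
      have "l + m \<le> a" if "a \<in> A" for a
      proof -
        have "m \<le> a - l" by (rule m[OF BI[OF that l]])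
        then show ?thesis by (simp only: le_diff_eq add.commute)
      qed
      then show ?thesis by (simp add: L)
    qed
    have "l0 + real n *\<^sub>R m \<in> L" for n
    proof (induction n)
      case 0 then show ?case using l0 by simp
    next
      case (Suc n)
      have "l0 + real (Suc n) *\<^sub>R m = (l0 + real n *\<^sub>R m) + m"
        by (simp add: scaleR_add_left algebra_simps)
      then show ?case using step[OF Suc] by metis
    qed
    then have "l0 + real n *\<^sub>R m \<le> a0" for n using a0 L by auto
    then have "real n *\<^sub>R m \<le> a0 - l0" for n by (simp only: le_diff_eq add.commute)
    then show ?thesis by (rule le_zero_of_scaleR_le)
  qed
  obtain x where x: "x \<in> B" "\<And>b. b \<in> B \<Longrightarrow> b \<le> x \<Longrightarrow> norm b < e"
    using order_continuousD[OF oc B1 B2 B3 B4 e] by auto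
  obtain a l where a: "x = a - l" "a \<in> A" "l \<in> L" using BE[OF x(1)] by auto
  show ?thesis
  proof
    show "a \<in> A" by fact
    fix b assume b: "b \<in> A" "b \<le> a"
    have "norm (a - b) \<le> norm (a - l)"
      using b a(3) L by (intro norm_mono_nonneg diff_mono) auto
    also have "\<dots> < e" using x(2)[OF x(1)] a(1) by simp
    finally show "norm (a - b) < e" .
  qed
qed

text \<open>Norm convergence and the infimum come together: elements with gaps below 1/(n+1) form a
  Cauchy sequence, compared through common smaller elements of \<open>A\<close>.\<close>

lemma order_continuous_directed_limit:
  fixes A :: "'a::banach_lattice set"
  assumes oc: "order_continuous (whole_lattice :: 'a nlattice)"
    and ne: "A \<noteq> {}" and dir: "\<And>a b. a \<in> A \<Longrightarrow> b \<in> A \<Longrightarrow> \<exists>c\<in>A. c \<le> a \<and> c \<le> b"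
    and lb: "\<And>a. a \<in> A \<Longrightarrow> l0 \<le> a"
  obtains c where "\<And>a. a \<in> A \<Longrightarrow> c \<le> a"
    "\<And>e. 0 < e \<Longrightarrow> \<exists>a\<in>A. \<forall>b\<in>A. b \<le> a \<longrightarrow> norm (b - c) < e"
proof -
  have "\<exists>a. a \<in> A \<and> (\<forall>b\<in>A. b \<le> a \<longrightarrow> norm (a - b) < inverse (real (Suc n)))" for n
    by (rule order_continuous_directed_gaps[OF oc ne dir lb, of "inverse (real (Suc n))"]) auto
  then obtain a where a: "\<And>n. a n \<in> A"
      "\<And>n b. b \<in> A \<Longrightarrow> b \<le> a n \<Longrightarrow> norm (a n - b) < inverse (real (Suc n))" by metis
  have small: "\<exists>N. \<forall>n\<ge>N. inverse (real (Suc n)) < e" if "0 < e" for e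
  proof -
    obtain N where "inverse (real (Suc N)) < e" using reals_Archimedean[OF \<open>0 < e\<close>] by blast
    moreover have "inverse (real (Suc n)) \<le> inverse (real (Suc N))" if "N \<le> n" for n
      using that by (intro le_imp_inverse_le) auto
    ultimately show ?thesis by (metis order_le_less_trans)
  qed
  have near: "norm (a n - a m) < inverse (real (Suc n)) + inverse (real (Suc m))" for n m
  proof -
    obtain b where b: "b \<in> A" "b \<le> a n" "b \<le> a m" using dir[OF a(1) a(1)] by blast
    have "norm (a n - a m) \<le> norm (a n - b) + norm (a m - b)"
      using norm_triangle_ineq4[of "a n - b" "a m - b"] by simp
    then show ?thesis using a(2)[OF b(1,2)] a(2)[OF b(1,3)] by linarith
  qed
  have "Cauchy a"
  proof (rule CauchyI)
    fix e :: real assume "0 < e"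
    then obtain N where N: "\<And>n. n \<ge> N \<Longrightarrow> inverse (real (Suc n)) < e / 2" using small[of "e / 2"] by auto
    have "norm (a m - a n) < e" if "N \<le> m" "N \<le> n" for m n
      using near[of m n] N[OF that(1)] N[OF that(2)] by linarith
    then show "\<exists>M. \<forall>m\<ge>M. \<forall>n\<ge>M. norm (a m - a n) < e" by blast
  qed
  then obtain c where c: "a \<longlonglongrightarrow> c" by (auto simp: convergent_eq_Cauchy[symmetric])
  show ?thesis
  proof
    fix b assume b: "b \<in> A"
    \<comment> \<open>\<open>d n\<close> lies below both \<open>a n\<close> and \<open>b\<close> and
      within the gap of \<open>a n\<close>, so it has the same limit \<open>c\<close>, and
      \<open>c \<le> b\<close> follows.\<close>
    obtain d where d: "\<And>n. d n \<in> A" "\<And>n. d n \<le> a n" "\<And>n. d n \<le> b" using dir[OF a(1) b] by metis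
    have lim0: "(\<lambda>n. a n - d n) \<longlonglongrightarrow> 0"
    proof (rule LIMSEQ_I)
      fix e :: real assume "0 < e"
      then obtain N where "\<forall>n\<ge>N. inverse (real (Suc n)) < e" using small by blast
      then show "\<exists>N. \<forall>n\<ge>N. norm (a n - d n - 0) < e"
        using a(2)[OF d(1,2)] by (metis diff_zero order_less_trans)
    qed
    have "(\<lambda>n. a n - (a n - d n)) \<longlonglongrightarrow> c - 0" by (rule tendsto_diff[OF c lim0])
    then have "d \<longlonglongrightarrow> c" by simp
    then show "c \<le> b"
      by (rule tendsto_le_lattice[OF sequentially_bot _ tendsto_const]) (use d in auto)
  next
    fix e :: real assume e: "0 < e"
    then obtain N where N: "\<And>n. n \<ge> N \<Longrightarrow> inverse (real (Suc n)) < e / 2" using small[of "e / 2"] by auto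
    obtain M where M: "\<And>n. n \<ge> M \<Longrightarrow> norm (a n - c) < e / 2" using LIMSEQ_D[OF c, of "e/2"] e by auto
    let ?n = "max N M"
    have "norm (b - c) < e" if "b \<in> A" "b \<le> a ?n" for b
    proof -
      have "norm (b - c) \<le> norm (a ?n - c) + norm (a ?n - b)"
        using norm_triangle_ineq4[of "a ?n - c" "a ?n - b"] by simp
      then show ?thesis using a(2)[OF that] N[of ?n] M[of ?n] by fastforce
    qed
    then show "\<exists>a\<in>A. \<forall>b\<in>A. b \<le> a \<longrightarrow> norm (b - c) < e" using a(1) by blast
  qed
qed

lemma order_continuous_decseq_convergent:
  fixes s :: "nat \<Rightarrow> 'a::banach_lattice"
  assumes oc: "order_continuous (whole_lattice :: 'a nlattice)"
    and dec: "decseq s" and lb: "\<And>n. l \<le> s n"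
  obtains c where "s \<longlonglongrightarrow> c"
proof -
  have dir: "\<exists>c\<in>range s. c \<le> a \<and> c \<le> b" if ab: "a \<in> range s" "b \<in> range s" for a b
  proof -
    obtain m n where "a = s m" "b = s n" using ab by blast
    then show ?thesis using dec by (intro bexI[of _ "s (max m n)"]) (auto simp: decseq_def)
  qed
  obtain c where c: "\<And>e. 0 < e \<Longrightarrow> \<exists>a\<in>range s. \<forall>b\<in>range s. b \<le> a \<longrightarrow> norm (b - c) < e"
    by (rule order_continuous_directed_limit[OF oc _ dir, of l]) (use lb in auto)
  have "s \<longlonglongrightarrow> c"
  proof (rule LIMSEQ_I)
    fix e :: real assume "0 < e"
    then obtain N where "\<forall>b\<in>range s. b \<le> s N \<longrightarrow> norm (b - c) < e" using c by blast
    then show "\<exists>N. \<forall>n\<ge>N. norm (s n - c) < e" using dec unfolding decseq_def by blast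
  qed
  then show ?thesis by (rule that)
qed

lemma order_continuous_incseq_convergent:
  fixes s :: "nat \<Rightarrow> 'a::banach_lattice"
  assumes oc: "order_continuous (whole_lattice :: 'a nlattice)"
    and inc: "incseq s" and ub: "\<And>n. s n \<le> u"
  obtains c where "s \<longlonglongrightarrow> c"
proof -
  obtain c where "(\<lambda>n. - s n) \<longlonglongrightarrow> c"
    by (rule order_continuous_decseq_convergent[OF oc, of "\<lambda>n. - s n" "- u"])
      (use inc ub in \<open>auto simp: incseq_def decseq_def\<close>)
  then have "s \<longlonglongrightarrow> - c" using tendsto_minus by fastforce
  then show ?thesis by (rule that)
qed

section \<open>Positive functionals controlling the norm on an order interval\<close>

primrec sup_range :: "(nat \<Rightarrow> 'a::semilattice_sup) \<Rightarrow> nat \<Rightarrow> nat \<Rightarrow> 'a" where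
  "sup_range z n 0 = z n"
| "sup_range z n (Suc m) = sup (sup_range z n m) (z (n + Suc m))"

lemma sup_range_ge: "z n \<le> sup_range z n m"
proof (induction m)
  case (Suc m)
  show ?case unfolding sup_range.simps by (rule le_supI1[OF Suc])
qed simp

lemma sup_range_least: "(\<And>k. z k \<le> u) \<Longrightarrow> sup_range z n m \<le> u"
  by (induction m) simp_all

lemma sup_range_Suc: "sup_range z (Suc n) m \<le> sup_range z n (Suc m)"
proof (induction m)
  case (Suc m)
  have "z (Suc n + Suc m) = z (n + Suc (Suc m))" by simp
  then have "sup_range z (Suc n) (Suc m) = sup (sup_range z (Suc n) m) (z (n + Suc (Suc m)))"
    by (simp only: sup_range.simps)
  also have "\<dots> \<le> sup (sup_range z n (Suc m)) (z (n + Suc (Suc m)))"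
    using Suc by (rule sup_mono) simp
  finally show ?case by (simp only: sup_range.simps)
qed simp

lemma incseq_sup_range: "incseq (sup_range z n)"
  by (rule incseq_SucI) simp

lemma positive_sup_range_le_sum:
  fixes z :: "nat \<Rightarrow> 'a::banach_lattice"
  assumes z: "\<And>n. 0 \<le> z n" and f: "linear f" "\<And>x. 0 \<le> x \<Longrightarrow> 0 \<le> (f x :: real)"
  shows "f (sup_range z n m) \<le> (\<Sum>j\<le>m. f (z (n + j)))"
proof (induction m)
  case (Suc m)
  let ?a = "sup_range z n m" and ?b = "z (n + Suc m)"
  have "0 \<le> ?a" by (rule order_trans[OF z sup_range_ge])
  then have "sup ?a ?b \<le> ?a + ?b" using z by (intro le_supI) (auto intro: add_increasing add_increasing2)
  then have "0 \<le> f (?a + ?b - sup ?a ?b)" by (intro f) (simp only: diff_ge_0_iff_ge)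
  then have "f (sup ?a ?b) \<le> f ?a + f ?b" by (simp only: linear_diff[OF f(1)] linear_add[OF f(1)] diff_ge_0_iff_ge)
  with Suc show ?case by simp
qed simp

text \<open>If the claim fails, there are \<open>z\<^sub>n \<in> [0, u]\<close> of norm at least \<open>e\<close> with norming functionals
  \<open>f\<^sub>n\<close> such that \<open>f\<^sub>n z\<^sub>k\<close> is tiny for \<open>k > n\<close>, and the decreasing sequence
  \<open>sup\<^sub>k\<^sub>\<ge>\<^sub>n z\<^sub>k\<close> does not converge.\<close>

lemma order_continuous_control:
  fixes u :: "'a::banach_lattice"
  assumes oc: "order_continuous (whole_lattice :: 'a nlattice)" and e: "0 < e"
  obtains f :: "'a \<Rightarrow> real" and d where "bounded_linear f" "\<And>x. 0 \<le> x \<Longrightarrow> 0 \<le> f x" "0 < d"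
    "\<And>z. 0 \<le> z \<Longrightarrow> z \<le> u \<Longrightarrow> f z < d \<Longrightarrow> norm z < e"
proof (rule ccontr)
  let ?pos = "\<lambda>f :: 'a \<Rightarrow> real. bounded_linear f \<and> (\<forall>x. 0 \<le> x \<longrightarrow> 0 \<le> f x)"
  assume "\<not> thesis"
  with that have "\<exists>z. 0 \<le> z \<and> z \<le> u \<and> f z < d \<and> e \<le> norm z" if "?pos f" "0 < d" for f d
    using that by (meson linorder_not_less)
  then obtain Z where Z: "\<And>f d. ?pos f \<Longrightarrow> 0 < d \<Longrightarrow>
      0 \<le> Z f d \<and> Z f d \<le> u \<and> f (Z f d) < d \<and> e \<le> norm (Z f d)" by metis
  have "\<exists>f. ?pos f \<and> (\<forall>y. \<bar>f y\<bar> \<le> norm y) \<and> f x = norm x" if "0 \<le> x" for x :: 'a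
    using norming_functional_nonneg[OF that] by metis
  then obtain N where N: "\<And>x :: 'a. 0 \<le> x \<Longrightarrow> ?pos (N x) \<and> (\<forall>y. \<bar>N x y\<bar> \<le> norm y) \<and> N x x = norm x"
    by metis
  \<comment> \<open>The terms from index n + 1 on add up to at most e/2, half of the lower bound e
    for \<open>f n (z n)\<close>.\<close>
  define d where "d n = e / 2 ^ (n + 2)" for n :: nat
  have d0: "0 < d n" for n using e by (simp add: d_def)
  \<comment> \<open>\<open>g n\<close> is the sum of the functionals \<open>f k\<close> with k < n.
    Making the single value \<open>g n (z n)\<close> small makes all these positive functionals
    small at \<open>z n\<close>.\<close>
  define g where "g = rec_nat (\<lambda>_. 0) (\<lambda>n h x. h x + N (Z h (d n)) x)"
  have g: "g 0 = (\<lambda>_. 0)" "g (Suc n) = (\<lambda>x. g n x + N (Z (g n) (d n)) x)" for n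
    by (simp_all add: g_def)
  have gpos: "?pos (g n)" for n
  proof (induction n)
    case (Suc n)
    then have "?pos (N (Z (g n) (d n)))" using N Z d0 by blast
    with Suc show ?case unfolding g by (auto intro: bounded_linear_add add_nonneg_nonneg)
  qed (simp add: g bounded_linear_zero)
  define z where "z n = Z (g n) (d n)" for n
  define f where "f n = N (z n)" for n
  have z: "0 \<le> z n" "z n \<le> u" "g n (z n) < d n" "e \<le> norm (z n)" for n
    unfolding z_def using Z[OF gpos[of n] d0[of n]] by simp_all
  have f: "bounded_linear (f n)" "\<And>x. 0 \<le> x \<Longrightarrow> 0 \<le> f n x" "\<bar>f n y\<bar> \<le> norm y" "e \<le> f n (z n)" for n y
    unfolding f_def using N[OF z(1)[of n]] z(4)[of n] by simp_all
  have fg: "f n x \<le> g k x" if "n < k" "0 \<le> x" for n k x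
    using that(1)
  proof (induction k)
    case (Suc k)
    have "0 \<le> g k x" "0 \<le> f k x" using gpos f(2) that(2) by auto
    with Suc show ?case by (cases "n = k") (auto simp: g f_def z_def)
  qed simp
  \<comment> \<open>The finite joins increase in their length and stay below \<open>u\<close>; their
    norm limit \<open>w n\<close> serves as the supremum of the tail from n on.\<close>
  have "\<exists>v. sup_range z n \<longlonglongrightarrow> v" for n
    by (rule order_continuous_incseq_convergent[OF oc incseq_sup_range sup_range_least[OF z(2)]])
      (rule exI)
  then obtain w where w: "\<And>n. sup_range z n \<longlonglongrightarrow> w n" by metis
  have zw: "z n \<le> w n" for n
    by (rule tendsto_le_lattice[OF _ tendsto_const w]) (auto simp: sup_range_ge)
  have dec: "decseq w"
  proof (rule decseq_SucI)
    show "w (Suc n) \<le> w n" for n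
      by (rule tendsto_le_lattice[OF _ w LIMSEQ_Suc[OF w]]) (auto simp: sup_range_Suc simp del: sup_range.simps)
  qed
  have "0 \<le> w n" for n by (rule order_trans[OF z(1) zw])
  then obtain c where "w \<longlonglongrightarrow> c" by (rule order_continuous_decseq_convergent[OF oc dec])
  then have "(\<lambda>n. w n - w (Suc n)) \<longlonglongrightarrow> c - c" by (intro tendsto_diff LIMSEQ_Suc)
  then obtain n where n: "norm (w n - w (Suc n)) < e / 2"
    using LIMSEQ_D[of "\<lambda>n. w n - w (Suc n)" 0 "e/2"] e by auto
  \<comment> \<open>\<open>f n\<close> separates consecutive tails: it is at most e/2 on
    \<open>w (Suc n)\<close> and at least e on \<open>w n\<close>. Being dominated by the norm, it
    contradicts the closeness of the two.\<close>
  have "f n (sup_range z (Suc n) m) \<le> e / 2" for m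
  proof -
    have "f n (sup_range z (Suc n) m) \<le> (\<Sum>j\<le>m. f n (z (Suc n + j)))"
      by (rule positive_sup_range_le_sum) (auto intro: z f bounded_linear.linear)
    also have "\<dots> \<le> (\<Sum>j\<le>m. (e / 4) * (1/2) ^ j)"
    proof (rule sum_mono)
      fix j
      have "f n (z (Suc n + j)) \<le> d (Suc n + j)"
        using fg[of n "Suc n + j" "z (Suc n + j)"] z(1,3)[of "Suc n + j"] by linarith
      also have "\<dots> \<le> (e / 4) * (1/2) ^ j"
        using e order_trans[OF two_realpow_ge_one[of n], of "2 * 2 ^ n"] by (simp add: d_def power_add field_simps)
      finally show "f n (z (Suc n + j)) \<le> (e / 4) * (1/2) ^ j" .
    qed
    also have "\<dots> = (e / 4) * (\<Sum>j<Suc m. (1/2) ^ j)"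
      by (simp add: sum_distrib_left lessThan_Suc_atMost)
    also have "\<dots> = (e / 4) * (2 - 2 * (1/2) ^ Suc m)"
      by (subst sum_gp_strict) (simp add: field_simps)
    also have "\<dots> \<le> (e / 4) * 2" using e by (intro mult_left_mono) auto
    finally show ?thesis by simp
  qed
  moreover have "(\<lambda>m. f n (sup_range z (Suc n) m)) \<longlonglongrightarrow> f n (w (Suc n))"
    by (rule bounded_linear.tendsto[OF f(1) w])
  ultimately have "f n (w (Suc n)) \<le> e / 2" by (meson LIMSEQ_le_const2)
  moreover have "e \<le> f n (w n)"
  proof -
    have "0 \<le> f n (w n - z n)" using zw by (intro f) (simp only: diff_ge_0_iff_ge)
    then show ?thesis using f(4)[of n] linear_diff[OF bounded_linear.linear[OF f(1)], of n "w n" "z n"] by linarith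
  qed
  ultimately have "e / 2 \<le> f n (w n - w (Suc n))"
    using linear_diff[OF bounded_linear.linear[OF f(1)], of n "w n" "w (Suc n)"] by linarith
  then show False using f(3)[of n "w n - w (Suc n)"] n by linarith
qed

section \<open>Weak compactness through convex energies; order intervals\<close>

lemma whole_lattice_sel [simp]:
  "ns_carrier whole_lattice = UNIV" "ns_add whole_lattice = (+)" "ns_zero whole_lattice = 0"
  "ns_scale whole_lattice = (*\<^sub>R)" "ns_norm whole_lattice = norm" "nl_le whole_lattice = (\<le>)"
  by (simp_all add: whole_lattice_def)

lemma real_nspace_sel [simp]:
  "ns_carrier real_nspace = UNIV" "ns_add real_nspace = (+)" "ns_zero real_nspace = 0"
  "ns_scale real_nspace = (*)" "ns_norm real_nspace = abs"
  by (simp_all add: real_nspace_def)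

lemma mem_dual_carrier:
  "f \<in> dual_carrier V \<longleftrightarrow> f \<in> extensional (ns_carrier V) \<and>
     (\<forall>x\<in>ns_carrier V. \<forall>y\<in>ns_carrier V. f (ns_add V x y) = f x + f y) \<and>
     (\<forall>r. \<forall>x\<in>ns_carrier V. f (ns_scale V r x) = r * f x) \<and>
     (\<exists>C. \<forall>x\<in>ns_carrier V. \<bar>f x\<bar> \<le> C * ns_norm V x)"
  by (auto simp: ns_dual_def ns_linear_on_def)

lemma mem_dual_whole_lattice:
  fixes f :: "'a::banach_lattice \<Rightarrow> real"
  shows "f \<in> dual_carrier whole_lattice \<longleftrightarrow> bounded_linear f"
proof
  assume "bounded_linear f"
  then interpret bounded_linear f .
  show "f \<in> dual_carrier whole_lattice"
    using nonneg_bounded by (auto simp: mem_dual_carrier add scale mult.commute)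
next
  assume "f \<in> dual_carrier whole_lattice"
  then obtain C where "\<And>x. \<bar>f x\<bar> \<le> C * norm x"
      "\<And>x y. f (x + y) = f x + f y" "\<And>r x. f (r *\<^sub>R x) = r * f x"
    by (auto simp: mem_dual_carrier)
  then show "bounded_linear f" by (intro bounded_linear_intro[of f C]) (auto simp: mult.commute)
qed

lemma dual_whole_lattice_nonempty: "dual_carrier (whole_lattice :: 'a::banach_lattice nlattice) \<noteq> {}"
  using mem_dual_whole_lattice bounded_linear_zero by blast

abbreviation functionals :: "('a::real_normed_vector \<Rightarrow> real) set" where
  "functionals \<equiv> {f. bounded_linear f}"

lemma dual_whole_lattice: "dual_carrier (whole_lattice :: 'a::banach_lattice nlattice) = functionals"
  using mem_dual_whole_lattice by blast

abbreviation weakly_compact :: "'a::banach_lattice set \<Rightarrow> bool" where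
  "weakly_compact K \<equiv> compactin (weak_topology (whole_lattice :: 'a nlattice)) K"

lemma weakly_compactI:
  fixes K :: "'a::banach_lattice set"
  assumes "\<And>x. x \<in> K \<Longrightarrow> norm x \<le> b"
    and "\<And>\<phi>. approximable functionals K \<phi> \<Longrightarrow> \<exists>x\<in>K. \<forall>f. bounded_linear f \<longrightarrow> \<phi> f = f x"
  shows "weakly_compact K"
proof (rule compactin_weakI[where B = "\<lambda>f. onorm f * b", OF dual_whole_lattice_nonempty])
  show "\<bar>f x\<bar> \<le> onorm f * b" if "f \<in> dual_carrier whole_lattice" "x \<in> K" for f and x :: 'a
  proof -
    have f: "bounded_linear f" using that(1) by (simp add: mem_dual_whole_lattice)
    have "\<bar>f x\<bar> \<le> onorm f * norm x" using onorm[OF f, of x] by simp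
    also have "\<dots> \<le> onorm f * b" using assms(1)[OF that(2)] onorm_pos_le[OF f] by (rule mult_left_mono)
    finally show ?thesis .
  qed
qed (use assms(2) in \<open>auto simp: dual_whole_lattice\<close>)

lemma weakly_compactD:
  fixes K :: "'a::banach_lattice set"
  assumes "weakly_compact K" "approximable functionals K \<phi>"
  obtains x where "x \<in> K" "\<And>f. bounded_linear f \<Longrightarrow> \<phi> f = f x"
  using compactin_weakD[OF assms(1) dual_whole_lattice_nonempty, of \<phi>] assms(2)
  by (auto simp: dual_whole_lattice)

text \<open>The sets \<open>{x \<in> C. \<forall>f\<in>F. \<bar>f x - \<phi> f\<bar> \<le> r}\<close> are convex and filter downwards; near minimizers of
  a uniformly convex energy on them form a Cauchy net, as for closed convex sets in Hilbert space.\<close>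

lemma approximable_near_point:
  fixes C :: "'a::real_normed_vector set" and E :: "'a \<Rightarrow> real"
  assumes C: "convex C" and \<phi>: "approximable functionals C \<phi>"
    and E: "\<And>x. x \<in> C \<Longrightarrow> 0 \<le> E x \<and> E x \<le> b" and eta: "0 < eta"
    and conv: "\<And>x y. x \<in> C \<Longrightarrow> y \<in> C \<Longrightarrow> E x + E y - 2 * E ((1/2) *\<^sub>R (x + y)) < eta \<Longrightarrow> norm (x - y) < e"
  obtains x where "x \<in> C" "\<And>f. bounded_linear f \<Longrightarrow> \<bar>f x - \<phi> f\<bar> \<le> onorm f * e"
proof -
  define S where "S F r = {x \<in> C. \<forall>f\<in>F. \<bar>f x - \<phi> f\<bar> \<le> r}" for F r
  define I where "I = {(F :: ('a \<Rightarrow> real) set, r :: real). finite F \<and> F \<subseteq> functionals \<and> 0 < r}"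
  have ne: "\<exists>x. x \<in> S F r" if "(F, r) \<in> I" for F r
  proof -
    have "\<exists>x\<in>C. \<forall>f\<in>F. \<bar>f x - \<phi> f\<bar> < r"
      using \<phi> that unfolding approximable_def I_def by simp
    then show ?thesis by (auto simp: S_def intro: less_imp_le)
  qed
  \<comment> \<open>\<open>Sup ?M\<close> is the limit of the infima of \<open>E\<close> along the
    sets \<open>S F r\<close>, which grow as these sets shrink.\<close>
  let ?M = "{c. \<exists>F r. (F, r) \<in> I \<and> (\<forall>x\<in>S F r. c \<le> E x)}"
  have bM: "bdd_above ?M"
  proof (rule bdd_aboveI)
    fix c assume "c \<in> ?M"
    then obtain F r where "(F, r) \<in> I" "\<forall>x\<in>S F r. c \<le> E x" by blast
    moreover from this ne obtain x where "x \<in> S F r" by blast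
    ultimately show "c \<le> b" using E[of x] by (fastforce simp: S_def)
  qed
  have "0 \<in> ?M"
    using E by (intro CollectI exI[of _ "{}"] exI[of _ 1]) (auto simp: I_def S_def)
  then have neM: "?M \<noteq> {}" by blast
  define m where "m = Sup ?M"
  \<comment> \<open>The quarter is used four times: two energies below \<open>m + eta / 4\<close>
    and twice a midpoint energy above \<open>m - eta / 4\<close> differ by less than
    \<open>eta\<close>.\<close>
  have "m - eta / 4 < Sup ?M" using eta by (simp add: m_def)
  then obtain c0 where "c0 \<in> ?M" "m - eta / 4 < c0" using less_cSup_iff[OF neM bM] by blast
  then obtain F0 r0 where I0: "(F0, r0) \<in> I" and low: "\<And>x. x \<in> S F0 r0 \<Longrightarrow> m - eta / 4 < E x"
    by fastforce
  have near: "\<exists>x\<in>S F r. E x < m + eta / 4" if "(F, r) \<in> I" for F r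
  proof (rule ccontr)
    assume "\<not> ?thesis"
    with that have "m + eta / 4 \<in> ?M" by (auto simp: not_less)
    then have "m + eta / 4 \<le> m" unfolding m_def by (rule cSup_upper[OF _ bM])
    with eta show False by simp
  qed
  obtain x0 where x0: "x0 \<in> S F0 r0" "E x0 < m + eta / 4" using near[OF I0] by blast
  have mid: "(1/2) *\<^sub>R (x + y) \<in> S F0 r0" if "x \<in> S F0 r0" "y \<in> S F0 r0" for x y
  proof -
    have "(1/2) *\<^sub>R x + (1/2) *\<^sub>R y \<in> C"
      using that by (intro convexD[OF C]) (auto simp: S_def)
    moreover have "\<bar>f ((1/2) *\<^sub>R (x + y)) - \<phi> f\<bar> \<le> r0" if f: "f \<in> F0" for f
    proof -
      have "linear f" using f I0 by (auto simp: I_def bounded_linear.linear)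
      then have "f ((1/2) *\<^sub>R (x + y)) = (f x + f y) / 2"
        by (simp add: linear_add linear_scale)
      moreover have "\<bar>f x - \<phi> f\<bar> \<le> r0" "\<bar>f y - \<phi> f\<bar> \<le> r0"
        using \<open>x \<in> _\<close> \<open>y \<in> _\<close> f by (auto simp: S_def)
      ultimately show ?thesis by (simp add: abs_le_iff field_simps)
    qed
    ultimately show ?thesis by (simp add: S_def scaleR_add_right)
  qed
  show ?thesis
  proof (rule that)
    show x0C: "x0 \<in> C" using x0 by (simp add: S_def)
    fix f :: "'a \<Rightarrow> real" assume f: "bounded_linear f"
    show "\<bar>f x0 - \<phi> f\<bar> \<le> onorm f * e"
    proof (rule field_le_epsilon)
      fix r :: real assume r: "0 < r"
      \<comment> \<open>\<open>x0\<close> stays fixed while \<open>x\<close> varies with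
        \<open>f\<close> and \<open>r\<close>. Keeping \<open>F0\<close> and \<open>r0\<close> in
        the constraints places the midpoint where \<open>E\<close> exceeds
        \<open>m - eta / 4\<close>.\<close>
      have "(insert f F0, min r r0) \<in> I" using I0 r f by (auto simp: I_def)
      then obtain x where x: "x \<in> S (insert f F0) (min r r0)" "E x < m + eta / 4" using near by blast
      have x': "x \<in> S F0 r0" "x \<in> C" "\<bar>f x - \<phi> f\<bar> \<le> r" using x(1) by (auto simp: S_def)
      have "E x0 + E x - 2 * E ((1/2) *\<^sub>R (x0 + x)) < eta"
        using x0(2) x(2) low[OF mid[OF x0(1) x'(1)]] by linarith
      then have "norm (x0 - x) < e" by (rule conv[OF x0C x'(2)])
      then have "onorm f * norm (x0 - x) \<le> onorm f * e"
        using onorm_pos_le[OF f] by (intro mult_left_mono) auto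
      moreover have "\<bar>f x0 - f x\<bar> \<le> onorm f * norm (x0 - x)"
        using onorm[OF f, of "x0 - x"] linear_diff[OF bounded_linear.linear[OF f]] by simp
      ultimately show "\<bar>f x0 - \<phi> f\<bar> \<le> onorm f * e + r" using x'(3) by linarith
    qed
  qed
qed

text \<open>The energy may change with \<open>e\<close>. Each accuracy 1/(n+1) yields a point of
  \<open>C\<close> approximating \<phi> uniformly on the dual ball; these points form a Cauchy
  sequence, and their limit represents \<phi>.\<close>

lemma weakly_compact_of_energy:
  fixes C :: "'a::banach_lattice set"
  assumes "closed C" "convex C" "\<And>x. x \<in> C \<Longrightarrow> norm x \<le> B"
    and energy: "\<And>e. 0 < e \<Longrightarrow> \<exists>E b eta. 0 < (eta :: real) \<and> (\<forall>x\<in>C. 0 \<le> E x \<and> E x \<le> (b::real)) \<and>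
      (\<forall>x\<in>C. \<forall>y\<in>C. E x + E y - 2 * E ((1/2) *\<^sub>R (x + y)) < eta \<longrightarrow> norm (x - y) < e)"
  shows "weakly_compact C"
proof (rule weakly_compactI)
  show "norm x \<le> B" if "x \<in> C" for x by (rule assms(3)[OF that])
  fix \<phi> :: "('a \<Rightarrow> real) \<Rightarrow> real" assume \<phi>: "approximable functionals C \<phi>"
  let ?e = "\<lambda>n. inverse (real (Suc n))"
  have "\<exists>x. x \<in> C \<and> (\<forall>f. bounded_linear f \<longrightarrow> \<bar>f x - \<phi> f\<bar> \<le> onorm f * e)" if e: "0 < e" for e
    using energy[OF e]
  proof (elim exE conjE)
    fix E :: "'a \<Rightarrow> real" and b eta :: real
    assume E: "0 < eta" "\<forall>x\<in>C. 0 \<le> E x \<and> E x \<le> b"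
      "\<forall>x\<in>C. \<forall>y\<in>C. E x + E y - 2 * E ((1/2) *\<^sub>R (x + y)) < eta \<longrightarrow> norm (x - y) < e"
    show ?thesis
      by (rule approximable_near_point[OF assms(2) \<phi>, of E b eta e]) (use E in auto)
  qed
  then have "\<forall>n. \<exists>x. x \<in> C \<and> (\<forall>f. bounded_linear f \<longrightarrow> \<bar>f x - \<phi> f\<bar> \<le> onorm f * ?e n)" by simp
  then obtain x where "\<forall>n. x n \<in> C \<and> (\<forall>f. bounded_linear f \<longrightarrow> \<bar>f (x n) - \<phi> f\<bar> \<le> onorm f * ?e n)"
    by (rule choice[THEN exE])
  then have x: "\<And>n. x n \<in> C" "\<And>n f. bounded_linear f \<Longrightarrow> \<bar>f (x n) - \<phi> f\<bar> \<le> onorm f * ?e n" by auto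
  \<comment> \<open>A norming functional turns the distance of two approximants into a difference of
    their values, and both are compared with \<phi> there.\<close>
  have diff: "norm (x m - x n) \<le> ?e m + ?e n" for m n
  proof -
    obtain f where f: "bounded_linear f" "\<And>y. \<bar>f y\<bar> \<le> norm y" "f (x m - x n) = norm (x m - x n)"
      using norming_functional by blast
    have "onorm f \<le> 1" by (rule onorm_bound) (use f(2) in simp_all)
    then have "onorm f * ?e k \<le> ?e k" for k by (simp add: mult_left_le_one_le onorm_pos_le[OF f(1)] mult.commute)
    then have k: "\<bar>f (x k) - \<phi> f\<bar> \<le> ?e k" for k using x(2)[OF f(1), of k] by (rule order_trans[rotated])
    have "norm (x m - x n) = f (x m) - f (x n)"
      by (simp only: f(3)[symmetric] linear_diff[OF bounded_linear.linear[OF f(1)]])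
    then show ?thesis using k[of m] k[of n] by (simp only: abs_le_iff) linarith
  qed
  have e0: "?e \<longlonglongrightarrow> 0" by (rule LIMSEQ_inverse_real_of_nat)
  have "Cauchy x"
  proof (rule CauchyI)
    fix r :: real assume "0 < r"
    then obtain N where N: "\<And>n. N \<le> n \<Longrightarrow> ?e n < r / 2" using LIMSEQ_D[OF e0, of "r/2"] by auto
    have "norm (x m - x n) < r" if "N \<le> m" "N \<le> n" for m n
      using diff[of m n] N[OF that(1)] N[OF that(2)] by linarith
    then show "\<exists>M. \<forall>m\<ge>M. \<forall>n\<ge>M. norm (x m - x n) < r" by blast
  qed
  then obtain z where z: "x \<longlonglongrightarrow> z" by (auto simp: convergent_eq_Cauchy[symmetric])
  have "z \<in> C" using closed_sequentially[OF assms(1) _ z] x(1) by blast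
  moreover have "\<phi> f = f z" if f: "bounded_linear f" for f
  proof -
    have 1: "(\<lambda>n. \<bar>f (x n) - \<phi> f\<bar>) \<longlonglongrightarrow> \<bar>f z - \<phi> f\<bar>"
      by (intro tendsto_intros bounded_linear.tendsto[OF f z])
    have 2: "(\<lambda>n. onorm f * ?e n) \<longlonglongrightarrow> onorm f * 0" by (intro tendsto_intros e0)
    have "\<bar>f z - \<phi> f\<bar> \<le> onorm f * 0"
      by (rule tendsto_le[OF sequentially_bot 2 1]) (intro always_eventually allI x(2)[OF f])
    then show ?thesis by simp
  qed
  ultimately show "\<exists>x\<in>C. \<forall>f. bounded_linear f \<longrightarrow> \<phi> f = f x" by blast
qed

lemma convex_interval: "convex {0..u :: 'a::banach_lattice}"
proof (rule convexI)
  fix x y :: 'a and a b :: real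
  assume *: "x \<in> {0..u}" "y \<in> {0..u}" "0 \<le> a" "0 \<le> b" "a + b = 1"
  have "a *\<^sub>R x + b *\<^sub>R y \<le> a *\<^sub>R u + b *\<^sub>R u"
    using * by (intro add_mono scaleR_left_mono) auto
  also have "\<dots> = u" using * by (simp flip: scaleR_add_left)
  finally show "a *\<^sub>R x + b *\<^sub>R y \<in> {0..u}" using * by (simp add: add_nonneg_nonneg scaleR_nonneg_nonneg)
qed

lemma closed_interval: "closed {0..u :: 'a::banach_lattice}"
  unfolding closed_sequential_limits
proof (intro allI impI, elim conjE)
  fix x and l :: 'a assume x: "\<forall>n. x n \<in> {0..u}" "x \<longlonglongrightarrow> l"
  have "0 \<le> l" by (rule tendsto_le_lattice[OF sequentially_bot tendsto_const x(2)]) (use x(1) in auto)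
  moreover have "l \<le> u" by (rule tendsto_le_lattice[OF sequentially_bot x(2) tendsto_const]) (use x(1) in auto)
  ultimately show "l \<in> {0..u}" by simp
qed

text \<open>The energy is a Riemann sum of \<open>\<integral> f ((x - t u)\<^sup>+) dt\<close>, which is half the square of the
  \<open>L\<^sub>2\<close> norm when \<open>f\<close> is an integral and \<open>u = 1\<close>.\<close>

lemma weakly_compact_interval:
  fixes u :: "'a::banach_lattice"
  assumes oc: "order_continuous (whole_lattice :: 'a nlattice)"
  shows "weakly_compact {0..u}"
proof (rule weakly_compact_of_energy[OF closed_interval convex_interval])
  show "norm x \<le> norm u" if "x \<in> {0..u}" for x using that by (auto intro: norm_mono_nonneg)
  fix e :: real assume "0 < e"
  obtain f :: "'a \<Rightarrow> real" and d where f: "bounded_linear f" "\<And>x. 0 \<le> x \<Longrightarrow> 0 \<le> f x" and d: "0 < d"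
      "\<And>z. 0 \<le> z \<Longrightarrow> z \<le> u \<Longrightarrow> f z < d \<Longrightarrow> norm z < e"
    using order_continuous_control[OF oc \<open>0 < e\<close>, of u] by blast
  have lin: "linear f" using f(1) by (rule bounded_linear.linear)
  have mono: "f x \<le> f y" if "x \<le> y" for x y
    using f(2)[of "y - x"] that linear_diff[OF lin, of y x] by simp
  \<comment> \<open>One half of \<open>d\<close> pays for the thickness of the slices, the other
    half for the midpoint gap of the energy.\<close>
  obtain N :: nat where N: "0 < N" "f u / N < d / 2"
  proof -
    obtain N :: nat where "2 * f u / d < N" using reals_Archimedean2 by blast
    then have "2 * f u < d * real (Suc N)" using d(1) by (simp add: field_simps)
    then show ?thesis using that[of "Suc N"] by (simp add: field_simps)
  qed
  define t where "t i = (real i / real N) *\<^sub>R u" for i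
  define E where "E x = (\<Sum>i<N. f (sup (x - t i) 0))" for x
  show "\<exists>E b eta. 0 < (eta :: real) \<and> (\<forall>x\<in>{0..u}. 0 \<le> E x \<and> E x \<le> (b::real)) \<and>
      (\<forall>x\<in>{0..u}. \<forall>y\<in>{0..u}. E x + E y - 2 * E ((1/2) *\<^sub>R (x + y)) < eta \<longrightarrow> norm (x - y) < e)"
  proof (rule exI[of _ E], rule exI[of _ "E u"], rule exI[of _ "d / 2"], intro conjI ballI impI)
    show "0 < d / 2" using d by simp
    fix x assume x: "x \<in> {0..u}"
    show "0 \<le> E x" unfolding E_def by (intro sum_nonneg f) simp
    show "E x \<le> E u" unfolding E_def using x by (intro sum_mono mono sup_mono diff_right_mono) auto
    fix y assume y: "y \<in> {0..u}" and gap: "E x + E y - 2 * E ((1/2) *\<^sub>R (x + y)) < d / 2"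
    \<comment> \<open>By homogeneity the factor 2 turns the midpoint into a sum, so the midpoint gap
      of \<open>E\<close> is the sum of the additivity gaps under \<open>f\<close>.\<close>
    have two: "2 * f (sup ((1/2) *\<^sub>R (x + y) - t i) 0) = f (sup ((x - t i) + (y - t i)) 0)" for i
    proof -
      have "2 *\<^sub>R sup ((1/2) *\<^sub>R (x + y) - t i) 0 = sup (2 *\<^sub>R ((1/2) *\<^sub>R (x + y) - t i)) (2 *\<^sub>R 0)"
        by (rule scaleR_sup) simp
      also have "2 *\<^sub>R ((1/2) *\<^sub>R (x + y) - t i) = (x - t i) + (y - t i)"
        by (simp add: scaleR_diff_right scaleR_2 algebra_simps)
      finally show ?thesis using linear_scale[OF lin, of 2] by (metis real_scaleR_def scaleR_zero_right)
    qed
    have "\<bar>x - y\<bar> \<le> (1 / real N) *\<^sub>R u +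
      (\<Sum>i<N. sup (x - t i) 0 + sup (y - t i) 0 - sup ((x - t i) + (y - t i)) 0)"
      using abs_diff_le_sum_gap[of x u y N] x y N(1) by (simp only: t_def atLeastAtMost_iff)
    then have "f \<bar>x - y\<bar> \<le> f ((1 / real N) *\<^sub>R u +
      (\<Sum>i<N. sup (x - t i) 0 + sup (y - t i) 0 - sup ((x - t i) + (y - t i)) 0))" by (rule mono)
    also have "\<dots> = f u / N + (\<Sum>i<N. f (sup (x - t i) 0) + f (sup (y - t i) 0) - f (sup ((x - t i) + (y - t i)) 0))"
      by (simp only: linear_add[OF lin] linear_sum[OF lin] linear_diff[OF lin] linear_scale[OF lin]) simp
    also have "\<dots> = f u / N + (E x + E y - 2 * E ((1/2) *\<^sub>R (x + y)))"
      by (simp only: E_def sum.distrib sum_subtractf sum_distrib_left two)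
    also have "\<dots> < d" using gap N(2) by linarith
    finally have small: "f \<bar>x - y\<bar> < d" .
    have "\<bar>x - y\<bar> \<le> u"
    proof (rule abs_leI)
      show "x - y \<le> u" using diff_mono[of x u 0 y] x y by simp
      show "- (x - y) \<le> u" using diff_mono[of y u 0 x] x y by simp
    qed
    then show "norm (x - y) < e" using d(2)[OF _ _ small] by simp
  qed
qed

section \<open>Disjointness and band projections\<close>

text \<open>The left-hand side is below both \<open>inf a c + a\<close> and
  \<open>inf a c + b\<close>, and the infimum of these two is the right-hand side.\<close>

lemma inf_add_le:
  fixes a b c :: "'a::lattice_ab_group_add"
  assumes "0 \<le> a" "0 \<le> b" "0 \<le> c"
  shows "inf a (b + c) \<le> inf a b + inf a c"
proof -
  have "inf a (b + c) \<le> inf a c + a"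
    using assms by (intro le_infI1) (simp add: add_increasing)
  moreover have "inf a (b + c) \<le> inf a c + b"
  proof -
    have "inf a (b + c) \<le> inf (a + b) (c + b)"
      using assms by (intro inf_mono) (simp_all add: add_increasing2 add.commute)
    then show ?thesis by (simp only: add_inf_distrib_right)
  qed
  ultimately have "inf a (b + c) \<le> inf (inf a c + a) (inf a c + b)" by (rule le_infI)
  also have "\<dots> = inf a b + inf a c"
    by (subst add_inf_distrib_left[symmetric]) (rule add.commute)
  finally show ?thesis .
qed

definition disjoint_elements :: "'a::banach_lattice \<Rightarrow> 'a \<Rightarrow> bool" where
  "disjoint_elements x y \<longleftrightarrow> inf \<bar>x\<bar> \<bar>y\<bar> = 0"

lemma disjoint_elements_iff: "disjoint_elements x y \<longleftrightarrow> inf \<bar>x\<bar> \<bar>y\<bar> \<le> 0"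
  unfolding disjoint_elements_def by (auto intro: antisym)

lemma disjoint_elements_commute: "disjoint_elements x y \<longleftrightarrow> disjoint_elements y x"
  by (simp add: disjoint_elements_def inf_commute)

lemma disjoint_elements_mono:
  assumes "disjoint_elements x y" "\<bar>x'\<bar> \<le> \<bar>x\<bar>" "\<bar>y'\<bar> \<le> \<bar>y\<bar>"
  shows "disjoint_elements x' y'"
  using assms unfolding disjoint_elements_iff by (meson inf_mono order_trans)

lemma disjoint_elements_self: "disjoint_elements x x \<longleftrightarrow> x = 0"
  by (simp add: disjoint_elements_def)

lemma disjoint_elements_0 [simp]: "disjoint_elements 0 x" "disjoint_elements x 0"
  by (simp_all add: disjoint_elements_def inf_absorb1 inf_absorb2)

lemma disjoint_elements_add:
  assumes "disjoint_elements x z" "disjoint_elements y z"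
  shows "disjoint_elements (x + y) z"
proof -
  have "inf \<bar>x + y\<bar> \<bar>z\<bar> \<le> inf \<bar>z\<bar> (\<bar>x\<bar> + \<bar>y\<bar>)"
    by (subst inf_commute) (intro inf_mono order_refl abs_triangle_ineq)
  also have "\<dots> \<le> inf \<bar>z\<bar> \<bar>x\<bar> + inf \<bar>z\<bar> \<bar>y\<bar>" by (intro inf_add_le) simp_all
  also have "\<dots> = 0" using assms by (simp add: disjoint_elements_def inf_commute)
  finally show ?thesis by (simp add: disjoint_elements_iff)
qed

text \<open>Integer multiples follow from additivity, and any real multiple is dominated in modulus
  by an integer one.\<close>

lemma disjoint_elements_scaleR:
  assumes "disjoint_elements x y"
  shows "disjoint_elements (r *\<^sub>R x) y"
proof -
  have "disjoint_elements (real n *\<^sub>R x) y" for n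
    by (induction n) (auto simp: scaleR_add_left add.commute intro: disjoint_elements_add assms)
  moreover obtain n :: nat where "\<bar>r\<bar> \<le> n" using real_arch_simple by blast
  then have "\<bar>r *\<^sub>R x\<bar> \<le> \<bar>real n *\<^sub>R x\<bar>"
    by (simp add: abs_scaleR_lattice scaleR_right_mono)
  ultimately show ?thesis using disjoint_elements_mono by blast
qed

lemma disjoint_elements_minus: "disjoint_elements x y \<Longrightarrow> disjoint_elements (- x) y"
  by (simp add: disjoint_elements_def)

text \<open>Disjoint summands cannot cancel: in
  \<open>\<bar>x\<bar> \<le> \<bar>x + y\<bar> + \<bar>y\<bar>\<close> the last term contributes
  nothing below \<open>\<bar>x\<bar>\<close>.\<close>

lemma abs_le_abs_add_disjoint:
  assumes "disjoint_elements x y"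
  shows "\<bar>x\<bar> \<le> \<bar>x + y\<bar>"
proof -
  have "\<bar>x\<bar> \<le> \<bar>x + y\<bar> + \<bar>y\<bar>" using abs_triangle_ineq4[of "x + y" y] by simp
  then have "\<bar>x\<bar> = inf \<bar>x\<bar> (\<bar>x + y\<bar> + \<bar>y\<bar>)" by (simp only: inf_absorb1)
  also have "\<dots> \<le> inf \<bar>x\<bar> \<bar>x + y\<bar> + inf \<bar>x\<bar> \<bar>y\<bar>" by (intro inf_add_le) simp_all
  also have "\<dots> \<le> \<bar>x + y\<bar>" using assms by (simp add: disjoint_elements_def)
  finally show ?thesis .
qed

lemma abs_add_disjoint:
  assumes "disjoint_elements x y"
  shows "\<bar>x + y\<bar> = \<bar>x\<bar> + \<bar>y\<bar>"
proof (rule antisym[OF abs_triangle_ineq])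
  have "\<bar>y\<bar> \<le> \<bar>x + y\<bar>"
    using abs_le_abs_add_disjoint[of y x] assms by (simp add: disjoint_elements_commute add.commute)
  with abs_le_abs_add_disjoint[OF assms] have "sup \<bar>x\<bar> \<bar>y\<bar> \<le> \<bar>x + y\<bar>" by (rule le_supI)
  moreover have "\<bar>x\<bar> + \<bar>y\<bar> = sup \<bar>x\<bar> \<bar>y\<bar> + inf \<bar>x\<bar> \<bar>y\<bar>"
    by (rule add_eq_inf_sup)
  ultimately show "\<bar>x\<bar> + \<bar>y\<bar> \<le> \<bar>x + y\<bar>" using assms by (simp add: disjoint_elements_def)
qed

lemma disjoint_elements_sum:
  assumes "finite I" "\<And>i. i \<in> I \<Longrightarrow> disjoint_elements (x i) z"
  shows "disjoint_elements (\<Sum>i\<in>I. x i) z"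
  using assms by (induction I rule: finite_induct) (auto intro: disjoint_elements_add)

text \<open>Only the moduli of the coefficients enter, so signs can be changed without changing the
  norm.\<close>

lemma abs_sum_disjoint:
  fixes x :: "nat \<Rightarrow> 'a::banach_lattice"
  assumes "\<And>i j. i \<noteq> j \<Longrightarrow> disjoint_elements (x i) (x j)"
  shows "\<bar>\<Sum>i<n. a i *\<^sub>R x i\<bar> = (\<Sum>i<n. \<bar>a i\<bar> *\<^sub>R \<bar>x i\<bar>)"
proof (induction n)
  case (Suc n)
  have "disjoint_elements (\<Sum>i<n. a i *\<^sub>R x i) (x n)"
    by (intro disjoint_elements_sum disjoint_elements_scaleR assms) auto
  then have "disjoint_elements (\<Sum>i<n. a i *\<^sub>R x i) (a n *\<^sub>R x n)"
    using disjoint_elements_scaleR disjoint_elements_commute by blast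
  then show ?case using Suc by (simp add: abs_add_disjoint abs_scaleR_lattice)
qed simp

section \<open>Splitting along a closed ideal\<close>

lemma closed_ideal_solid:
  assumes "closed_ideal Y" "\<bar>x\<bar> \<le> \<bar>y\<bar>" "y \<in> Y" shows "x \<in> Y"
  using assms unfolding closed_ideal_def by simp

lemma closed_ideal_closed: "closed_ideal Y \<Longrightarrow> closed Y"
  by (simp add: closed_ideal_def)

text \<open>Subtract from \<open>x\<close> ever larger elements of \<open>Y\<close> in [0, x]. The
  differences are directed downwards and converge in norm; closedness of \<open>Y\<close> keeps what
  was subtracted inside \<open>Y\<close>.\<close>

lemma order_continuous_band_component:
  fixes Y :: "'a::banach_lattice set"
  assumes oc: "order_continuous (whole_lattice :: 'a nlattice)" and Y: "closed_ideal Y" and x: "0 \<le> x"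
  obtains z where "x - z \<in> Y" "\<And>y. y \<in> Y \<Longrightarrow> disjoint_elements z y"
proof -
  note sub = closed_ideal_subspace[OF Y]
  define A where "A = {x - y | y. y \<in> Y \<and> 0 \<le> y \<and> y \<le> x}"
  have AI: "x - y \<in> A" if "y \<in> Y" "0 \<le> y" "y \<le> x" for y using that by (auto simp: A_def)
  have AE: "\<exists>y. a = x - y \<and> y \<in> Y \<and> 0 \<le> y \<and> y \<le> x" if "a \<in> A" for a using that by (auto simp: A_def)
  have "x - 0 \<in> A" using AI[of 0] x subspace_0[OF sub] by simp
  then have ne: "A \<noteq> {}" by blast
  have dir: "\<exists>c\<in>A. c \<le> a \<and> c \<le> b" if ab: "a \<in> A" "b \<in> A" for a b
  proof -
    obtain y w where yw: "a = x - y" "y \<in> Y" "0 \<le> y" "y \<le> x" "b = x - w" "w \<in> Y" "0 \<le> w" "w \<le> x"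
      using AE[OF ab(1)] AE[OF ab(2)] by auto
    have "x - sup y w \<in> A" using yw closed_ideal_sup[OF Y] by (intro AI) (auto intro: le_supI1)
    moreover have "x - sup y w \<le> a \<and> x - sup y w \<le> b"
      unfolding yw(1,5) by (intro conjI diff_left_mono) simp_all
    ultimately show ?thesis by (rule rev_bexI)
  qed
  have lb: "0 \<le> a" if "a \<in> A" for a using AE[OF that] by auto
  obtain c where c: "\<And>a. a \<in> A \<Longrightarrow> c \<le> a"
      "\<And>e. 0 < e \<Longrightarrow> \<exists>a\<in>A. \<forall>b\<in>A. b \<le> a \<longrightarrow> norm (b - c) < e"
    using order_continuous_directed_limit[OF oc ne dir lb] by blast
  have Yclosed: "closed Y" by (rule closed_ideal_closed[OF Y])
  have "x - c \<in> closure Y" and c0: "c \<in> closure {x. 0 \<le> x}"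
  proof -
    have "(\<exists>y\<in>Y. dist y (x - c) < e) \<and> (\<exists>a\<in>{x. 0 \<le> x}. dist a c < e)" if e: "0 < e" for e
    proof -
      obtain a where a: "a \<in> A" "norm (a - c) < e" using c(2)[OF e] by blast
      obtain y where y: "a = x - y" "y \<in> Y" using AE[OF a(1)] by auto
      have "dist y (x - c) = norm (a - c)" unfolding y(1) dist_norm
        by (simp add: norm_minus_commute algebra_simps)
      then have "dist y (x - c) < e" using a(2) by (simp only:)
      moreover have "dist a c < e" using a(2) by (simp only: dist_norm)
      ultimately show ?thesis using y(2) lb[OF a(1)] by (intro conjI bexI[of _ y] bexI[of _ a]) simp_all
    qed
    then show "x - c \<in> closure Y" "c \<in> closure {x. 0 \<le> x}" unfolding closure_approachable by blast+
  qed
  then have xc: "x - c \<in> Y" and c0: "0 \<le> c" 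
    unfolding closure_closed[OF Yclosed] closure_closed[OF closed_nonneg] by simp_all
  show ?thesis
  proof
    show "x - c \<in> Y" by fact
    fix y assume y: "y \<in> Y"
    \<comment> \<open>\<open>(x - c) + ?m\<close> is again an element of \<open>Y\<close> in [0, x],
      so \<open>x\<close> minus it belongs to \<open>A\<close> and is at least \<open>c\<close>.
      This forces \<open>?m \<le> 0\<close>.\<close>
    let ?m = "inf c \<bar>y\<bar>"
    have m0: "0 \<le> ?m" using c0 by simp
    have "\<bar>?m\<bar> \<le> \<bar>y\<bar>" using m0 by simp
    then have mY: "?m \<in> Y" using y by (rule closed_ideal_solid[OF Y])
    have "0 \<le> x - c" using c(1)[OF \<open>x - 0 \<in> A\<close>] by simp
    moreover have "(x - c) + ?m \<le> x" using add_left_mono[OF inf_le1[of c "\<bar>y\<bar>"], of "x - c"] by simp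
    ultimately have "x - ((x - c) + ?m) \<in> A"
      by (intro AI subspace_add[OF sub xc mY] add_nonneg_nonneg m0)
    then have "c \<le> x - ((x - c) + ?m)" by (rule c(1))
    moreover have "x - ((x - c) + m) = c - m" for m by simp
    ultimately have "c \<le> c - ?m" by (simp only:)
    moreover have "m \<le> 0" if "c \<le> c - m" for m using that by simp
    ultimately have "?m \<le> 0" by blast
    then show "disjoint_elements c y" using c0 by (simp add: disjoint_elements_iff)
  qed
qed

text \<open>This is the component in the disjoint complement of \<open>Y\<close>, so that it depends
  only on the coset of \<open>x\<close>.\<close>

definition band_part :: "'a::banach_lattice set \<Rightarrow> 'a \<Rightarrow> 'a" where
  "band_part Y x = (SOME z. x - z \<in> Y \<and> (\<forall>y\<in>Y. disjoint_elements z y))"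

context
  fixes Y :: "'a::banach_lattice set"
  assumes oc: "order_continuous (whole_lattice :: 'a nlattice)" and Y: "closed_ideal Y"
begin

lemma band_part: "x - band_part Y x \<in> Y" "y \<in> Y \<Longrightarrow> disjoint_elements (band_part Y x) y"
proof -
  obtain z1 where z1: "sup x 0 - z1 \<in> Y" "\<And>y. y \<in> Y \<Longrightarrow> disjoint_elements z1 y"
    using order_continuous_band_component[OF oc Y, of "sup x 0"] by auto
  obtain z2 where z2: "sup (- x) 0 - z2 \<in> Y" "\<And>y. y \<in> Y \<Longrightarrow> disjoint_elements z2 y"
    using order_continuous_band_component[OF oc Y, of "sup (- x) 0"] by auto
  have "sup (- x) 0 = sup x 0 - x" using add_sup_distrib_right[of x 0 "- x"] by (simp add: sup_commute)
  then have "x = sup x 0 - sup (- x) 0" by (simp only: diff_diff_eq2 add_diff_cancel_left')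
  then have "x - (z1 - z2) = (sup x 0 - z1) - (sup (- x) 0 - z2)"
    by (metis (no_types, opaque_lifting) diff_diff_eq2 add_diff_eq diff_diff_add add.commute)
  then have "x - (z1 - z2) \<in> Y" using subspace_diff[OF closed_ideal_subspace[OF Y] z1(1) z2(1)] by (simp only:)
  moreover have "disjoint_elements (z1 - z2) y" if "y \<in> Y" for y
    using disjoint_elements_add[OF z1(2)[OF that] disjoint_elements_minus[OF z2(2)[OF that]]] by simp
  ultimately have "\<exists>z. x - z \<in> Y \<and> (\<forall>y\<in>Y. disjoint_elements z y)" by blast
  from someI_ex[OF this] show "x - band_part Y x \<in> Y" "y \<in> Y \<Longrightarrow> disjoint_elements (band_part Y x) y"
    unfolding band_part_def by auto
qed

text \<open>The difference of two candidates lies in \<open>Y\<close> and is disjoint from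
  \<open>Y\<close>, hence from itself. Linearity follows by checking candidates.\<close>

lemma band_part_unique:
  assumes "x - z \<in> Y" "\<And>y. y \<in> Y \<Longrightarrow> disjoint_elements z y"
  shows "band_part Y x = z"
proof -
  let ?d = "band_part Y x - z"
  have "(x - z) - (x - band_part Y x) \<in> Y"
    by (rule subspace_diff[OF closed_ideal_subspace[OF Y] assms(1) band_part(1)])
  then have d: "?d \<in> Y" by simp
  have "disjoint_elements ?d ?d"
    using disjoint_elements_add[OF band_part(2)[OF d, of x] disjoint_elements_minus[OF assms(2)[OF d]]] by simp
  then show ?thesis by (simp add: disjoint_elements_self)
qed

lemma band_part_cong:
  assumes "x - x' \<in> Y" shows "band_part Y x = band_part Y x'"
proof (rule band_part_unique)
  have "(x - x') + (x' - band_part Y x') \<in> Y"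
    by (rule subspace_add[OF closed_ideal_subspace[OF Y] assms band_part(1)])
  then show "x - band_part Y x' \<in> Y" by simp
qed (rule band_part(2))

lemma band_part_add: "band_part Y (x + y) = band_part Y x + band_part Y y"
proof (rule band_part_unique)
  have "(x - band_part Y x) + (y - band_part Y y) \<in> Y"
    by (rule subspace_add[OF closed_ideal_subspace[OF Y] band_part(1) band_part(1)])
  then show "x + y - (band_part Y x + band_part Y y) \<in> Y" by (simp add: algebra_simps)
qed (intro disjoint_elements_add band_part(2))

lemma band_part_scaleR: "band_part Y (r *\<^sub>R x) = r *\<^sub>R band_part Y x"
proof (rule band_part_unique)
  show "r *\<^sub>R x - r *\<^sub>R band_part Y x \<in> Y"
    using subspace_scale[OF closed_ideal_subspace[OF Y] band_part(1), of r x] by (simp add: scaleR_diff_right)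
qed (intro disjoint_elements_scaleR band_part(2))

text \<open>For every y in \<open>Y\<close>, \<open>x - y\<close> is the sum of
  \<open>band_part Y x\<close> and an element of \<open>Y\<close> disjoint from it, so
  \<open>band_part Y x\<close> is dominated by \<open>x - y\<close> in modulus.\<close>

lemma norm_band_part_le: "norm (band_part Y x) \<le> infdist x Y"
proof -
  have "norm (band_part Y x) \<le> dist x y" if y: "y \<in> Y" for y
  proof -
    have "(x - band_part Y x) - y \<in> Y"
      by (rule subspace_diff[OF closed_ideal_subspace[OF Y] band_part(1) y])
    from abs_le_abs_add_disjoint[OF band_part(2)[OF this, of x]]
    have "\<bar>band_part Y x\<bar> \<le> \<bar>x - y\<bar>" by simp
    then show ?thesis unfolding dist_norm by (rule norm_le_of_abs_le)
  qed
  moreover have "Y \<noteq> {}" using subspace_0[OF closed_ideal_subspace[OF Y]] by blast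
  ultimately show ?thesis unfolding infdist_def by (simp add: cINF_greatest)
qed

end

section \<open>Disjoint sequences and \<open>\<ell>\<^sub>1\<close>\<close>

lemma sub_lattice_sel [simp]:
  "ns_carrier (sub_lattice Y) = Y" "ns_add (sub_lattice Y) = (+)" "ns_zero (sub_lattice Y) = 0"
  "ns_scale (sub_lattice Y) = (*\<^sub>R)" "ns_norm (sub_lattice Y) = norm"
  by (simp_all add: sub_lattice_def)

lemma l1_space_sel [simp]:
  "ns_carrier l1_space = {a. summable (\<lambda>n. \<bar>a n\<bar>)}" "ns_add l1_space = (\<lambda>a b n. a n + b n)"
  "ns_zero l1_space = (\<lambda>n. 0)" "ns_scale l1_space = (\<lambda>r a n. r * a n)"
  "ns_norm l1_space = (\<lambda>a. \<Sum>n. \<bar>a n\<bar>)"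
  by (simp_all add: l1_space_def)

lemma ns_topology_sub_lattice: "ns_topology (sub_lattice Y) = top_of_set Y"
  unfolding topology_eq openin_ns_topology openin_euclidean_subtopology_iff
  by (auto simp: ns_dist_def dist_norm)

lemma embedding_map_of_norm_equiv:
  fixes T :: "'v \<Rightarrow> 'a::banach_lattice" and W :: "('v, 'm) nspace_scheme"
  assumes T: "\<And>x. x \<in> ns_carrier W \<Longrightarrow> T x \<in> Y" and c: "0 < c" "0 < C"
    and dist: "\<And>x y. x \<in> ns_carrier W \<Longrightarrow> y \<in> ns_carrier W \<Longrightarrow>
      c * ns_dist W x y \<le> norm (T x - T y) \<and> norm (T x - T y) \<le> C * ns_dist W x y"
    and inj: "inj_on T (ns_carrier W)"
  shows "embedding_map (ns_topology W) (ns_topology (sub_lattice Y)) T"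
proof -
  let ?W = "ns_carrier W"
  have sub: "subtopology (top_of_set Y) (T ` ?W) = top_of_set (T ` ?W)"
    using T by (auto simp: subtopology_subtopology Int_absorb1 image_subset_iff)
  have "homeomorphic_map (ns_topology W) (top_of_set (T ` ?W)) T"
  proof (rule bijective_open_imp_homeomorphic_map)
    show "continuous_map (ns_topology W) (top_of_set (T ` ?W)) T"
      unfolding continuous_map_in_subtopology
    proof
      show "continuous_map (ns_topology W) euclidean T"
        unfolding continuous_map_def
      proof (intro conjI allI impI)
        fix U :: "'a set" assume "openin euclidean U"
        then have U: "open U" by simp
        show "openin (ns_topology W) {x \<in> topspace (ns_topology W). T x \<in> U}"
          unfolding openin_ns_topology
        proof (intro conjI ballI)
          fix x assume x: "x \<in> {x \<in> topspace (ns_topology W). T x \<in> U}"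
          then obtain e where e: "0 < e" "\<And>v. dist v (T x) < e \<Longrightarrow> v \<in> U"
            using U unfolding open_dist by auto
          have "T y \<in> U" if y: "y \<in> ?W" "ns_dist W y x < e / C" for y
          proof (rule e(2))
            have "norm (T y - T x) \<le> C * ns_dist W y x" using dist[OF y(1), of x] x by simp
            also have "\<dots> < e" using y(2) c by (simp add: field_simps)
            finally show "dist (T y) (T x) < e" by (simp add: dist_norm)
          qed
          then show "\<exists>e>0. \<forall>y\<in>?W. ns_dist W y x < e \<longrightarrow> y \<in> {x \<in> topspace (ns_topology W). T x \<in> U}"
            using e(1) c by (intro exI[of _ "e / C"]) simp
        qed auto
      qed simp
    qed simp
    show "open_map (ns_topology W) (top_of_set (T ` ?W)) T"
      unfolding open_map_def
    proof (intro allI impI)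
      fix U assume U: "openin (ns_topology W) U"
      show "openin (top_of_set (T ` ?W)) (T ` U)"
        unfolding openin_euclidean_subtopology_iff
      proof (intro conjI ballI)
        have UW: "U \<subseteq> ?W" using U by (simp add: openin_ns_topology)
        then show "T ` U \<subseteq> T ` ?W" by (rule image_mono)
        fix v assume "v \<in> T ` U"
        then obtain x where x: "x \<in> U" "v = T x" by auto
        then obtain e where e: "0 < e" "\<And>y. y \<in> ?W \<Longrightarrow> ns_dist W y x < e \<Longrightarrow> y \<in> U"
          using U unfolding openin_ns_topology by auto
        have "T y \<in> T ` U" if y: "y \<in> ?W" "dist (T y) v < c * e" for y
        proof (intro imageI e(2)[OF y(1)])
          have "c * ns_dist W y x \<le> norm (T y - T x)" using dist[OF y(1), of x] x(1) UW by blast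
          also have "\<dots> < c * e" using y(2) x(2) by (simp add: dist_norm)
          finally show "ns_dist W y x < e" using c by simp
        qed
        then show "\<exists>e>0. \<forall>w\<in>T ` ?W. dist w v < e \<longrightarrow> w \<in> T ` U"
          using e(1) c by (intro exI[of _ "c * e"]) auto
      qed
    qed
  qed (use inj in auto)
  then show ?thesis by (simp add: embedding_map_def ns_topology_sub_lattice sub)
qed

text \<open>The embedding sends \<open>a\<close> to the sum of the \<open>a n *\<^sub>R x n\<close>.
  The bound on the \<open>x n\<close> gives continuity; the estimate from below comes from
  \<open>f\<close>, after disjointness has removed the signs of the coefficients.\<close>

lemma contains_l1_of_disjoint:
  fixes x :: "nat \<Rightarrow> 'a::banach_lattice" and f :: "'a \<Rightarrow> real"
  assumes Y: "closed_ideal Y" and x: "\<And>n. x n \<in> Y" "\<And>n. norm (x n) \<le> 1"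
    and disj: "\<And>i j. i \<noteq> j \<Longrightarrow> disjoint_elements (x i) (x j)"
    and f: "bounded_linear f" and e: "0 < e" "\<And>n. e \<le> f (x n)"
  shows "contains_isomorphic_copy (sub_lattice Y) l1_space"
proof -
  note sub = closed_ideal_subspace[OF Y]
  define T where "T a = (\<Sum>n. a n *\<^sub>R x n)" for a
  have term_le: "norm (a n *\<^sub>R x n) \<le> \<bar>a n\<bar>" for a n
    using mult_left_mono[OF x(2), of "\<bar>a n\<bar>" n] by simp
  have abs_sum: "summable (\<lambda>n. norm (a n *\<^sub>R x n))" if "summable (\<lambda>n. \<bar>a n\<bar>)" for a
    by (rule summable_comparison_test[OF _ that]) (use term_le in auto)
  have sum: "summable (\<lambda>n. a n *\<^sub>R x n)" if "summable (\<lambda>n. \<bar>a n\<bar>)" for a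
    by (rule summable_norm_cancel[OF abs_sum[OF that]])
  have lim: "(\<lambda>n. \<Sum>i<n. a i *\<^sub>R x i) \<longlonglongrightarrow> T a" if "summable (\<lambda>n. \<bar>a n\<bar>)" for a
    unfolding T_def by (rule summable_LIMSEQ[OF sum[OF that]])
  have TY: "T a \<in> Y" if "summable (\<lambda>n. \<bar>a n\<bar>)" for a
    by (rule closed_sequentially[OF closed_ideal_closed[OF Y] _ lim[OF that]])
      (intro subspace_sum[OF sub] subspace_scale[OF sub] x)
  have upper: "norm (T a) \<le> (\<Sum>n. \<bar>a n\<bar>)" if "summable (\<lambda>n. \<bar>a n\<bar>)" for a
    unfolding T_def
    by (rule order_trans[OF summable_norm[OF abs_sum[OF that]]])
      (intro suminf_le allI term_le abs_sum that)
  obtain K where K: "0 < K" "\<And>y. norm (f y) \<le> norm y * K" using bounded_linear.pos_bounded[OF f] by blast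
  have lin: "linear f" using f by (rule bounded_linear.linear)
  have lower_part: "e * (\<Sum>i<n. \<bar>a i\<bar>) \<le> K * norm (\<Sum>i<n. a i *\<^sub>R x i)" for a n
  proof -
    \<comment> \<open>\<open>?v\<close> has the norm of the original partial sum, but its
      coefficients are nonnegative, so nothing cancels when \<open>f\<close> is applied.\<close>
    let ?v = "\<Sum>i<n. \<bar>a i\<bar> *\<^sub>R x i"
    have "\<bar>?v\<bar> = \<bar>\<Sum>i<n. a i *\<^sub>R x i\<bar>" by (simp add: abs_sum_disjoint[OF disj])
    then have nv: "norm ?v = norm (\<Sum>i<n. a i *\<^sub>R x i)" by (metis norm_abs_eq)
    have "e * (\<Sum>i<n. \<bar>a i\<bar>) = (\<Sum>i<n. \<bar>a i\<bar> * e)" by (simp add: sum_distrib_left mult.commute)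
    also have "\<dots> \<le> (\<Sum>i<n. \<bar>a i\<bar> * f (x i))" by (intro sum_mono mult_left_mono e) simp
    also have "\<dots> = f ?v" by (simp add: linear_sum[OF lin] linear_scale[OF lin])
    also have "\<dots> \<le> norm ?v * K" using K(2)[of ?v] by simp
    finally show ?thesis by (simp add: nv mult.commute)
  qed
  have lower: "e * (\<Sum>n. \<bar>a n\<bar>) \<le> K * norm (T a)" if a: "summable (\<lambda>n. \<bar>a n\<bar>)" for a
  proof (rule LIMSEQ_le)
    show "(\<lambda>n. e * (\<Sum>i<n. \<bar>a i\<bar>)) \<longlonglongrightarrow> e * (\<Sum>n. \<bar>a n\<bar>)"
      by (intro tendsto_intros summable_LIMSEQ a)
    show "(\<lambda>n. K * norm (\<Sum>i<n. a i *\<^sub>R x i)) \<longlonglongrightarrow> K * norm (T a)"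
      by (intro tendsto_intros lim a)
  qed (use lower_part in blast)
  have add: "T (\<lambda>n. a n + b n) = T a + T b" if "summable (\<lambda>n. \<bar>a n\<bar>)" "summable (\<lambda>n. \<bar>b n\<bar>)" for a b
    unfolding T_def using suminf_add[OF sum[OF that(1)] sum[OF that(2)]] by (simp add: scaleR_add_left)
  have scale: "T (\<lambda>n. r * a n) = r *\<^sub>R T a" if "summable (\<lambda>n. \<bar>a n\<bar>)" for r a
    unfolding T_def using suminf_scaleR_right[OF sum[OF that], of r] by simp
  have summ_scale: "summable (\<lambda>n. \<bar>r * a n\<bar>)" if "summable (\<lambda>n. \<bar>a n\<bar>)" for r and a :: "nat \<Rightarrow> real"
    using summable_mult[OF that, of "\<bar>r\<bar>"] by (simp add: abs_mult)
  have summ_add: "summable (\<lambda>n. \<bar>a n + b n\<bar>)" if "summable (\<lambda>n. \<bar>a n\<bar>)" "summable (\<lambda>n. \<bar>b n\<bar>)"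
    for a b :: "nat \<Rightarrow> real"
    by (rule summable_comparison_test[OF _ summable_add[OF that]]) auto
  have diff: "T (\<lambda>n. a n + - 1 * b n) = T a - T b" "summable (\<lambda>n. \<bar>a n + - 1 * b n\<bar>)"
    if "summable (\<lambda>n. \<bar>a n\<bar>)" "summable (\<lambda>n. \<bar>b n\<bar>)" for a b
    using add[OF that(1) summ_scale[OF that(2), of "-1"]] scale[OF that(2), of "-1"]
      summ_add[OF that(1) summ_scale[OF that(2), of "-1"]] by simp_all
  have d: "ns_dist l1_space a b = (\<Sum>n. \<bar>a n + - 1 * b n\<bar>)" for a b by (simp add: ns_dist_def)
  have "embedding_map (ns_topology l1_space) (ns_topology (sub_lattice Y)) T"
  proof (rule embedding_map_of_norm_equiv[where c = "e / K" and C = 1])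
    fix a b assume "a \<in> ns_carrier l1_space" "b \<in> ns_carrier l1_space"
    then have ab: "summable (\<lambda>n. \<bar>a n\<bar>)" "summable (\<lambda>n. \<bar>b n\<bar>)" by simp_all
    show "e / K * ns_dist l1_space a b \<le> norm (T a - T b) \<and> norm (T a - T b) \<le> 1 * ns_dist l1_space a b"
      using lower[OF diff(2)[OF ab]] upper[OF diff(2)[OF ab]] K(1)
      unfolding d diff(1)[OF ab, symmetric] by (simp add: field_simps)
  next
    show "inj_on T (ns_carrier l1_space)"
    proof (rule inj_onI)
      fix a b assume "a \<in> ns_carrier l1_space" "b \<in> ns_carrier l1_space" and eq: "T a = T b"
      then have ab: "summable (\<lambda>n. \<bar>a n\<bar>)" "summable (\<lambda>n. \<bar>b n\<bar>)" by simp_all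
      have "e * (\<Sum>n. \<bar>a n + - 1 * b n\<bar>) \<le> 0" using lower[OF diff(2)[OF ab]] diff(1)[OF ab] eq by simp
      then have "(\<Sum>n. \<bar>a n + - 1 * b n\<bar>) \<le> 0" using e(1) by (simp add: mult_le_0_iff)
      moreover have "0 \<le> (\<Sum>n. \<bar>a n + - 1 * b n\<bar>)" by (intro suminf_nonneg diff(2)[OF ab]) simp
      ultimately have "(\<Sum>n. \<bar>a n + - 1 * b n\<bar>) = 0" by (rule antisym)
      then show "a = b" using suminf_eq_zero_iff[OF diff(2)[OF ab]] by (simp add: fun_eq_iff)
    qed
  qed (use TY K e in auto)
  moreover have "ns_linear_on l1_space (sub_lattice Y) T"
    using TY add scale by (simp add: ns_linear_on_def)
  ultimately show ?thesis unfolding contains_isomorphic_copy_def by blast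
qed

section \<open>A weakly compact set generating an ideal without
  \<open>\<ell>\<^sub>1\<close>\<close>

lemma maximal_disjoint_family:
  fixes Y :: "'a::banach_lattice set"
  assumes Y: "closed_ideal Y"
  obtains M where "M \<subseteq> {u \<in> Y. 0 \<le> u \<and> norm u \<le> 1}" "pairwise disjoint_elements M"
    "\<And>l. l \<in> Y \<Longrightarrow> 0 \<le> l \<Longrightarrow> (\<And>u. u \<in> M \<Longrightarrow> disjoint_elements l u) \<Longrightarrow> l = 0"
proof -
  let ?A = "{M. M \<subseteq> {u \<in> Y. 0 \<le> u \<and> norm u \<le> 1} \<and> pairwise disjoint_elements M}"
  have "\<exists>M\<in>?A. \<forall>X\<in>?A. M \<subseteq> X \<longrightarrow> X = M"
  proof (rule subset_Zorn')
    fix C assume C: "subset.chain ?A C"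
    have C': "X \<subseteq> {u \<in> Y. 0 \<le> u \<and> norm u \<le> 1}" "pairwise disjoint_elements X" if "X \<in> C" for X
      using C that unfolding subset_chain_def by auto
    have "chain\<^sub>\<subseteq> C" using C unfolding subset_chain_def chain_subset_def by (rule conjunct2)
    then have "pairwise disjoint_elements (\<Union>C)" by (intro pairwise_chain_Union C'(2))
    moreover have "\<Union>C \<subseteq> {u \<in> Y. 0 \<le> u \<and> norm u \<le> 1}" by (rule Union_least[OF C'(1)])
    ultimately show "\<Union>C \<in> ?A" by (intro CollectI conjI)
  qed
  then obtain M where M: "M \<subseteq> {u \<in> Y. 0 \<le> u \<and> norm u \<le> 1}" "pairwise disjoint_elements M"
      and max: "\<And>X. X \<in> ?A \<Longrightarrow> M \<subseteq> X \<Longrightarrow> X = M" by auto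
  show ?thesis
  proof (rule that[OF M])
    fix l assume l: "l \<in> Y" "0 \<le> l" and disj: "\<And>u. u \<in> M \<Longrightarrow> disjoint_elements l u"
    \<comment> \<open>For \<open>l = 0\<close> the convention 1 / 0 = 0 makes \<open>?v = 0\<close>,
      so no case split arises. Maximality puts \<open>?v\<close> into \<open>M\<close>, hence makes
      it disjoint from itself.\<close>
    let ?v = "(1 / norm l) *\<^sub>R l"
    have v: "disjoint_elements ?v u" if "u \<in> M" for u
      by (rule disjoint_elements_scaleR[OF disj[OF that]])
    have "?v \<in> Y" by (rule subspace_scale[OF closed_ideal_subspace[OF Y] l(1)])
    moreover have "0 \<le> ?v" "norm ?v \<le> 1" using l(2) by (simp_all add: scaleR_nonneg_nonneg)
    moreover have "pairwise disjoint_elements (insert ?v M)"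
      using M(2) v disjoint_elements_commute by (auto simp: pairwise_insert)
    ultimately have "insert ?v M \<in> ?A" using M(1) by blast
    then have "insert ?v M = M" by (rule max) blast
    then have "?v \<in> M" by blast
    from v[OF this] have "?v = 0" by (simp only: disjoint_elements_self)
    then show "l = 0" by simp
  qed
qed

text \<open>If \<phi> vanishes it is represented by the inserted 0. Otherwise it is nonzero at some
  \<open>f0\<close>, which is large on finitely many intervals only, and \<phi> lies in the weak*
  closure of their weakly compact union.\<close>

lemma l1_free_weakly_compact_union:
  fixes Y :: "'a::banach_lattice set"
  assumes oc: "order_continuous (whole_lattice :: 'a nlattice)" and Y: "closed_ideal Y"
    and l1: "\<not> contains_isomorphic_copy (sub_lattice Y) l1_space"
    and M: "M \<subseteq> {u \<in> Y. 0 \<le> u \<and> norm u \<le> 1}" "pairwise disjoint_elements M"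
  shows "weakly_compact (insert 0 (\<Union>u\<in>M. {0..u}))"
proof (rule weakly_compactI)
  let ?L = "insert 0 (\<Union>u\<in>M. {0..u})"
  show "norm x \<le> 1" if x: "x \<in> ?L" for x
  proof (cases "x = 0")
    case False
    then obtain u where u: "u \<in> M" "0 \<le> x" "x \<le> u" using x by auto
    have "norm x \<le> norm u" by (rule norm_mono_nonneg[OF u(2,3)])
    also have "\<dots> \<le> 1" using u(1) M(1) by blast
    finally show ?thesis .
  qed simp
  have finite_large: "finite {u \<in> M. \<exists>x\<in>{0..u}. e \<le> \<bar>f x\<bar>}"
    if f: "bounded_linear f" and e: "0 < e" for f and e :: real
  proof (rule ccontr)
    define S where "S = {u \<in> M. \<exists>x\<in>{0..u}. e \<le> \<bar>f x\<bar>}"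
    assume "infinite {u \<in> M. \<exists>x\<in>{0..u}. e \<le> \<bar>f x\<bar>}"
    then have "infinite S" by (simp only: S_def not_False_eq_True)
    then have "\<exists>u :: nat \<Rightarrow> 'a. inj u \<and> range u \<subseteq> S" by (rule infinite_countable_subset)
    then obtain u :: "nat \<Rightarrow> 'a" where u: "inj u" "range u \<subseteq> S" by (elim exE conjE)
    have uS: "u n \<in> S" for n using u(2) rangeI by (rule subsetD)
    have uM: "u n \<in> M" and ux: "\<exists>x\<in>{0..u n}. e \<le> \<bar>f x\<bar>" for n
      using uS[of n] unfolding S_def by simp_all
    \<comment> \<open>A lower bound on \<open>f x\<close> rather than on its modulus may require
      passing to \<open>- x\<close>, which leaves the interval but keeps the modulus below
      \<open>u n\<close>.\<close>
    have "\<exists>x. \<bar>x\<bar> \<le> u n \<and> e \<le> f x" for n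
    proof -
      obtain x where x: "x \<in> {0..u n}" "e \<le> \<bar>f x\<bar>" using ux[of n] by (rule bexE)
      show ?thesis
      proof (cases "0 \<le> f x")
        case True with x show ?thesis by (intro exI[of _ x]) auto
      next
        case False
        with x linear_neg[OF bounded_linear.linear[OF f], of x] show ?thesis
          by (intro exI[of _ "- x"]) auto
      qed
    qed
    then obtain x where x: "\<And>n. \<bar>x n\<bar> \<le> u n" "\<And>n. e \<le> f (x n)" by metis
    have u0: "0 \<le> u n" "u n \<in> Y" "norm (u n) \<le> 1" for n
      using subsetD[OF M(1) uM[of n]] by simp_all
    have xu: "\<bar>x n\<bar> \<le> \<bar>u n\<bar>" for n by (rule order_trans[OF x(1) abs_ge_self])
    have "contains_isomorphic_copy (sub_lattice Y) l1_space"
    proof (rule contains_l1_of_disjoint[OF Y _ _ _ f e x(2)])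
      show "x n \<in> Y" for n by (rule closed_ideal_solid[OF Y xu u0(2)])
      show "norm (x n) \<le> 1" for n by (rule order_trans[OF norm_le_of_abs_le[OF xu] u0(3)])
      show "disjoint_elements (x i) (x j)" if "i \<noteq> j" for i j
      proof (rule disjoint_elements_mono[OF _ xu xu])
        have "u i \<noteq> u j" using u(1) that by (simp add: inj_eq)
        then show "disjoint_elements (u i) (u j)" using M(2) uM by (simp add: pairwise_def)
      qed
    qed
    with l1 show False by (rule notE)
  qed
  fix \<phi> :: "('a \<Rightarrow> real) \<Rightarrow> real" assume \<phi>: "approximable functionals ?L \<phi>"
  show "\<exists>x\<in>?L. \<forall>f. bounded_linear f \<longrightarrow> \<phi> f = f x"
  proof (cases "\<forall>f. bounded_linear f \<longrightarrow> \<phi> f = 0")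
    case True
    have "\<phi> f = f 0" if "bounded_linear f" for f
      using True that linear_0[OF bounded_linear.linear[OF that]] by simp
    then show ?thesis by (intro bexI[of _ 0]) auto
  next
    case False
    then obtain f0 where f0: "bounded_linear f0" "\<phi> f0 \<noteq> 0" by blast
    let ?e = "\<bar>\<phi> f0\<bar> / 2"
    have e: "0 < ?e" using f0(2) by simp
    define M0 where "M0 = {u \<in> M. \<exists>x\<in>{0..u}. ?e \<le> \<bar>f0 x\<bar>}"
    have fin: "finite M0" unfolding M0_def by (rule finite_large[OF f0(1) e])
    have cpt: "weakly_compact (\<Union>u\<in>M0. {0..u})"
      using fin weakly_compact_interval[OF oc] by (intro compactin_Union) auto
    have "approximable functionals (\<Union>u\<in>M0. {0..u}) \<phi>"
      unfolding approximable_def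
    proof (intro allI impI)
      fix F :: "('a \<Rightarrow> real) set" and r :: real assume F: "finite F" "F \<subseteq> functionals" "0 < r"
      \<comment> \<open>Adding \<open>f0\<close> to the tests, with error below half of
        \<open>\<bar>\<phi> f0\<bar>\<close>, keeps \<open>\<bar>f0 x\<bar>\<close> at least
        \<open>?e\<close> and so forces the approximants into the intervals over
        \<open>M0\<close>.\<close>
      have F': "finite (insert f0 F)" "insert f0 F \<subseteq> functionals" "0 < min r ?e" using F f0(1) e by auto
      obtain x where x: "x \<in> ?L" "\<And>f. f \<in> insert f0 F \<Longrightarrow> \<bar>f x - \<phi> f\<bar> < min r ?e"
        using approximableD[OF \<phi> F'] by auto
      have "\<bar>f0 x - \<phi> f0\<bar> < ?e" using x(2)[of f0] by simp
      then have big: "?e \<le> \<bar>f0 x\<bar>" by linarith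
      have "x \<noteq> 0"
      proof
        assume "x = 0"
        with big e linear_0[OF bounded_linear.linear[OF f0(1)]] show False by simp
      qed
      with x(1) obtain u where u: "u \<in> M" "x \<in> {0..u}" by auto
      have "u \<in> M0" unfolding M0_def using u(1) bexI[of "\<lambda>x. ?e \<le> \<bar>f0 x\<bar>", OF big u(2)]
        by (intro CollectI conjI)
      then have "x \<in> (\<Union>u\<in>M0. {0..u})" using u(2) by (rule UN_I)
      then show "\<exists>x\<in>\<Union>u\<in>M0. {0..u}. \<forall>f\<in>F. \<bar>f x - \<phi> f\<bar> < r"
        using x(2) by (intro bexI[of _ x]) auto
    qed
    from weakly_compactD[OF cpt this] obtain x where
      x: "x \<in> (\<Union>u\<in>M0. {0..u})" "\<And>f. bounded_linear f \<Longrightarrow> \<phi> f = f x" by auto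
    have "x \<in> ?L" using x(1) by (auto simp: M0_def)
    then show ?thesis using x(2) by (intro bexI[of _ x] allI impI)
  qed
qed

lemma scaleR_interval_subspace:
  fixes u :: "'a::banach_lattice"
  assumes Z: "subspace Z" and uZ: "{0..u} \<subseteq> Z" and w: "0 \<le> w" "w \<le> real n *\<^sub>R u"
  shows "w \<in> Z"
proof (cases "n = 0")
  case True
  then have "w = 0" using w by simp
  then show ?thesis using subspace_0[OF Z] by simp
next
  case False
  then have n: "0 < real n" by simp
  have "inverse (real n) *\<^sub>R w \<le> inverse (real n) *\<^sub>R (real n *\<^sub>R u)"
    using n by (intro scaleR_left_mono w) simp
  then have "inverse (real n) *\<^sub>R w \<in> {0..u}" using n w(1) by (simp add: scaleR_nonneg_nonneg)
  then have "real n *\<^sub>R (inverse (real n) *\<^sub>R w) \<in> Z" by (intro subspace_scale[OF Z] subsetD[OF uZ])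
  then show ?thesis using n by simp
qed

text \<open>A lower bound \<open>l\<close> of all \<open>x - x \<and> n (u\<^sub>1 + \<dots> + u\<^sub>k)\<close> is disjoint from the family, since
  \<open>l \<and> u\<close> is infinitely small relative to \<open>x\<close>.\<close>

lemma disjoint_family_dense:
  fixes Y :: "'a::banach_lattice set"
  assumes oc: "order_continuous (whole_lattice :: 'a nlattice)" and Y: "closed_ideal Y"
    and M: "\<And>u. u \<in> M \<Longrightarrow> 0 \<le> u"
    and max: "\<And>l. l \<in> Y \<Longrightarrow> 0 \<le> l \<Longrightarrow> (\<And>u. u \<in> M \<Longrightarrow> disjoint_elements l u) \<Longrightarrow> l = 0"
    and Z: "subspace Z" "closed Z" "\<And>u. u \<in> M \<Longrightarrow> {0..u} \<subseteq> Z"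
  shows "Y \<subseteq> Z"
proof -
  have nonneg: "x \<in> Z" if xY: "x \<in> Y" and x0: "0 \<le> x" for x
  proof -
    define s where "s F n = (\<Sum>u\<in>F. real n *\<^sub>R u)" for F :: "'a set" and n :: nat
    define A where "A = {x - inf x (s F n) | F n. finite F \<and> F \<subseteq> M}"
    have AI: "x - inf x (s F n) \<in> A" if "finite F" "F \<subseteq> M" for F n using that by (auto simp: A_def)
    have AE: "\<exists>F n. a = x - inf x (s F n) \<and> finite F \<and> F \<subseteq> M" if "a \<in> A" for a
      using that by (auto simp: A_def)
    have smono: "s F n \<le> s G k" if "F \<subseteq> G" "n \<le> k" "finite G" "G \<subseteq> M" for F G n k
    proof -
      have "s F n \<le> s G n" unfolding s_def
        using that M by (intro sum_mono2) (auto intro!: scaleR_nonneg_nonneg)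
      also have "\<dots> \<le> s G k" unfolding s_def
        using that M by (intro sum_mono scaleR_right_mono) auto
      finally show ?thesis .
    qed
    have s0: "0 \<le> s F n" if "F \<subseteq> M" for F n
      unfolding s_def using that M by (intro sum_nonneg scaleR_nonneg_nonneg) auto
    have ne: "A \<noteq> {}" using AI[of "{}" 0] by auto
    have dir: "\<exists>c\<in>A. c \<le> a \<and> c \<le> b" if ab: "a \<in> A" "b \<in> A" for a b
    proof -
      obtain F n where a: "a = x - inf x (s F n)" "finite F" "F \<subseteq> M" using AE[OF ab(1)] by auto
      obtain G k where b: "b = x - inf x (s G k)" "finite G" "G \<subseteq> M" using AE[OF ab(2)] by auto
      have FG: "finite (F \<union> G)" "F \<union> G \<subseteq> M" using a b by auto
      have "x - inf x (s (F \<union> G) (max n k)) \<le> a" "x - inf x (s (F \<union> G) (max n k)) \<le> b"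
        unfolding a(1) b(1) using FG by (intro diff_left_mono inf_mono order_refl smono; simp)+
      then show ?thesis using AI[OF FG, of "max n k"] by blast
    qed
    have lb: "0 \<le> a" if a: "a \<in> A" for a
    proof -
      obtain F n where "a = x - inf x (s F n)" using AE[OF a] by auto
      then show ?thesis by (simp only: diff_ge_0_iff_ge inf_le1)
    qed
    have small: "l \<le> 0" if l: "\<And>a. a \<in> A \<Longrightarrow> l \<le> a" for l
    proof -
      \<comment> \<open>The elements of \<open>A\<close> are nonnegative, so the positive part of
        \<open>l\<close> is again a lower bound.\<close>
      define p where "p = sup l 0"
      have pA: "p \<le> a" if "a \<in> A" for a unfolding p_def using l[OF that] lb[OF that] by simp
      have p0: "0 \<le> p" by (simp add: p_def)
      have "inf x (s {} 0) = 0" using x0 by (simp add: s_def inf_absorb2)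
      then have px: "p \<le> x" using pA[OF AI[of "{}" 0]] by simp
      have pY: "p \<in> Y" by (rule closed_ideal_solid[OF Y _ xY]) (use p0 px x0 in simp)
      have "disjoint_elements p u" if u: "u \<in> M" for u
      proof -
        define m where "m = inf p u"
        have m: "m \<le> p" "m \<le> u" by (simp_all add: m_def)
        \<comment> \<open>In the induction \<open>inf x (s {u} n)\<close> absorbs n copies of
          \<open>m\<close>, and the remainder of \<open>x\<close>, an element of \<open>A\<close>,
          has room for one more.\<close>
        have "real n *\<^sub>R m \<le> x" for n
        proof (induction n)
          case 0 then show ?case using x0 by simp
        next
          case (Suc n)
          have "real n *\<^sub>R m \<le> s {u} n" unfolding s_def using m(2) by (simp add: scaleR_left_mono)
          with Suc have "real n *\<^sub>R m \<le> inf x (s {u} n)" by (rule le_infI)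
          moreover have "m \<le> x - inf x (s {u} n)"
            using order_trans[OF m(1) pA[OF AI[of "{u}" n]]] u by simp
          ultimately have "real n *\<^sub>R m + m \<le> inf x (s {u} n) + (x - inf x (s {u} n))" by (rule add_mono)
          moreover have "a + (x - a) = x" for a by simp
          ultimately have "real n *\<^sub>R m + m \<le> x" by (simp only:)
          moreover have "real (Suc n) *\<^sub>R m = real n *\<^sub>R m + m" by (simp add: scaleR_add_left add.commute)
          ultimately show ?case by (simp only:)
        qed
        then have "m \<le> 0" by (rule le_zero_of_scaleR_le)
        then show ?thesis using p0 M[OF u] by (simp add: disjoint_elements_iff m_def)
      qed
      then have "p = 0" by (rule max[OF pY p0])
      then show "l \<le> 0" unfolding p_def by (metis sup_ge1)
    qed
    have "x \<in> closure Z"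
      unfolding closure_approachable
    proof (intro allI impI)
      fix e :: real assume e: "0 < e"
      obtain a where a: "a \<in> A" "norm a < e"
        using order_continuousD[OF oc ne dir lb small e] by blast
      obtain F n where F: "a = x - inf x (s F n)" "finite F" "F \<subseteq> M" using AE[OF a(1)] by auto
      \<comment> \<open>Riesz decomposition distributes this infimum over the multiples of the
        \<open>u\<close> in \<open>F\<close>; each piece is a multiple of a point of
        \<open>{0..u}\<close>, so it lies in \<open>Z\<close>.\<close>
      have "0 \<le> inf x (s F n)" using x0 s0[OF F(3)] by simp
      moreover have "inf x (s F n) \<le> (\<Sum>u\<in>F. real n *\<^sub>R u)" by (simp add: s_def)
      moreover have "0 \<le> real n *\<^sub>R u" if "u \<in> F" for u
        using M[OF subsetD[OF F(3) that]] by (simp add: scaleR_nonneg_nonneg)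
      ultimately have "\<exists>w. inf x (s F n) = (\<Sum>u\<in>F. w u) \<and> (\<forall>u\<in>F. 0 \<le> w u \<and> w u \<le> real n *\<^sub>R u)"
        by (rule Riesz_decomposition_sum[OF F(2)])
      then obtain w where w: "inf x (s F n) = (\<Sum>u\<in>F. w u)" "\<forall>u\<in>F. 0 \<le> w u \<and> w u \<le> real n *\<^sub>R u"
        by (elim exE conjE)
      have "inf x (s F n) \<in> Z" unfolding w(1)
      proof (rule subspace_sum[OF Z(1)])
        fix u assume u: "u \<in> F"
        show "w u \<in> Z"
          by (rule scaleR_interval_subspace[OF Z(1) Z(3)]) (use u F(3) w(2) in auto)
      qed
      moreover have "dist (inf x (s F n)) x < e"
        using a(2) unfolding F(1) dist_norm by (simp only: norm_minus_commute)
      ultimately show "\<exists>y\<in>Z. dist y x < e" by blast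
    qed
    then show ?thesis using Z(2) by (simp only: closure_closed)
  qed
  show ?thesis
  proof
    fix y assume y: "y \<in> Y"
    have eq: "sup (- y) 0 = sup y 0 - y" using add_sup_distrib_right[of y 0 "- y"] by (simp add: sup_commute)
    have p: "sup y 0 \<in> Y" "sup (- y) 0 \<in> Y"
      using y subspace_0[OF closed_ideal_subspace[OF Y]] subspace_neg[OF closed_ideal_subspace[OF Y] y]
      by (auto intro: closed_ideal_sup[OF Y])
    have "sup y 0 - sup (- y) 0 \<in> Z"
      by (intro subspace_diff[OF Z(1)] nonneg p) simp_all
    then show "y \<in> Z" unfolding eq by simp
  qed
qed

text \<open>Compactness and generation are expressed in the whole space, the form in which
  \<open>L\<close> is joined to lifted generators of the quotient.\<close>

lemma weakly_compact_generating_ideal: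
  fixes Y :: "'a::banach_lattice set"
  assumes oc: "order_continuous (whole_lattice :: 'a nlattice)" and Y: "closed_ideal Y"
    and l1: "\<not> contains_isomorphic_copy (sub_lattice Y) l1_space"
  obtains L where "weakly_compact L" "\<And>Z. subspace Z \<Longrightarrow> closed Z \<Longrightarrow> L \<subseteq> Z \<Longrightarrow> Y \<subseteq> Z"
proof -
  obtain M where M: "M \<subseteq> {u \<in> Y. 0 \<le> u \<and> norm u \<le> 1}" "pairwise disjoint_elements M"
    "\<And>l. l \<in> Y \<Longrightarrow> 0 \<le> l \<Longrightarrow> (\<And>u. u \<in> M \<Longrightarrow> disjoint_elements l u) \<Longrightarrow> l = 0"
    using maximal_disjoint_family[OF Y] by blast
  show ?thesis
  proof (rule that[OF l1_free_weakly_compact_union[OF oc Y l1 M(1,2)]])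
    fix Z :: "'a set" assume Z: "subspace Z" "closed Z" "insert 0 (\<Union>u\<in>M. {0..u}) \<subseteq> Z"
    show "Y \<subseteq> Z"
    proof (rule disjoint_family_dense[OF oc Y _ _ Z(1,2)])
      show "0 \<le> u" if "u \<in> M" for u using subsetD[OF M(1) that] by simp
      show "{0..u} \<subseteq> Z" if "u \<in> M" for u using Z(3) that by auto
      show "l = 0" if "l \<in> Y" "0 \<le> l" "\<And>u. u \<in> M \<Longrightarrow> disjoint_elements l u" for l
        using that by (rule M(3))
    qed
  qed
qed

section \<open>Quotients by closed ideals\<close>

lemma quotient_carrier: "ns_carrier (quotient_lattice Y) = range (coset Y)"
  and quotient_zero: "ns_zero (quotient_lattice Y) = Y"
  by (simp_all add: quotient_lattice_def)

lemma ns_subspace_whole_lattice: "ns_subspace whole_lattice S \<longleftrightarrow> subspace S"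
  by (simp add: ns_subspace_def subspace_def)

lemma closed_sublattice_whole_lattice:
  "closed_sublattice whole_lattice S \<longleftrightarrow>
     subspace S \<and> closed S \<and> (\<forall>x\<in>S. \<forall>y\<in>S. sup x y \<in> S \<and> inf x y \<in> S)"
  by (simp add: closed_sublattice_def ns_subspace_whole_lattice ns_topology_whole_lattice
      nl_join_whole_lattice nl_meet_whole_lattice)

lemma LWCG_whole_lattice_iff:
  "LWCG (whole_lattice :: 'a::banach_lattice nlattice) \<longleftrightarrow>
     (\<exists>K :: 'a set. weakly_compact K \<and>
       (\<forall>S. closed_sublattice whole_lattice S \<longrightarrow> K \<subseteq> S \<longrightarrow> S = UNIV))"
  unfolding LWCG_def hull_def by auto

lemma WCG_whole_lattice_iff:
  "WCG (whole_lattice :: 'a::banach_lattice nlattice) \<longleftrightarrow>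
     (\<exists>K :: 'a set. weakly_compact K \<and> closure (span K) = UNIV)"
proof -
  have "ns_subspace (whole_lattice :: 'a nlattice) = subspace"
    by (simp add: fun_eq_iff ns_subspace_whole_lattice)
  then show ?thesis unfolding WCG_def by (simp add: ns_topology_whole_lattice span_def)
qed

context
  fixes Y :: "'a::banach_lattice set"
  assumes Y: "closed_ideal Y"
begin

lemma coset_mem: "coset Y x \<in> ns_carrier (quotient_lattice Y)"
  by (simp add: quotient_carrier)

lemma coset_zero: "coset Y 0 = Y"
  by (simp add: coset_def)

lemma self_mem_coset: "x \<in> coset Y x"
  using mem_coset[OF Y] subspace_0[OF closed_ideal_subspace[OF Y]] by simp

lemma infdist_ideal_le: "infdist x Y \<le> norm x"
  using infdist_le[OF subspace_0[OF closed_ideal_subspace[OF Y]], of x] by (simp add: dist_norm)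

lemma quotient_dist: "ns_dist (quotient_lattice Y) (coset Y x) (coset Y z) = infdist (x - z) Y"
  by (simp add: ns_dist_def quotient_scale[OF Y] quotient_add[OF Y] quotient_norm[OF Y])

text \<open>The coset map is a contraction, and if \<open>infdist (z - x) Y < e\<close> then
  subtracting a suitable y in \<open>Y\<close> from \<open>z\<close> brings it within
  \<open>e\<close> of \<open>x\<close> inside the same coset.\<close>

lemma closedin_quotient_iff:
  assumes "S \<subseteq> range (coset Y)"
  shows "closedin (ns_topology (quotient_lattice Y)) S \<longleftrightarrow> closed {x. coset Y x \<in> S}"
proof
  assume "closedin (ns_topology (quotient_lattice Y)) S"
  then have op: "openin (ns_topology (quotient_lattice Y)) (range (coset Y) - S)"
    by (simp add: closedin_def quotient_carrier)
  have "open {x. coset Y x \<notin> S}"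
    unfolding open_dist
  proof
    fix x assume "x \<in> {x. coset Y x \<notin> S}"
    then have "coset Y x \<in> range (coset Y) - S" by simp
    with op have "\<exists>e>0. \<forall>B\<in>range (coset Y). ns_dist (quotient_lattice Y) B (coset Y x) < e \<longrightarrow>
        B \<in> range (coset Y) - S"
      unfolding openin_ns_topology quotient_carrier by (elim conjE) (rule bspec)
    then obtain e where e: "0 < e" "\<And>z. ns_dist (quotient_lattice Y) (coset Y z) (coset Y x) < e \<Longrightarrow> coset Y z \<notin> S"
      by auto
    have "coset Y z \<notin> S" if "dist z x < e" for z
      using e(2)[of z] that infdist_ideal_le[of "z - x"] by (simp add: quotient_dist dist_norm)
    then show "\<exists>e>0. \<forall>z. dist z x < e \<longrightarrow> z \<in> {x. coset Y x \<notin> S}" using e(1) by auto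
  qed
  then show "closed {x. coset Y x \<in> S}" by (simp add: closed_def Collect_neg_eq)
next
  assume cl: "closed {x. coset Y x \<in> S}"
  have "openin (ns_topology (quotient_lattice Y)) (range (coset Y) - S)"
    unfolding openin_ns_topology quotient_carrier
  proof (intro conjI ballI)
    fix A assume "A \<in> range (coset Y) - S"
    then obtain x where x: "A = coset Y x" "coset Y x \<notin> S" by blast
    have "open {x. coset Y x \<notin> S}" using cl by (simp add: closed_def Collect_neg_eq)
    then obtain e where e: "0 < e" "\<And>z. dist z x < e \<Longrightarrow> coset Y z \<notin> S"
      using x(2) unfolding open_dist by auto
    have "coset Y z \<notin> S" if "infdist (z - x) Y < e" for z
    proof -
      have ne: "Y \<noteq> {}" using subspace_0[OF closed_ideal_subspace[OF Y]] by blast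
      then have "e \<le> infdist (z - x) Y" if "\<And>y. y \<in> Y \<Longrightarrow> e \<le> dist (z - x) y"
        using that by (simp add: infdist_def cINF_greatest)
      with that obtain y where y: "y \<in> Y" "dist (z - x) y < e" by (meson linorder_not_le)
      then have "coset Y (z - y) \<notin> S" by (intro e(2)) (simp add: dist_norm algebra_simps)
      moreover have "coset Y (z - y) = coset Y z"
        using y(1) subspace_neg[OF closed_ideal_subspace[OF Y]] by (simp add: coset_eq_iff[OF Y])
      ultimately show ?thesis by simp
    qed
    then show "\<exists>e>0. \<forall>B\<in>range (coset Y). ns_dist (quotient_lattice Y) B A < e \<longrightarrow> B \<in> range (coset Y) - S"
      using e(1) x(1) by (intro exI[of _ e]) (auto simp: quotient_dist)
  qed blast
  then show "closedin (ns_topology (quotient_lattice Y)) S"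
    using assms by (simp add: closedin_def quotient_carrier)
qed

text \<open>Quantifiers over cosets become quantifiers over representatives, which turns closure
  conditions on \<open>S\<close> into closure conditions on its preimage.\<close>

lemma ball_coset_iff:
  assumes "S \<subseteq> range (coset Y)"
  shows "(\<forall>A\<in>S. P A) \<longleftrightarrow> (\<forall>x. coset Y x \<in> S \<longrightarrow> P (coset Y x))"
proof (intro iffI ballI allI impI)
  fix A assume *: "\<forall>x. coset Y x \<in> S \<longrightarrow> P (coset Y x)" and A: "A \<in> S"
  obtain x where "A = coset Y x" using subsetD[OF assms A] by (rule rangeE)
  then show "P A" using * A by simp
qed auto

lemma ns_subspace_quotient_iff:
  assumes "S \<subseteq> range (coset Y)"
  shows "ns_subspace (quotient_lattice Y) S \<longleftrightarrow> subspace {x. coset Y x \<in> S}"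
proof -
  show ?thesis
    using assms unfolding ns_subspace_def subspace_def ball_coset_iff[OF assms] quotient_add[OF Y] quotient_scale[OF Y]
    by (auto simp: quotient_carrier quotient_zero coset_zero)
qed

lemma closed_sublattice_quotient_iff:
  assumes "S \<subseteq> range (coset Y)"
  shows "closed_sublattice (quotient_lattice Y) S \<longleftrightarrow>
    closed_sublattice whole_lattice {x. coset Y x \<in> S}"
proof -
  show ?thesis
    using ns_subspace_quotient_iff[OF assms] closedin_quotient_iff[OF assms]
    unfolding closed_sublattice_whole_lattice closed_sublattice_def[of "quotient_lattice Y"]
      ball_coset_iff[OF assms] quotient_join[OF Y] quotient_meet[OF Y] by simp
qed

lemma ideal_hull_preimage:
  assumes Z: "subspace Z" "Y \<subseteq> Z"
  shows "{x. coset Y x \<in> coset Y ` Z} = Z"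
proof
  show "{x. coset Y x \<in> coset Y ` Z} \<subseteq> Z"
  proof
    fix x assume "x \<in> {x. coset Y x \<in> coset Y ` Z}"
    then obtain z where z: "z \<in> Z" "x - z \<in> Y" using coset_eq_iff[OF Y] by auto
    then have "z + (x - z) \<in> Z" using Z by (intro subspace_add[OF Z(1)]) auto
    then show "x \<in> Z" by simp
  qed
qed auto

text \<open>The annihilator of \<open>Y\<close> is the dual of the quotient. Since
  \<open>h x = h (x - y)\<close> for all y in \<open>Y\<close>, the norm of \<open>x\<close> in the
  bound can be replaced by its distance from \<open>Y\<close>.\<close>

lemma mem_dual_quotient:
  assumes "bounded_linear h" "\<And>y. y \<in> Y \<Longrightarrow> h y = (0::real)"
  obtains g where "g \<in> dual_carrier (quotient_lattice Y)" "\<And>x. g (coset Y x) = h x"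
proof -
  note lin = bounded_linear.linear[OF assms(1)]
  define g where "g A = (if A \<in> range (coset Y) then h (SOME x. coset Y x = A) else undefined)" for A
  have g: "g (coset Y x) = h x" for x
  proof -
    let ?x = "SOME z. coset Y z = coset Y x"
    have "coset Y ?x = coset Y x" by (rule someI[of _ x]) simp
    then have "?x - x \<in> Y" by (simp add: coset_eq_iff[OF Y])
    then have "h ?x = h x" using assms(2) linear_diff[OF lin, of ?x x] by simp
    then show ?thesis by (simp add: g_def)
  qed
  have "\<bar>h x\<bar> \<le> onorm h * infdist x Y" for x
  proof (cases "onorm h = 0")
    case True
    then show ?thesis using onorm[OF assms(1), of x] by simp
  next
    case False
    then have pos: "0 < onorm h" using onorm_pos_le[OF assms(1)] by simp
    have ne: "Y \<noteq> {}" using subspace_0[OF closed_ideal_subspace[OF Y]] by blast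
    have "\<bar>h x\<bar> / onorm h \<le> dist x y" if y: "y \<in> Y" for y
    proof -
      have "h x = h (x - y)" using assms(2)[OF y] linear_diff[OF lin, of x y] by simp
      then have "\<bar>h x\<bar> \<le> onorm h * dist x y" using onorm[OF assms(1), of "x - y"] by (simp add: dist_norm)
      then show ?thesis using pos by (simp add: field_simps)
    qed
    then have "\<bar>h x\<bar> / onorm h \<le> infdist x Y" using ne unfolding infdist_def by (simp add: cINF_greatest)
    then show ?thesis using pos by (simp add: field_simps)
  qed
  then have "g \<in> dual_carrier (quotient_lattice Y)"
    using linear_add[OF lin] linear_scale[OF lin]
    by (auto simp: mem_dual_carrier quotient_carrier quotient_add[OF Y] quotient_scale[OF Y]
        quotient_norm[OF Y] g extensional_def) (auto simp: g_def)
  then show ?thesis using g that by blast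
qed

lemma bounded_linear_dual_quotient:
  assumes "g \<in> dual_carrier (quotient_lattice Y)"
  shows "bounded_linear (\<lambda>x. g (coset Y x))" "y \<in> Y \<Longrightarrow> g (coset Y y) = 0"
proof -
  have add: "g (coset Y (x + z)) = g (coset Y x) + g (coset Y z)" for x z
    using assms coset_mem quotient_add[OF Y, of x z] unfolding mem_dual_carrier by metis
  have scale: "g (coset Y (r *\<^sub>R x)) = r * g (coset Y x)" for r x
    using assms coset_mem quotient_scale[OF Y, of r x] unfolding mem_dual_carrier by metis
  obtain C where C: "\<And>x. \<bar>g (coset Y x)\<bar> \<le> C * infdist x Y"
    using assms coset_mem quotient_norm[OF Y] unfolding mem_dual_carrier by metis
  have "\<bar>g (coset Y x)\<bar> \<le> norm x * \<bar>C\<bar>" for x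
  proof -
    have "\<bar>g (coset Y x)\<bar> \<le> \<bar>C\<bar> * infdist x Y"
      using C[of x] mult_right_mono[OF abs_ge_self[of C] infdist_nonneg[of x Y]] by linarith
    also have "\<dots> \<le> \<bar>C\<bar> * norm x" by (intro mult_left_mono infdist_ideal_le) simp
    finally show ?thesis by (simp add: mult.commute)
  qed
  then show "bounded_linear (\<lambda>x. g (coset Y x))"
    by (intro bounded_linear_intro[where K = "\<bar>C\<bar>"]) (simp_all add: add scale)
  assume "y \<in> Y"
  then have "coset Y y = coset Y 0" by (simp add: coset_eq_iff[OF Y])
  then show "g (coset Y y) = 0" using scale[of 0 0] by simp
qed

lemma dual_quotient_nonempty: "dual_carrier (quotient_lattice Y) \<noteq> {}"
  using mem_dual_quotient[OF bounded_linear_zero] by blast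

lemma LWCG_quotient:
  assumes "LWCG (whole_lattice :: 'a nlattice)"
  shows "LWCG (quotient_lattice Y)"
proof -
  obtain K :: "'a set" where K: "weakly_compact K"
      "\<And>S. closed_sublattice whole_lattice S \<Longrightarrow> K \<subseteq> S \<Longrightarrow> S = UNIV"
    using assms unfolding LWCG_whole_lattice_iff by blast
  \<comment> \<open>A functional on the quotient composed with the coset map is bounded on the whole
    space, hence weakly continuous.\<close>
  have "continuous_map (weak_topology (whole_lattice :: 'a nlattice)) (weak_topology (quotient_lattice Y)) (coset Y)"
  proof (rule continuous_map_into_weak[OF _ dual_quotient_nonempty])
    fix g assume "g \<in> dual_carrier (quotient_lattice Y)"
    then show "continuous_map (weak_topology (whole_lattice :: 'a nlattice)) euclideanreal (\<lambda>x. g (coset Y x))"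
      by (intro continuous_map_weak_functional) (simp add: mem_dual_whole_lattice bounded_linear_dual_quotient)
  qed (simp add: coset_mem)
  then have cpt: "compactin (weak_topology (quotient_lattice Y)) (coset Y ` K)"
    by (rule image_compactin[OF K(1)])
  have "S = range (coset Y)" if S: "closed_sublattice (quotient_lattice Y) S" "coset Y ` K \<subseteq> S" for S
  proof -
    have sub: "S \<subseteq> range (coset Y)"
      using S(1) by (simp add: closed_sublattice_def ns_subspace_def quotient_carrier)
    have "{x. coset Y x \<in> S} = UNIV"
      by (rule K(2)) (use S closed_sublattice_quotient_iff[OF sub] in auto)
    with sub show ?thesis by auto
  qed
  \<comment> \<open>The hull is an intersection, so the whole carrier has to be among the sets
    intersected.\<close>
  moreover have "closed_sublattice (quotient_lattice Y) (range (coset Y))"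
    by (simp add: closed_sublattice_quotient_iff closed_sublattice_whole_lattice)
  ultimately have "closed_sublattice (quotient_lattice Y) hull (coset Y ` K) = ns_carrier (quotient_lattice Y)"
    unfolding quotient_carrier
  proof (intro equalityI)
    assume "closed_sublattice (quotient_lattice Y) (range (coset Y))"
    then show "closed_sublattice (quotient_lattice Y) hull (coset Y ` K) \<subseteq> range (coset Y)"
      by (intro hull_minimal image_mono) simp_all
  next
    assume *: "\<And>S. closed_sublattice (quotient_lattice Y) S \<Longrightarrow> coset Y ` K \<subseteq> S \<Longrightarrow> S = range (coset Y)"
    show "range (coset Y) \<subseteq> closed_sublattice (quotient_lattice Y) hull (coset Y ` K)"
      unfolding hull_def by (rule Inter_greatest) (elim CollectE conjE, rule equalityD2, rule *)
  qed
  with cpt show ?thesis unfolding LWCG_def by blast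
qed

end

section \<open>Limit functionals and reflexive ideals\<close>

lemma approximable_linear:
  fixes K :: "'a::banach_lattice set"
  assumes \<phi>: "approximable functionals K \<phi>" and f: "bounded_linear f" and g: "bounded_linear g"
  shows "\<phi> (\<lambda>x. f x + g x) = \<phi> f + \<phi> g" "\<phi> (\<lambda>x. r * f x) = r * \<phi> f"
proof -
  let ?s = "\<lambda>x. f x + g x" and ?m = "\<lambda>x. r * f x"
  have lin: "{f, g, ?s, ?m} \<subseteq> functionals"
    using f g by (auto intro: bounded_linear_add bounded_linear_const_mult)
  have "\<bar>\<phi> ?s - (\<phi> f + \<phi> g)\<bar> \<le> 0 + e \<and> \<bar>\<phi> ?m - r * \<phi> f\<bar> \<le> 0 + e" if e: "0 < e" for e
  proof -
    \<comment> \<open>One approximant tests all four functionals. Additivity collects three errors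
      and homogeneity 1 + |r| of them, so \<open>3 + \<bar>r\<bar>\<close> covers both.\<close>
    let ?d = "e / (3 + \<bar>r\<bar>)"
    have d: "0 < ?d" using e by simp
    obtain x where x: "\<And>h. h \<in> {f, g, ?s, ?m} \<Longrightarrow> \<bar>h x - \<phi> h\<bar> < ?d"
      using approximableD[OF \<phi> _ lin d] by auto
    have b: "\<bar>f x - \<phi> f\<bar> < ?d" "\<bar>g x - \<phi> g\<bar> < ?d" "\<bar>f x + g x - \<phi> ?s\<bar> < ?d" "\<bar>r * f x - \<phi> ?m\<bar> < ?d"
      using x[of f] x[of g] x[of ?s] x[of ?m] by simp_all
    have "\<bar>r * f x - r * \<phi> f\<bar> \<le> \<bar>r\<bar> * ?d"
      using mult_left_mono[OF less_imp_le[OF b(1)], of "\<bar>r\<bar>"] by (simp add: abs_mult flip: right_diff_distrib)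
    moreover have "3 * ?d + \<bar>r\<bar> * ?d = e"
      using abs_ge_zero[of r] by (simp only: distrib_right[symmetric]) simp
    moreover have "0 \<le> \<bar>r\<bar> * ?d" by (rule mult_nonneg_nonneg[OF abs_ge_zero less_imp_le[OF d]])
    ultimately show ?thesis using b d by linarith
  qed
  then have "\<bar>\<phi> ?s - (\<phi> f + \<phi> g)\<bar> \<le> 0" "\<bar>\<phi> ?m - r * \<phi> f\<bar> \<le> 0"
    by (meson field_le_epsilon)+
  then show "\<phi> ?s = \<phi> f + \<phi> g" "\<phi> ?m = r * \<phi> f" by simp_all
qed

lemma approximable_bound:
  fixes K :: "'a::banach_lattice set"
  assumes \<phi>: "approximable functionals K \<phi>" and f: "bounded_linear f"
    and b: "\<And>x. x \<in> K \<Longrightarrow> \<bar>f x\<bar> \<le> b"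
  shows "\<bar>\<phi> f\<bar> \<le> b"
proof (rule field_le_epsilon)
  fix e :: real assume "0 < e"
  then obtain x where "x \<in> K" "\<bar>f x - \<phi> f\<bar> < e"
    using approximableD[OF \<phi>, of "{f}" e] f by auto
  then show "\<bar>\<phi> f\<bar> \<le> b + e" using b[of x] by linarith
qed

lemma dual_sub_lattice_bound:
  fixes Y :: "'a::banach_lattice set"
  assumes Y: "subspace Y" and k: "k \<in> dual_carrier (sub_lattice Y)"
  shows "0 \<le> ns_norm (ns_dual (sub_lattice Y)) k"
    and "y \<in> Y \<Longrightarrow> \<bar>k y\<bar> \<le> ns_norm (ns_dual (sub_lattice Y)) k * norm y"
proof -
  let ?S = "{\<bar>k x\<bar> | x. x \<in> Y \<and> norm x \<le> 1}"
  have n: "ns_norm (ns_dual (sub_lattice Y)) k = Sup ?S" by (simp add: ns_dual_def)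
  have scale: "k (r *\<^sub>R y) = r * k y" if "y \<in> Y" for r y
    using k that by (simp add: mem_dual_carrier)
  have "\<exists>C. \<forall>x\<in>Y. \<bar>k x\<bar> \<le> C * norm x" using k by (simp add: mem_dual_carrier)
  then obtain C where C: "\<And>x. x \<in> Y \<Longrightarrow> \<bar>k x\<bar> \<le> C * norm x" by auto
  have bdd: "bdd_above ?S"
  proof (rule bdd_aboveI)
    fix s assume "s \<in> ?S"
    then obtain x where x: "s = \<bar>k x\<bar>" "x \<in> Y" "norm x \<le> 1" by blast
    \<comment> \<open>\<open>C\<close> may be negative if \<open>Y\<close> is trivial, hence the
      modulus.\<close>
    have "C * norm x \<le> \<bar>C\<bar> * norm x" by (intro mult_right_mono) auto
    also have "\<dots> \<le> \<bar>C\<bar> * 1" using x(3) by (intro mult_left_mono) auto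
    finally show "s \<le> \<bar>C\<bar>" using C[OF x(2)] x(1) by simp
  qed
  have up: "\<bar>k x\<bar> \<le> Sup ?S" if "x \<in> Y" "norm x \<le> 1" for x
    using that by (intro cSup_upper[OF _ bdd]) blast
  show "0 \<le> ns_norm (ns_dual (sub_lattice Y)) k"
    unfolding n by (rule order_trans[OF abs_ge_zero up[OF subspace_0[OF Y]]]) simp
  show "\<bar>k y\<bar> \<le> ns_norm (ns_dual (sub_lattice Y)) k * norm y" if y: "y \<in> Y"
  proof (cases "y = 0")
    case True
    then show ?thesis using C[OF y] by simp
  next
    case False
    let ?z = "inverse (norm y) *\<^sub>R y"
    have "?z \<in> Y" by (rule subspace_scale[OF Y y])
    moreover have "norm ?z \<le> 1" using False by simp
    ultimately have "\<bar>k ?z\<bar> \<le> Sup ?S" by (rule up)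
    then show ?thesis unfolding n scale[OF y] using False by (simp add: abs_mult field_simps)
  qed
qed

text \<open>The extension keeps the dual norm, which makes functionals on the dual of
  \<open>Y\<close> built from extensions bounded.\<close>

lemma Hahn_Banach_sub_lattice:
  fixes Y :: "'a::banach_lattice set"
  assumes Y: "subspace Y" and k: "k \<in> dual_carrier (sub_lattice Y)"
  obtains g where "bounded_linear g" "\<And>x. \<bar>g x\<bar> \<le> ns_norm (ns_dual (sub_lattice Y)) k * norm x"
    "\<And>y. y \<in> Y \<Longrightarrow> g y = k y"
proof -
  let ?c = "ns_norm (ns_dual (sub_lattice Y)) k"
  note bd = dual_sub_lattice_bound[OF Y k]
  have "\<exists>g. linear g \<and> (\<forall>x. g x \<le> ?c * norm x) \<and> (\<forall>y\<in>Y. g y = k y)"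
  proof (rule Hahn_Banach_subspace[OF sublinear_norm[OF bd(1)] Y, of k])
    show "k (x + y) = k x + k y" if "x \<in> Y" "y \<in> Y" for x y
      using k that by (simp add: mem_dual_carrier)
    show "k (r *\<^sub>R x) = r * k x" if "x \<in> Y" for r x
      using k that by (simp add: mem_dual_carrier)
    show "k x \<le> ?c * norm x" if "x \<in> Y" for x using bd(2)[OF that] by simp
  qed blast
  then obtain g where g: "linear g" "\<And>x. g x \<le> ?c * norm x" "\<And>y. y \<in> Y \<Longrightarrow> g y = k y" by auto
  show ?thesis by (rule that[OF bounded_linear_of_le_norm[OF g(1,2)] g(3)])
qed

lemma restrict_mem_dual_sub_lattice:
  fixes Y :: "'a::banach_lattice set"
  assumes Y: "subspace Y" and f: "bounded_linear f"
  shows "restrict f Y \<in> dual_carrier (sub_lattice Y)"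
proof -
  have "\<exists>C. \<forall>x\<in>Y. \<bar>f x\<bar> \<le> C * norm x" using onorm[OF f] by auto
  then show ?thesis
    using linear_add[OF bounded_linear.linear[OF f]] linear_scale[OF bounded_linear.linear[OF f]]
      subspace_add[OF Y] subspace_scale[OF Y]
    by (auto simp: mem_dual_carrier)
qed

context
  fixes Y :: "'a::banach_lattice set"
  assumes Y: "closed_ideal Y"
begin

text \<open>Multiples with factors in \<open>[0, 1]\<close> are included so that every point of \<open>K\<close> has a multiple that
  lifts to the unit ball, without appeal to the uniform boundedness principle.\<close>

lemma compactin_scaled_quotient:
  assumes K: "compactin (weak_topology (quotient_lattice Y)) K"
  shows "compactin (weak_topology (quotient_lattice Y))
    (insert Y ((\<lambda>(t, A). ns_scale (quotient_lattice Y) t A) ` ({0..1} \<times> K)))"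
proof -
  let ?Q = "quotient_lattice Y" and ?W = "weak_topology (quotient_lattice Y)"
  note ne = dual_quotient_nonempty[OF Y]
  have top: "topspace ?W = range (coset Y)"
    by (simp add: topspace_weak_topology[OF ne] quotient_carrier)
  have "continuous_map (prod_topology euclideanreal ?W) ?W (\<lambda>(t, A). ns_scale ?Q t A)"
  proof (rule continuous_map_into_weak[OF _ ne])
    show "(\<lambda>(t, A). ns_scale ?Q t A) \<in> topspace (prod_topology euclideanreal ?W) \<rightarrow> ns_carrier ?Q"
      by (auto simp: top quotient_carrier quotient_scale[OF Y])
    fix g assume g: "g \<in> dual_carrier ?Q"
    have "continuous_map (prod_topology euclideanreal ?W) euclideanreal (\<lambda>p. fst p * g (snd p))"
      using continuous_map_compose[OF continuous_map_snd continuous_map_weak_functional[OF g]]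
      by (intro continuous_map_real_mult continuous_map_fst) (simp add: o_def)
    then show "continuous_map (prod_topology euclideanreal ?W) euclideanreal (\<lambda>p. g ((\<lambda>(t, A). ns_scale ?Q t A) p))"
    proof (rule continuous_map_eq)
      fix p assume "p \<in> topspace (prod_topology euclideanreal ?W)"
      then have "snd p \<in> ns_carrier ?Q" by (auto simp: top quotient_carrier)
      then show "fst p * g (snd p) = g ((\<lambda>(t, A). ns_scale ?Q t A) p)"
        using g by (simp add: mem_dual_carrier case_prod_beta)
    qed
  qed
  moreover have "compactin (prod_topology euclideanreal ?W) ({0..1} \<times> K)"
    using K by (simp add: compactin_Times)
  ultimately have "compactin ?W ((\<lambda>(t, A). ns_scale ?Q t A) ` ({0..1} \<times> K))"
    using image_compactin by blast
  moreover have "compactin ?W {Y}"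
    by (simp add: top) (metis coset_zero[OF Y] rangeI)
  ultimately show ?thesis using compactin_Un by (metis insert_is_Un)
qed

lemma weakly_compact_ball_preimage:
  assumes refl: "ns_reflexive (sub_lattice Y)"
    and K: "compactin (weak_topology (quotient_lattice Y)) K"
  shows "weakly_compact {x. norm x \<le> 1 \<and> coset Y x \<in> K}"
proof (rule weakly_compactI)
  let ?H = "{x. norm x \<le> 1 \<and> coset Y x \<in> K}"
  let ?Q = "quotient_lattice Y" and ?S = "sub_lattice Y"
  note sub = closed_ideal_subspace[OF Y]
  show "norm x \<le> 1" if "x \<in> ?H" for x using that by simp
  fix \<phi> :: "('a \<Rightarrow> real) \<Rightarrow> real" assume \<phi>: "approximable functionals ?H \<phi>"
  have bound: "\<bar>\<phi> f\<bar> \<le> c" if f: "bounded_linear f" and c: "\<And>x. \<bar>f x\<bar> \<le> c * norm x" "0 \<le> c" for f c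
  proof (rule approximable_bound[OF \<phi> f])
    fix x assume "x \<in> ?H"
    then have "c * norm x \<le> c * 1" using c(2) by (intro mult_left_mono) auto
    then show "\<bar>f x\<bar> \<le> c" using c(1)[of x] by simp
  qed
  \<comment> \<open>Through the coset map \<phi> induces a functional in the weak* closure of
    \<open>K\<close>; compactness of \<open>K\<close> turns it into a coset, whose representative
    \<open>x\<close> agrees with \<phi> on the annihilator of \<open>Y\<close>.\<close>
  have "approximable (dual_carrier ?Q) K (\<lambda>g. \<phi> (\<lambda>x. g (coset Y x)))"
    unfolding approximable_def
  proof (intro allI impI)
    fix F and e :: real assume F: "finite F" "F \<subseteq> dual_carrier ?Q" "0 < e"
    let ?F = "(\<lambda>g x. g (coset Y x)) ` F"
    have F': "?F \<subseteq> functionals" using F(2) bounded_linear_dual_quotient(1)[OF Y] by auto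
    obtain x where x: "x \<in> ?H" "\<And>f. f \<in> ?F \<Longrightarrow> \<bar>f x - \<phi> f\<bar> < e"
      using approximableD[OF \<phi> finite_imageI[OF F(1)] F' F(3)] by auto
    then show "\<exists>A\<in>K. \<forall>g\<in>F. \<bar>g A - \<phi> (\<lambda>x. g (coset Y x))\<bar> < e"
      by (intro bexI[of _ "coset Y x"]) auto
  qed
  from compactin_weakD[OF K dual_quotient_nonempty[OF Y] this]
  obtain A where A: "A \<in> K" "\<And>g. g \<in> dual_carrier ?Q \<Longrightarrow> \<phi> (\<lambda>x. g (coset Y x)) = g A" by auto
  have "K \<subseteq> range (coset Y)"
    using compactin_subset_topspace[OF K] by (simp add: topspace_weak_topology[OF dual_quotient_nonempty[OF Y]] quotient_carrier)
  with A(1) obtain x where x: "A = coset Y x" by auto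
  have \<phi>h: "\<phi> h = h x" if h: "bounded_linear h" "\<And>y. y \<in> Y \<Longrightarrow> h y = 0" for h
  proof -
    obtain g where g: "g \<in> dual_carrier ?Q" "\<And>x. g (coset Y x) = h x" using mem_dual_quotient[OF Y h] by auto
    then show ?thesis using A(2)[OF g(1)] by (simp add: x)
  qed
  define psi where "psi f = \<phi> f - f x" for f
  have psi_add: "psi (\<lambda>x. f x + g x) = psi f + psi g" if "bounded_linear f" "bounded_linear g" for f g
    using approximable_linear(1)[OF \<phi> that] by (simp add: psi_def)
  have psi_scale: "psi (\<lambda>x. r * f x) = r * psi f" if "bounded_linear f" for f r
    using approximable_linear(2)[OF \<phi> that that, of r] by (simp add: psi_def right_diff_distrib)
  \<comment> \<open>The difference of \<open>f\<close> and \<open>g\<close> annihilates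
    \<open>Y\<close>, where \<phi> is evaluation at \<open>x\<close>. Hence \<open>psi\<close>
    depends only on restrictions to \<open>Y\<close>.\<close>
  have psi_cong: "psi f = psi g" if fg: "bounded_linear f" "bounded_linear g" "\<And>y. y \<in> Y \<Longrightarrow> f y = g y" for f g
  proof -
    have h: "bounded_linear (\<lambda>x. f x + -1 * g x)"
      using fg by (intro bounded_linear_add bounded_linear_const_mult)
    have "psi (\<lambda>x. f x + -1 * g x) = 0" using \<phi>h[OF h] fg(3) by (simp add: psi_def)
    moreover have "psi (\<lambda>x. f x + -1 * g x) = psi f + -1 * psi g"
      using psi_add[OF fg(1) bounded_linear_const_mult[OF fg(2)], of "-1"] psi_scale[OF fg(2), of "-1"] by simp
    ultimately show ?thesis by simp
  qed
  have "\<exists>g. bounded_linear g \<and> (\<forall>x. \<bar>g x\<bar> \<le> ns_norm (ns_dual ?S) k * norm x) \<and> (\<forall>y\<in>Y. g y = k y)"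
    if "k \<in> dual_carrier ?S" for k
    using Hahn_Banach_sub_lattice[OF sub that] by metis
  then obtain ext where ext: "\<And>k. k \<in> dual_carrier ?S \<Longrightarrow> bounded_linear (ext k)"
      "\<And>k x. k \<in> dual_carrier ?S \<Longrightarrow> \<bar>ext k x\<bar> \<le> ns_norm (ns_dual ?S) k * norm x"
      "\<And>k y. k \<in> dual_carrier ?S \<Longrightarrow> y \<in> Y \<Longrightarrow> ext k y = k y" by metis
  \<comment> \<open>The choice \<open>ext\<close> need not be linear; \<open>Phi\<close> is, because
    by \<open>psi_cong\<close> its values do not depend on the extension chosen.\<close>
  define Phi where "Phi = (\<lambda>k\<in>dual_carrier ?S. psi (ext k))"
  have dadd: "ns_add (ns_dual ?S) k l = (\<lambda>y\<in>Y. k y + l y)" and dscale: "ns_scale (ns_dual ?S) r k = (\<lambda>y\<in>Y. r * k y)" for k l r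
    by (simp_all add: ns_dual_def)
  have dadd_mem: "(\<lambda>y\<in>Y. k y + l y) \<in> dual_carrier ?S" if "k \<in> dual_carrier ?S" "l \<in> dual_carrier ?S" for k l
  proof -
    have "(\<lambda>y\<in>Y. k y + l y) = restrict (\<lambda>x. ext k x + ext l x) Y"
      using ext(3)[OF that(1)] ext(3)[OF that(2)] by (auto simp: restrict_def)
    then show ?thesis
      using restrict_mem_dual_sub_lattice[OF sub bounded_linear_add[OF ext(1)[OF that(1)] ext(1)[OF that(2)]]] by simp
  qed
  have dscale_mem: "(\<lambda>y\<in>Y. r * k y) \<in> dual_carrier ?S" if "k \<in> dual_carrier ?S" for k r
  proof -
    have "(\<lambda>y\<in>Y. r * k y) = restrict (\<lambda>x. r * ext k x) Y"
      using ext(3)[OF that] by (auto simp: restrict_def)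
    then show ?thesis
      using restrict_mem_dual_sub_lattice[OF sub bounded_linear_const_mult[OF ext(1)[OF that]], of r] by simp
  qed
  have "Phi \<in> dual_carrier (ns_dual ?S)"
    unfolding mem_dual_carrier[of Phi]
  proof (intro conjI ballI allI)
    show "Phi \<in> extensional (dual_carrier ?S)" by (simp add: Phi_def)
    fix k l assume k: "k \<in> dual_carrier ?S" and l: "l \<in> dual_carrier ?S"
    have "psi (ext (\<lambda>y\<in>Y. k y + l y)) = psi (\<lambda>x. ext k x + ext l x)"
      by (rule psi_cong[OF ext(1)[OF dadd_mem[OF k l]] bounded_linear_add[OF ext(1)[OF k] ext(1)[OF l]]])
        (simp add: ext(3) dadd_mem k l)
    also have "\<dots> = psi (ext k) + psi (ext l)" by (rule psi_add[OF ext(1)[OF k] ext(1)[OF l]])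
    finally show "Phi (ns_add (ns_dual ?S) k l) = Phi k + Phi l"
      using dadd_mem[OF k l] k l by (simp add: Phi_def dadd)
  next
    fix r k assume k: "k \<in> dual_carrier ?S"
    have "psi (ext (\<lambda>y\<in>Y. r * k y)) = psi (\<lambda>x. r * ext k x)"
      by (rule psi_cong[OF ext(1)[OF dscale_mem[OF k]] bounded_linear_const_mult[OF ext(1)[OF k]]])
        (simp add: ext(3) dscale_mem k)
    also have "\<dots> = r * psi (ext k)" by (rule psi_scale[OF ext(1)[OF k]])
    finally show "Phi (ns_scale (ns_dual ?S) r k) = r * Phi k"
      using dscale_mem[OF k] k by (simp add: Phi_def dscale)
  next
    show "\<exists>C. \<forall>k\<in>dual_carrier ?S. \<bar>Phi k\<bar> \<le> C * ns_norm (ns_dual ?S) k"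
    proof (intro exI[of _ "1 + norm x"] ballI)
      fix k assume k: "k \<in> dual_carrier ?S"
      \<comment> \<open>Here the unit ball enters: \<phi> is a limit of evaluations at points of
        norm at most 1. The term \<open>norm x\<close> in the constant comes from evaluation at
        \<open>x\<close>.\<close>
      have "\<bar>\<phi> (ext k)\<bar> \<le> ns_norm (ns_dual ?S) k"
        by (rule bound[OF ext(1,2)[OF k] dual_sub_lattice_bound(1)[OF sub k]])
      then show "\<bar>Phi k\<bar> \<le> (1 + norm x) * ns_norm (ns_dual ?S) k"
        using ext(2)[OF k, of x] k by (simp add: Phi_def psi_def algebra_simps)
    qed
  qed
  then obtain y where y: "y \<in> Y" "\<And>k. k \<in> dual_carrier ?S \<Longrightarrow> Phi k = k y"
    using refl unfolding ns_reflexive_def sub_lattice_sel by auto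
  have \<phi>xy: "\<phi> f = f (x + y)" if f: "bounded_linear f" for f
  proof -
    have k: "restrict f Y \<in> dual_carrier ?S" by (rule restrict_mem_dual_sub_lattice[OF sub f])
    have "psi f = psi (ext (restrict f Y))"
      by (rule psi_cong[OF f ext(1)[OF k]]) (simp add: ext(3)[OF k])
    also have "\<dots> = f y" using y(2)[OF k] y(1) k by (simp add: Phi_def)
    finally show ?thesis using linear_add[OF bounded_linear.linear[OF f], of x y] by (simp add: psi_def)
  qed
  have "x + y \<in> ?H"
  proof -
    obtain f where f: "bounded_linear f" "\<And>z. \<bar>f z\<bar> \<le> norm z" "f (x + y) = norm (x + y)"
      using norming_functional by blast
    have "\<bar>\<phi> f\<bar> \<le> 1" by (rule bound[OF f(1)]) (use f(2) in simp_all)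
    then have "norm (x + y) \<le> 1" using \<phi>xy[OF f(1)] f(3) by simp
    moreover have "coset Y (x + y) = coset Y x" using y(1) by (simp add: coset_eq_iff[OF Y])
    ultimately show ?thesis using A(1) x by simp
  qed
  then show "\<exists>x\<in>?H. \<forall>f. bounded_linear f \<longrightarrow> \<phi> f = f x" using \<phi>xy by (intro bexI[of _ "x + y"]) auto
qed

end

section \<open>Lifting generating sets from the quotient\<close>

lemma subspace_closure:
  fixes S :: "'a::real_normed_vector set"
  assumes S: "subspace S"
  shows "subspace (closure S)"
  unfolding subspace_def
proof (intro conjI ballI allI)
  show "0 \<in> closure S" using subspace_0[OF S] closure_subset by auto
next
  fix x y assume "x \<in> closure S" "y \<in> closure S"
  then obtain a b where "\<forall>n. a n \<in> S" "a \<longlonglongrightarrow> x" "\<forall>n. b n \<in> S" "b \<longlonglongrightarrow> y"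
    unfolding closure_sequential by auto
  then show "x + y \<in> closure S"
    unfolding closure_sequential
    by (intro exI[of _ "\<lambda>n. a n + b n"] conjI allI subspace_add[OF S] tendsto_add) auto
next
  fix r :: real and x assume "x \<in> closure S"
  then obtain a where "\<forall>n. a n \<in> S" "a \<longlonglongrightarrow> x" unfolding closure_sequential by auto
  then show "r *\<^sub>R x \<in> closure S"
    unfolding closure_sequential
    by (intro exI[of _ "\<lambda>n. r *\<^sub>R a n"] conjI allI subspace_scale[OF S] tendsto_scaleR tendsto_const) auto
qed

context
  fixes Y :: "'a::banach_lattice set"
  assumes Y: "closed_ideal Y"
begin

text \<open>A closed sublattice containing \<open>H\<close> contains \<open>Y\<close>, so it is the
  full preimage of its image. That image is closed and contains \<open>K\<close>, hence is
  everything.\<close>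

lemma LWCG_of_reflexive_ideal:
  assumes refl: "ns_reflexive (sub_lattice Y)" and Q: "LWCG (quotient_lattice Y)"
  shows "LWCG (whole_lattice :: 'a nlattice)"
proof -
  note sub = closed_ideal_subspace[OF Y]
  obtain K where K: "compactin (weak_topology (quotient_lattice Y)) K"
      "closed_sublattice (quotient_lattice Y) hull K = range (coset Y)"
    using Q unfolding LWCG_def quotient_carrier by blast
  have KQ: "K \<subseteq> range (coset Y)"
    using compactin_subset_topspace[OF K(1)]
    by (simp add: topspace_weak_topology[OF dual_quotient_nonempty[OF Y]] quotient_carrier)
  \<comment> \<open>\<open>Y\<close> is the zero coset. Its presence puts the unit ball of
    \<open>Y\<close> into \<open>H\<close>, so that sublattices containing \<open>H\<close> contain
    \<open>Y\<close>.\<close>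
  define K1 where "K1 = insert Y ((\<lambda>(t, A). ns_scale (quotient_lattice Y) t A) ` ({0..1} \<times> K))"
  have K1: "coset Y (t *\<^sub>R x) \<in> K1" if "coset Y x \<in> K" "0 \<le> t" "t \<le> 1" for t x
  proof -
    have "coset Y (t *\<^sub>R x) = (\<lambda>(t, A). ns_scale (quotient_lattice Y) t A) (t, coset Y x)"
      by (simp add: quotient_scale[OF Y])
    then show ?thesis unfolding K1_def using that by (intro insertI2 image_eqI[of _ _ "(t, coset Y x)"]) simp_all
  qed
  define H where "H = {x. norm x \<le> 1 \<and> coset Y x \<in> K1}"
  have cpt: "weakly_compact H"
    unfolding H_def K1_def by (intro weakly_compact_ball_preimage[OF Y refl] compactin_scaled_quotient[OF Y K(1)])
  have "S = UNIV" if S: "closed_sublattice whole_lattice S" and HS: "H \<subseteq> S" for S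
  proof -
    have sS: "subspace S" using S by (simp add: closed_sublattice_whole_lattice)
    \<comment> \<open>The factor \<open>1 / (1 + norm x)\<close> moves any point, 0 included, into
      the unit ball and lies in [0, 1], as \<open>K1\<close> demands.\<close>
    have normalize: "x \<in> S" if "(1 / (1 + norm x)) *\<^sub>R x \<in> S" for x
    proof -
      have "(1 + norm x) *\<^sub>R ((1 / (1 + norm x)) *\<^sub>R x) \<in> S" by (rule subspace_scale[OF sS that])
      moreover have "1 + norm x \<noteq> 0" using norm_ge_zero[of x] by linarith
      ultimately show ?thesis by simp
    qed
    have small: "norm ((1 / (1 + norm x)) *\<^sub>R x) \<le> 1" for x :: 'a
    proof -
      have "norm ((1 / (1 + norm x)) *\<^sub>R x) = norm x / (1 + norm x)" using norm_ge_zero[of x] by simp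
      also have "\<dots> \<le> 1" using norm_ge_zero[of x] by (subst divide_le_eq_1) linarith
      finally show ?thesis .
    qed
    have YS: "Y \<subseteq> S"
    proof
      fix y assume y: "y \<in> Y"
      have "(1 / (1 + norm y)) *\<^sub>R y \<in> Y" by (rule subspace_scale[OF sub y])
      then have "coset Y ((1 / (1 + norm y)) *\<^sub>R y) = coset Y 0" by (simp add: coset_eq_iff[OF Y])
      then have "(1 / (1 + norm y)) *\<^sub>R y \<in> H" using small by (simp add: H_def K1_def coset_zero[OF Y])
      with HS have "(1 / (1 + norm y)) *\<^sub>R y \<in> S" by (rule subsetD)
      then show "y \<in> S" by (rule normalize)
    qed
    have pre: "{x. coset Y x \<in> coset Y ` S} = S" by (rule ideal_hull_preimage[OF Y sS YS])
    have "closed_sublattice (quotient_lattice Y) (coset Y ` S)"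
      using S closed_sublattice_quotient_iff[OF Y, of "coset Y ` S"] by (simp add: pre image_mono)
    moreover have "K \<subseteq> coset Y ` S"
    proof
      fix A assume A: "A \<in> K"
      obtain x where x: "A = coset Y x" using subsetD[OF KQ A] by (rule rangeE)
      have "1 / (1 + norm x) \<le> 1" using norm_ge_zero[of x] by (subst divide_le_eq_1) linarith
      then have "coset Y ((1 / (1 + norm x)) *\<^sub>R x) \<in> K1"
        by (rule K1[OF A[unfolded x], rotated]) simp
      then have "(1 / (1 + norm x)) *\<^sub>R x \<in> H" using small by (simp add: H_def)
      with HS have "(1 / (1 + norm x)) *\<^sub>R x \<in> S" by (rule subsetD)
      then show "A \<in> coset Y ` S" unfolding x by (rule imageI[OF normalize])
    qed
    ultimately have "closed_sublattice (quotient_lattice Y) hull K \<subseteq> coset Y ` S"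
      by (intro hull_minimal)
    then have "range (coset Y) \<subseteq> coset Y ` S" by (simp only: K(2))
    then have "{x. coset Y x \<in> coset Y ` S} = UNIV" by auto
    then show ?thesis by (simp only: pre)
  qed
  with cpt show ?thesis unfolding LWCG_whole_lattice_iff by blast
qed

lemma closure_hull_quotient_subset:
  assumes Z: "subspace Z" "closed Z" "Y \<subseteq> Z" and KZ: "K \<subseteq> coset Y ` Z"
  shows "ns_topology (quotient_lattice Y) closure_of (ns_subspace (quotient_lattice Y) hull K) \<subseteq> coset Y ` Z"
proof -
  have pre: "{x. coset Y x \<in> coset Y ` Z} = Z" by (rule ideal_hull_preimage[OF Y Z(1,3)])
  have ran: "coset Y ` Z \<subseteq> range (coset Y)" by (rule image_mono) simp
  have "ns_subspace (quotient_lattice Y) (coset Y ` Z)"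
    using Z(1) by (simp add: ns_subspace_quotient_iff[OF Y ran] pre)
  then have "ns_subspace (quotient_lattice Y) hull K \<subseteq> coset Y ` Z" by (rule hull_minimal[OF KZ])
  moreover have "closedin (ns_topology (quotient_lattice Y)) (coset Y ` Z)"
    using Z(2) by (simp add: closedin_quotient_iff[OF Y ran] pre)
  ultimately show ?thesis by (rule closure_of_minimal)
qed

text \<open>\<open>L\<close> alone puts \<open>Y\<close> into the closed span \<open>?Z\<close>, so
  \<open>?Z\<close> is the preimage of its image in the quotient. That image is closed and contains
  \<open>K\<close>, because \<open>s\<close> lifts cosets.\<close>

lemma WCG_of_l1_free_ideal:
  assumes oc: "order_continuous (whole_lattice :: 'a nlattice)"
    and l1: "\<not> contains_isomorphic_copy (sub_lattice Y) l1_space"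
    and Q: "WCG (quotient_lattice Y)"
  shows "WCG (whole_lattice :: 'a nlattice)"
proof -
  note sub = closed_ideal_subspace[OF Y] and ne = dual_quotient_nonempty[OF Y]
  obtain K where K: "compactin (weak_topology (quotient_lattice Y)) K"
      "ns_topology (quotient_lattice Y) closure_of (ns_subspace (quotient_lattice Y) hull K) = range (coset Y)"
    using Q unfolding WCG_def quotient_carrier by blast
  have KQ: "K \<subseteq> range (coset Y)"
    using compactin_subset_topspace[OF K(1)] by (simp add: topspace_weak_topology[OF ne] quotient_carrier)
  obtain L where L: "weakly_compact L" "\<And>Z. subspace Z \<Longrightarrow> closed Z \<Longrightarrow> L \<subseteq> Z \<Longrightarrow> Y \<subseteq> Z"
    using weakly_compact_generating_ideal[OF oc Y l1] by blast
  \<comment> \<open>The representative is arbitrary: \<open>band_part\<close> is constant on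
    cosets.\<close>
  define s where "s A = band_part Y (SOME x. x \<in> A)" for A
  have s: "s (coset Y x) = band_part Y x" for x
  proof -
    have "(SOME z. z \<in> coset Y x) \<in> coset Y x" by (rule someI[of _ x]) (rule self_mem_coset[OF Y])
    then have "(SOME z. z \<in> coset Y x) - x \<in> Y" by (simp add: mem_coset[OF Y])
    then show ?thesis unfolding s_def by (rule band_part_cong[OF oc Y])
  qed
  have cs: "coset Y (s A) = A" if "A \<in> range (coset Y)" for A
  proof -
    obtain x where x: "A = coset Y x" using \<open>A \<in> range (coset Y)\<close> by (rule rangeE)
    have "- (x - band_part Y x) \<in> Y" by (rule subspace_neg[OF sub band_part(1)[OF oc Y]])
    then show ?thesis by (simp add: x s coset_eq_iff[OF Y])
  qed
  have "continuous_map (weak_topology (quotient_lattice Y)) (weak_topology (whole_lattice :: 'a nlattice)) s"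
  proof (rule continuous_map_into_weak[OF _ dual_whole_lattice_nonempty])
    fix f :: "'a \<Rightarrow> real" assume "f \<in> dual_carrier whole_lattice"
    then have f: "bounded_linear f" by (simp add: mem_dual_whole_lattice)
    have bl: "bounded_linear (band_part Y)"
    proof (rule bounded_linear_intro[where K = 1])
      show "norm (band_part Y x) \<le> norm x * 1" for x
        using norm_band_part_le[OF oc Y, of x] infdist_ideal_le[OF Y, of x] by simp
    qed (rule band_part_add[OF oc Y] band_part_scaleR[OF oc Y])+
    have zero: "f (band_part Y y) = 0" if y: "y \<in> Y" for y
    proof -
      have "band_part Y y = 0" by (rule band_part_unique[OF oc Y]) (use y in simp_all)
      then show ?thesis using linear_0[OF bounded_linear.linear[OF f]] by simp
    qed
    \<comment> \<open>\<open>f\<close> composed with \<open>band_part Y\<close> is bounded and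
      vanishes on \<open>Y\<close>, so it is a functional on the quotient; this is the weak
      continuity of \<open>s\<close>.\<close>
    obtain g where g: "g \<in> dual_carrier (quotient_lattice Y)" "\<And>x. g (coset Y x) = f (band_part Y x)"
      using mem_dual_quotient[OF Y bounded_linear_compose[OF f bl] zero] by auto
    show "continuous_map (weak_topology (quotient_lattice Y)) euclideanreal (\<lambda>A. f (s A))"
    proof (rule continuous_map_eq[OF continuous_map_weak_functional[OF g(1)]])
      fix A assume "A \<in> topspace (weak_topology (quotient_lattice Y))"
      then obtain x where "A = coset Y x" by (auto simp: topspace_weak_topology[OF ne] quotient_carrier)
      then show "g A = f (s A)" by (simp add: g(2) s)
    qed
  qed simp
  then have "weakly_compact (s ` K)" by (rule image_compactin[OF K(1)])
  then have cpt: "weakly_compact (s ` K \<union> L)" using L(1) by (rule compactin_Un)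
  let ?Z = "closure (span (s ` K \<union> L))"
  have Z: "subspace ?Z" "closed ?Z" by (simp_all add: subspace_closure)
  have KLZ: "s ` K \<union> L \<subseteq> ?Z" by (rule order_trans[OF span_superset closure_subset])
  then have YZ: "Y \<subseteq> ?Z" by (intro L(2)[OF Z]) simp
  have "K \<subseteq> coset Y ` ?Z"
  proof
    fix A assume A: "A \<in> K"
    have "A = coset Y (s A)" using cs[OF subsetD[OF KQ A]] by (rule sym)
    moreover have "s A \<in> ?Z" using KLZ A by auto
    ultimately show "A \<in> coset Y ` ?Z" by (rule image_eqI)
  qed
  from closure_hull_quotient_subset[OF Z YZ this]
  have "range (coset Y) \<subseteq> coset Y ` ?Z" by (simp only: K(2))
  then have "{x. coset Y x \<in> coset Y ` ?Z} = UNIV" by auto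
  then have "?Z = UNIV" by (simp only: ideal_hull_preimage[OF Y Z(1) YZ])
  with cpt show ?thesis unfolding WCG_whole_lattice_iff by blast
qed

end

theorem theorem5p4:
  fixes Y :: "'a::banach_lattice set"
  assumes "closed_ideal Y"
  shows "(LWCG (whole_lattice :: 'a nlattice) \<longrightarrow> LWCG (quotient_lattice Y)) \<and>
         (ns_reflexive (sub_lattice Y) \<and> LWCG (quotient_lattice Y) \<longrightarrow>
            LWCG (whole_lattice :: 'a nlattice)) \<and>
         (order_continuous (whole_lattice :: 'a nlattice) \<and>
            \<not> contains_isomorphic_copy (sub_lattice Y) l1_space \<and>
            WCG (quotient_lattice Y) \<longrightarrow>
            WCG (whole_lattice :: 'a nlattice))"
  using LWCG_quotient[OF assms] LWCG_of_reflexive_ideal[OF assms] WCG_of_l1_free_ideal[OF assms]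
  by blast

end
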